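(* Let $f_1,\dots,f_n:\mathbb{R}^d\to\mathbb{R}$ be differentiable with $\|\nabla f_i(x)-\nabla f_i(y)\|\le \ell\|x-y\|$ for all $x,y$ ($\ell>0$), and let $f=\frac1n\sum_{i=1}^n f_i$ satisfy $f^\ast=\inf f>-\infty$ and the Polyak--Łojasiewicz condition $\frac12\|\nabla f(x)\|^2\ge\nu(f(x)-f^\ast)$ for all $x\in\mathbb R^d$ with some $\nu>0$. Let the communication graph be undirected and connected. Let $\mathcal{C}:\mathbb{R}^d\to\mathbb{R}^d$ be a (possibly random) globally-bounded compressor: for some $r>0$, $C>0$, $\delta\in(0,1]$, $\mathbb E_{\mathcal C}\big[\big\|\frac{\mathcal{C}(x)}{r}-x\big\|^2\big]\le(1-\delta)\|x\|^2+C$ for all $x\in\mathbb R^d$. Let $\{x_{i,k}\}$ be generated by the Unified Compression Algorithm (see context) with $$\alpha\in(0,\hat\kappa_0'),\quad\beta=\tau_1\gamma,\quad\gamma>\kappa_2,\quad\omega\in(0,1/r],\quad s_0\ge\max_i\|x_{i,0}\|_p,\quad s_k=s_0\varepsilon^k,\quad\tau_1\ge\kappa_1,\quad\varepsilon\in(0,1),$$ where $p\ge1$ and the constants are those given in the context. Then, with $\bar x_k=\frac1n\sum_ix_{i,k}$ and $\hat\varepsilon\in(\max\{1-\alpha\varepsilon_6',\varepsilon^2\},1)\subset(0,1)$, $$\mathbb E_{\mathcal C}\Big[f(\bar x_k)-f^\ast+\frac1n\sum_{i=1}^n\|x_{i,k}-\bar x_k\|^2\Big]=\mathcal O(\hat\varepsilon^{k}),$$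 i.e. the left-hand side is at most a constant independent of $k$ times $\hat\varepsilon^k$ for all $k\ge0$.
   Context: Network: $n\ge2$ agents, weighted undirected connected graph with symmetric nonnegative adjacency matrix $A=[A_{ij}]$, $A_{ij}>0$ iff $(j,i)$ is an edge; Laplacian $L=\mathrm{diag}(\sum_jA_{1j},\dots,\sum_j A_{nj})-A=[L_{ij}]$. $\rho(L)$ is the spectral radius, $\rho_2(L)$ the smallest positive eigenvalue. $\|\cdot\|=\|\cdot\|_2$. $\mathbb E_{\mathcal C}$ is the expectation over the internal randomness of the compressor; the randomness of each call of $\mathcal C$ is independent of the past, so that the compressor inequality holds conditionally on the past. Unified Compression Algorithm: positive parameters $\alpha,\beta,\gamma,\omega$, positive sequence $\{s_k\}$; $x_{i,0}\in\mathbb{R}^d$ arbitrary, $v_{i,0}=\hat x_{i,-1}=y_{i,-1}=\mathbf 0_d$. For $k=0,1,\dots$ and each $i$: $q_{i,k}=\mathcal{C}((x_{i,k}-\hat x_{i,k-1})/s_k)$, $\hat x_{i,k}=\hat x_{i,k-1}+\omega s_kq_{i,k}$, $y_{i,k}=y_{i,k-1}+\omega s_k\sum_{j=1}^nL_{ij}q_{j,k}$, $x_{i,k+1}=x_{i,k}-\alpha(\beta y_{i,k}+\gamma v_{i,k}+\nabla f_i(x_{i,k}))$, $v_{i,k+1}=v_{i,k}+\alpha\gamma y_{i,k}$. Constants: $\kappa_1=4/\rho_2(L)$; $\kappa_2=\max\{2+2\ell^2,\ 5/\rho_2(L),\ (16\ell^2(\kappa_1+1)^2/\rho_2(L))^{1/3},\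 2\sqrt2\,\ell/\rho_2(L)\}$; $\varepsilon_9=\omega r\delta/2$; $\varepsilon_{10}=(1-2\varepsilon_9)(1+\varepsilon_9^{-1})$; $\varepsilon_{12}=(\varepsilon_9+2\varepsilon_9^2)/2$; $\varphi_1=\frac12(\rho_2(L)\beta-(3\gamma+2+2\ell^2))$; $\varphi_2'=(3+4\varepsilon_{10})\rho^2(L)\beta^2-\rho_2(L)\beta\gamma+(\rho(L)+2)\gamma^2+1+(\frac52+4\varepsilon_{10})\ell^2$; $\varphi_3=\frac\gamma2-\frac52\rho_2^{-1}(L)$; $\varphi_4'=(2+4\varepsilon_{10})\rho(L)\gamma^2+\frac12\rho(L)$; $\varphi_5=\frac18-\frac{(\beta+\gamma)^2}{\gamma^5}\rho_2^{-1}(L)\ell^2-\frac1{2\gamma^2}\rho_2^{-2}(L)\ell^2$; $\varphi_6=\frac{\beta+\gamma}{2\gamma^3}\rho_2^{-1}(L)\ell^2+\frac1{2\gamma^2}\rho_2^{-2}(L)\ell^2+\frac12\rho_2^{-2}(L)\ell^2+\frac{\ell^2}2+\frac\ell2$; $\varphi_7=(\rho(L)+1)\gamma+\frac12\rho(L)\beta$; $\varphi_8'=(3+4\varepsilon_{10})\rho^2(L)\beta^2+(\rho(L)-2\rho_2(L))\beta\gamma+(\rho(L)+2)\gamma^2+1$; $\hat\kappa_0'=\min\Big\{\frac{\varphi_1}{\varphi_2'},\frac{\varphi_3}{\varphi_4'},\frac{\varphi_5}{\varphi_6},\frac{\sqrt{\varphi_7^2+8\varepsilon_{12}\varphi_8'}-\varphi_7}{2\varphi_8'}\Big\}$;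 $\varepsilon_2=\max\{\frac{1+\tau_1\rho_2(L)}2,\ \frac{1+\tau_1}2+\frac1{2\tau_1\rho_2^2(L)}\}$; $\varepsilon_3'=\min\{\varphi_1-\alpha\varphi_2',\ \varphi_3-\alpha\varphi_4'\}$; $\varepsilon_6'=\min\{\nu/2,\ \varepsilon_3',\ (2\varepsilon_{12}-\alpha\varphi_7-\alpha^2\varphi_8')/\alpha\}/\varepsilon_2$. *)

theory Defs
  imports "HOL-Probability.Probability"
begin

section \<open>Graphs and spectra\<close>

definition adjacency :: "real^'n^'n \<Rightarrow> bool" where
  "adjacency A \<longleftrightarrow> (\<forall>i j. A $ i $ j \<ge> 0) \<and> (\<forall>i j. A $ i $ j = A $ j $ i)"

text \<open>A pair \<open>(j, i)\<close> is an edge iff the weight in row \<open>i\<close>, column \<open>j\<close> is positive.\<close>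

definition edges :: "real^'n^'n \<Rightarrow> ('n \<times> 'n) set" where
  "edges A = {(j, i). A $ i $ j > 0}"

definition connected_graph :: "real^'n^'n \<Rightarrow> bool" where
  "connected_graph A \<longleftrightarrow> (\<forall>i j. (i, j) \<in> (edges A)\<^sup>*)"

definition laplacian :: "real^'n^'n \<Rightarrow> real^'n^'n" where
  "laplacian A = (\<chi> i j. (if i = j then \<Sum>m\<in>UNIV. A $ i $ m else 0) - A $ i $ j)"

definition eigenvalue :: "'a::field^'n^'n \<Rightarrow> 'a \<Rightarrow> bool" where
  "eigenvalue B z \<longleftrightarrow> (\<exists>v. v \<noteq> 0 \<and> B *v v = z *s v)"

text \<open>The spectral radius of a real matrix ranges over its complex eigenvalues.\<close>

definition spectral_radius :: "real^'n^'n \<Rightarrow> real" where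
  "spectral_radius B = Sup {cmod z | z. eigenvalue (map_matrix complex_of_real B) z}"

definition least_pos_eigenvalue :: "real^'n^'n \<Rightarrow> real" where
  "least_pos_eigenvalue B = (LEAST z. 0 < z \<and> eigenvalue B z)"

section \<open>Norms, gradients, averages over the agents\<close>

definition p_norm :: "ereal \<Rightarrow> real^'d \<Rightarrow> real" where
  "p_norm p x = (if p = \<infinity> then infnorm x
     else (\<Sum>i\<in>UNIV. \<bar>x $ i\<bar> powr real_of_ereal p) powr (1 / real_of_ereal p))"

definition gradient :: "('a::real_inner \<Rightarrow> real) \<Rightarrow> 'a \<Rightarrow> 'a" where
  "gradient f x = (THE g. GDERIV f x :> g)"

definition agent_avg :: "('n::finite \<Rightarrow> 'a::real_vector) \<Rightarrow> 'a" where
  "agent_avg z = (1 / real CARD('n)) *\<^sub>R (\<Sum>i\<in>UNIV. z i)"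

section \<open>Random compressors\<close>

text \<open>A random compressor is a jointly measurable map \<open>Q\<close> of a random seed with law \<open>D\<close> and of
  the vector to be compressed; a deterministic compressor ignores the seed.\<close>

definition globally_bounded_compressor ::
  "'s measure \<Rightarrow> ('s \<Rightarrow> real^'d \<Rightarrow> real^'d) \<Rightarrow> real \<Rightarrow> real \<Rightarrow> real \<Rightarrow> bool" where
  "globally_bounded_compressor D Q r \<delta> C \<longleftrightarrow>
     prob_space D \<and> case_prod Q \<in> borel_measurable (D \<Otimes>\<^sub>M borel) \<and>
     (\<forall>x. integrable D (\<lambda>\<sigma>. (norm (Q \<sigma> x /\<^sub>R r - x))\<^sup>2) \<and>
          (LINT \<sigma>|D. (norm (Q \<sigma> x /\<^sub>R r - x))\<^sup>2) \<le> (1 - \<delta>) * (norm x)\<^sup>2 + C)"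

text \<open>The call of agent \<open>i\<close> at time \<open>k\<close> uses the seed \<open>\<xi> (i, k)\<close>, which has law \<open>D\<close> and is
  independent of all seeds used before time \<open>k\<close>. Seeds of different agents at the same time may
  depend on each other. The one-element product is used because \<^const>\<open>prob_space.indep_var\<close>
  requires both random variables to have the same type.\<close>

definition fresh_seeds :: "'w measure \<Rightarrow> 's measure \<Rightarrow> ('n \<times> nat \<Rightarrow> 'w \<Rightarrow> 's) \<Rightarrow> bool" where
  "fresh_seeds M D \<xi> \<longleftrightarrow>
     (\<forall>c. \<xi> c \<in> measurable M D \<and> distr M D (\<xi> c) = D) \<and>
     (\<forall>i k. prob_space.indep_var M
        (PiM {(i, k)} (\<lambda>_. D)) (\<lambda>w. \<lambda>c\<in>{(i, k)}. \<xi> c w)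
        (PiM (UNIV \<times> {..<k}) (\<lambda>_. D)) (\<lambda>w. \<lambda>c\<in>UNIV \<times> {..<k}. \<xi> c w))"

section \<open>The algorithm\<close>

text \<open>\<open>prev z k\<close> is the value of \<open>z\<close> at index \<open>k - 1\<close>, with value \<open>0\<close> at index \<open>-1\<close>.\<close>

definition prev :: "(nat \<Rightarrow> 'a::zero) \<Rightarrow> nat \<Rightarrow> 'a" where
  "prev z k = (case k of 0 \<Rightarrow> 0 | Suc j \<Rightarrow> z j)"

text \<open>\<open>Q i k\<close> is the realization of the compressor in the call of agent \<open>i\<close> at time \<open>k\<close>, \<open>gf i\<close>
  the gradient of the cost of agent \<open>i\<close>.\<close>

definition unified_compression_algorithm ::
  "real^'n^'n \<Rightarrow> ('n \<Rightarrow> real^'d \<Rightarrow> real^'d) \<Rightarrow> ('n \<Rightarrow> nat \<Rightarrow> real^'d \<Rightarrow> real^'d) \<Rightarrow>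
   real \<Rightarrow> real \<Rightarrow> real \<Rightarrow> real \<Rightarrow> (nat \<Rightarrow> real) \<Rightarrow> ('n \<Rightarrow> real^'d) \<Rightarrow>
   ('n \<Rightarrow> nat \<Rightarrow> real^'d) \<Rightarrow> ('n \<Rightarrow> nat \<Rightarrow> real^'d) \<Rightarrow> ('n \<Rightarrow> nat \<Rightarrow> real^'d) \<Rightarrow>
   ('n \<Rightarrow> nat \<Rightarrow> real^'d) \<Rightarrow> ('n \<Rightarrow> nat \<Rightarrow> real^'d) \<Rightarrow> bool" where
  "unified_compression_algorithm L gf Q \<alpha> \<beta> \<gamma> \<omega> s x0 x v q xhat y \<longleftrightarrow>
     (\<forall>i. x i 0 = x0 i \<and> v i 0 = 0) \<and>
     (\<forall>i k.
        q i k = Q i k ((x i k - prev (xhat i) k) /\<^sub>R s k) \<and>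
        xhat i k = prev (xhat i) k + (\<omega> * s k) *\<^sub>R q i k \<and>
        y i k = prev (y i) k + (\<omega> * s k) *\<^sub>R (\<Sum>j\<in>UNIV. L $ i $ j *\<^sub>R q j k) \<and>
        x i (Suc k) = x i k - \<alpha> *\<^sub>R (\<beta> *\<^sub>R y i k + \<gamma> *\<^sub>R v i k + gf i (x i k)) \<and>
        v i (Suc k) = v i k + (\<alpha> * \<gamma>) *\<^sub>R y i k)"

section \<open>Constants\<close>

text \<open>Throughout, \<open>\<rho>\<close> and \<open>\<rho>2\<close> stand for the spectral radius and the smallest positive
  eigenvalue of the Laplacian, \<open>l\<close> for the Lipschitz constant of the gradients, and
  \<open>e9\<close>, \<open>e10\<close>, \<open>e12\<close> for the values of \<open>eps9\<close>, \<open>eps10\<close>, \<open>eps12\<close>.\<close>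

definition kappa1 :: "real \<Rightarrow> real" where
  "kappa1 \<rho>2 = 4 / \<rho>2"

definition kappa2 :: "real \<Rightarrow> real \<Rightarrow> real" where
  "kappa2 \<rho>2 l = Max {2 + 2 * l\<^sup>2, 5 / \<rho>2, root 3 (16 * l\<^sup>2 * (kappa1 \<rho>2 + 1)\<^sup>2 / \<rho>2),
     2 * sqrt 2 * l / \<rho>2}"

definition eps9 :: "real \<Rightarrow> real \<Rightarrow> real \<Rightarrow> real" where
  "eps9 \<omega> r \<delta> = \<omega> * r * \<delta> / 2"

definition eps10 :: "real \<Rightarrow> real" where
  "eps10 e9 = (1 - 2 * e9) * (1 + 1 / e9)"

definition eps12 :: "real \<Rightarrow> real" where
  "eps12 e9 = (e9 + 2 * e9\<^sup>2) / 2"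

definition phi1 :: "real \<Rightarrow> real \<Rightarrow> real \<Rightarrow> real \<Rightarrow> real" where
  "phi1 \<rho>2 l \<beta> \<gamma> = (\<rho>2 * \<beta> - (3 * \<gamma> + 2 + 2 * l\<^sup>2)) / 2"

definition phi2' :: "real \<Rightarrow> real \<Rightarrow> real \<Rightarrow> real \<Rightarrow> real \<Rightarrow> real \<Rightarrow> real" where
  "phi2' \<rho> \<rho>2 l e10 \<beta> \<gamma> = (3 + 4 * e10) * \<rho>\<^sup>2 * \<beta>\<^sup>2 - \<rho>2 * \<beta> * \<gamma> + (\<rho> + 2) * \<gamma>\<^sup>2 + 1
     + (5 / 2 + 4 * e10) * l\<^sup>2"

definition phi3 :: "real \<Rightarrow> real \<Rightarrow> real" where
  "phi3 \<rho>2 \<gamma> = \<gamma> / 2 - 5 / (2 * \<rho>2)"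

definition phi4' :: "real \<Rightarrow> real \<Rightarrow> real \<Rightarrow> real" where
  "phi4' \<rho> e10 \<gamma> = (2 + 4 * e10) * \<rho> * \<gamma>\<^sup>2 + \<rho> / 2"

definition phi5 :: "real \<Rightarrow> real \<Rightarrow> real \<Rightarrow> real \<Rightarrow> real" where
  "phi5 \<rho>2 l \<beta> \<gamma> = 1 / 8 - (\<beta> + \<gamma>)\<^sup>2 / \<gamma> ^ 5 * (1 / \<rho>2) * l\<^sup>2
     - 1 / (2 * \<gamma>\<^sup>2) * (1 / \<rho>2\<^sup>2) * l\<^sup>2"

definition phi6 :: "real \<Rightarrow> real \<Rightarrow> real \<Rightarrow> real \<Rightarrow> real" where
  "phi6 \<rho>2 l \<beta> \<gamma> = (\<beta> + \<gamma>) / (2 * \<gamma> ^ 3) * (1 / \<rho>2) * l\<^sup>2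
     + 1 / (2 * \<gamma>\<^sup>2) * (1 / \<rho>2\<^sup>2) * l\<^sup>2 + 1 / 2 * (1 / \<rho>2\<^sup>2) * l\<^sup>2 + l\<^sup>2 / 2 + l / 2"

definition phi7 :: "real \<Rightarrow> real \<Rightarrow> real \<Rightarrow> real" where
  "phi7 \<rho> \<beta> \<gamma> = (\<rho> + 1) * \<gamma> + \<rho> * \<beta> / 2"

definition phi8' :: "real \<Rightarrow> real \<Rightarrow> real \<Rightarrow> real \<Rightarrow> real \<Rightarrow> real" where
  "phi8' \<rho> \<rho>2 e10 \<beta> \<gamma> = (3 + 4 * e10) * \<rho>\<^sup>2 * \<beta>\<^sup>2 + (\<rho> - 2 * \<rho>2) * \<beta> * \<gamma> + (\<rho> + 2) * \<gamma>\<^sup>2 + 1"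

definition kappa0hat' :: "real \<Rightarrow> real \<Rightarrow> real \<Rightarrow> real \<Rightarrow> real \<Rightarrow> real \<Rightarrow> real \<Rightarrow> real" where
  "kappa0hat' \<rho> \<rho>2 l e10 e12 \<beta> \<gamma> =
     Min {phi1 \<rho>2 l \<beta> \<gamma> / phi2' \<rho> \<rho>2 l e10 \<beta> \<gamma>,
          phi3 \<rho>2 \<gamma> / phi4' \<rho> e10 \<gamma>,
          phi5 \<rho>2 l \<beta> \<gamma> / phi6 \<rho>2 l \<beta> \<gamma>,
          (sqrt ((phi7 \<rho> \<beta> \<gamma>)\<^sup>2 + 8 * e12 * phi8' \<rho> \<rho>2 e10 \<beta> \<gamma>) - phi7 \<rho> \<beta> \<gamma>)
            / (2 * phi8' \<rho> \<rho>2 e10 \<beta> \<gamma>)}"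

definition eps2 :: "real \<Rightarrow> real \<Rightarrow> real" where
  "eps2 \<rho>2 \<tau>1 = max ((1 + \<tau>1 * \<rho>2) / 2) ((1 + \<tau>1) / 2 + 1 / (2 * \<tau>1 * \<rho>2\<^sup>2))"

definition eps3' :: "real \<Rightarrow> real \<Rightarrow> real \<Rightarrow> real \<Rightarrow> real \<Rightarrow> real \<Rightarrow> real \<Rightarrow> real" where
  "eps3' \<rho> \<rho>2 l e10 \<alpha> \<beta> \<gamma> = min (phi1 \<rho>2 l \<beta> \<gamma> - \<alpha> * phi2' \<rho> \<rho>2 l e10 \<beta> \<gamma>)
     (phi3 \<rho>2 \<gamma> - \<alpha> * phi4' \<rho> e10 \<gamma>)"

definition eps6' ::
  "real \<Rightarrow> real \<Rightarrow> real \<Rightarrow> real \<Rightarrow> real \<Rightarrow> real \<Rightarrow> real \<Rightarrow> real \<Rightarrow> real \<Rightarrow> real \<Rightarrow> real" where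
  "eps6' \<rho> \<rho>2 l \<nu> e10 e12 \<tau>1 \<alpha> \<beta> \<gamma> =
     Min {\<nu> / 2, eps3' \<rho> \<rho>2 l e10 \<alpha> \<beta> \<gamma>,
          (2 * e12 - \<alpha> * phi7 \<rho> \<beta> \<gamma> - \<alpha>\<^sup>2 * phi8' \<rho> \<rho>2 e10 \<beta> \<gamma>) / \<alpha>} / eps2 \<rho>2 \<tau>1"

end

theory Submission
  imports Defs
begin

text \<open>Stack the agents' states, let \<open>X\<close> be the deviation of \<open>x\<close> from its mean, \<open>w = v + g0 / \<gamma>\<close> with \<open>g0\<close>
  the local gradients at the mean, \<open>P\<close> the pseudo-inverse of the Laplacian \<open>L\<close>, \<open>u = P w\<close>, and \<open>e = x - xhat\<close>.
  Since \<open>y = L xhat\<close>, the function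
  \<open>V = |X|^2 / 2 + (1 + \<tau>1) / 2 * (u \<bullet> L u) + X \<bullet> u + n (f(mean) - fstar) + |e|^2\<close>
  is controlled in two stages: along every path the next value of \<open>V - |e|^2\<close>, plus \<open>1 - 2 * e9\<close> times the squared distance
  of the new \<open>x\<close> to the old \<open>xhat\<close>, is at most \<open>(1 - \<alpha> * eps6') V\<close>; and in expectation a compressor call
  shrinks that squared distance by \<open>1 - 2 * e9\<close> up to a constant multiple of \<open>s k ^ 2\<close>.
  Hence \<open>E V\<close> satisfies a linear recursion with a forcing term of order \<open>\<epsilon> ^ (2 * k)\<close>.\<close>

section \<open>Gradients\<close>

text \<open>At rest the centered part of \<open>\<gamma> v + g0\<close> vanishes, so
  \<open>w\<close> measures how far the integral action is from compensating the disagreement of the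
  gradients; apart from the update of \<open>v\<close> it drifts only because the mean moves. The
  cross term \<open>X \<bullet> u\<close> is the source of dissipation in \<open>u\<close>: it alone
  contributes \<open>- \<gamma> (u \<bullet> L u)\<close>. The constants are prescribed, so every
  Young weight is chosen to land on \<open>phi1\<close> to \<open>phi8'\<close>. The pieces are tied
  together by two reserves. The disagreement estimate leaves \<open>2 / 5 * l^2\<close> of
  \<open>|X|^2\<close> unspent, which pays for replacing the averaged gradient by the gradient of
  the mean cost. In return the descent of that cost leaves \<open>3 / 20\<close> of the squared
  averaged gradient: \<open>1 / 8\<close> for the drift of \<open>w\<close> and the curvature of the
  cost, \<open>1 / 40\<close> for the growth of the compression error caused by the moving mean.
  Simultaneous compressor calls of different agents may be dependent, so the compressor inequality
  is applied agent by agent and the results are only added.\<close>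

lemma gradient_eqI:
  assumes "GDERIV f z :> D"
  shows "gradient f z = D"
  unfolding gradient_def
proof (rule the_equality)
  show "GDERIV f z :> D"
    by (rule assms)
  fix D'
  assume "GDERIV f z :> D'"
  then have "(\<lambda>h. h \<bullet> D') = (\<lambda>h. h \<bullet> D)"
    using assms unfolding gderiv_def by (rule has_derivative_unique)
  then have "\<forall>h. h \<bullet> D' = h \<bullet> D"
    by meson
  then show "D' = D"
    by (simp only: vector_eq_ldot)
qed

text \<open>Riesz representation: the derivative is a linear functional, represented by the vector
  \<open>adjoint f' 1\<close>. This makes the definite description \<open>gradient\<close> usable
  under plain differentiability.\<close>

lemma gderiv_gradient:
  fixes f :: "'a::euclidean_space \<Rightarrow> real"
  assumes "f differentiable (at z)"
  shows "GDERIV f z :> gradient f z"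
proof -
  obtain f' where f': "(f has_derivative f') (at z)"
    using assms by (auto simp: differentiable_def)
  then have "linear f'"
    by (rule has_derivative_linear)
  then have "f' = (\<lambda>h. h \<bullet> adjoint f' 1)"
    using adjoint_works[of f' _ 1] by (auto simp: fun_eq_iff)
  with f' have "GDERIV f z :> adjoint f' 1"
    by (simp add: gderiv_def)
  with gradient_eqI[OF this] show ?thesis
    by simp
qed

lemma gderiv_agent_avg:
  fixes f :: "'n::finite \<Rightarrow> 'a::real_inner \<Rightarrow> real"
  assumes "\<And>i. GDERIV (f i) z :> g i"
  shows "GDERIV (\<lambda>z. agent_avg (\<lambda>i. f i z)) z :> agent_avg g"
proof -
  have "((\<lambda>z. (1 / real CARD('n)) *\<^sub>R (\<Sum>i\<in>UNIV. f i z)) has_derivative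
      (\<lambda>h. (1 / real CARD('n)) *\<^sub>R (\<Sum>i\<in>UNIV. h \<bullet> g i))) (at z)"
    by (intro has_derivative_scaleR_right has_derivative_sum) (use assms in \<open>simp add: gderiv_def\<close>)
  then show ?thesis
    by (simp add: gderiv_def agent_avg_def inner_sum_right)
qed

lemma descent_inequality:
  fixes F :: "'a::euclidean_space \<Rightarrow> real"
  assumes gd: "\<And>z. GDERIV F z :> g z"
    and lip: "\<And>z z'. norm (g z - g z') \<le> l * norm (z - z')"
  shows "F (x + h) \<le> F x + h \<bullet> g x + l / 2 * (norm h)\<^sup>2"
proof -
  define \<phi> where "\<phi> t = F (x + t *\<^sub>R h) - t * (h \<bullet> g x) - l / 2 * t\<^sup>2 * (norm h)\<^sup>2" for t
  have der: "(\<phi> has_real_derivative (h \<bullet> g (x + t *\<^sub>R h) - h \<bullet> g x - l * t * (norm h)\<^sup>2)) (at t)"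
    for t
  proof -
    have "((\<lambda>t. x + t *\<^sub>R h) has_derivative (\<lambda>s. s *\<^sub>R h)) (at t)"
      by (auto intro!: derivative_eq_intros)
    then have "((\<lambda>t. F (x + t *\<^sub>R h)) has_derivative (\<lambda>s. (s *\<^sub>R h) \<bullet> g (x + t *\<^sub>R h))) (at t)"
      using gd[of "x + t *\<^sub>R h", unfolded gderiv_def] by (rule has_derivative_compose)
    then have "((\<lambda>t. F (x + t *\<^sub>R h)) has_real_derivative (h \<bullet> g (x + t *\<^sub>R h))) (at t)"
      by (simp add: has_field_derivative_def mult.commute[of _ "h \<bullet> g (x + t *\<^sub>R h)"])
    then show ?thesis
      unfolding \<phi>_def by (auto intro!: derivative_eq_intros)
  qed
  have "\<phi> 1 \<le> \<phi> 0"
  proof (rule DERIV_nonpos_imp_nonincreasing[of 0 1 \<phi>])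
    fix t :: real
    assume t: "0 \<le> t" "t \<le> 1"
    have "h \<bullet> (g (x + t *\<^sub>R h) - g x) \<le> norm h * norm (g (x + t *\<^sub>R h) - g x)"
      by (rule norm_cauchy_schwarz)
    also have "\<dots> \<le> norm h * (l * norm (t *\<^sub>R h))"
      using lip[of "x + t *\<^sub>R h" x] by (intro mult_left_mono) auto
    finally have "h \<bullet> g (x + t *\<^sub>R h) - h \<bullet> g x - l * t * (norm h)\<^sup>2 \<le> 0"
      using t by (simp add: inner_diff_right power2_eq_square mult_ac)
    with der show "\<exists>y. (\<phi> has_real_derivative y) (at t) \<and> y \<le> 0"
      by blast
  qed auto
  then show ?thesis
    by (simp add: \<phi>_def)
qed

section \<open>Extreme eigenvalues of self-adjoint maps\<close>

text \<open>A minimizer \<open>v\<close> of the Rayleigh quotient on the unit sphere of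
  \<open>S\<close> is an eigenvector: moving against the residual \<open>T v - \<mu> v\<close> would
  otherwise lower the quotient to first order, and invariance keeps this residual in
  \<open>S\<close>. Applied to \<open>- L\<close> on \<open>UNIV\<close> and to \<open>L\<close> on
  the zero-sum vectors, it gives both spectral bounds.\<close>

lemma rayleigh_minimizer:
  fixes T :: "'a::euclidean_space \<Rightarrow> 'a"
  assumes lin: "linear T" and adj: "\<And>x y. T x \<bullet> y = x \<bullet> T y"
    and S: "subspace S" and inv: "\<And>x. x \<in> S \<Longrightarrow> T x \<in> S" and ne: "w \<in> S" "w \<noteq> 0"
  obtains v \<mu> where "v \<in> S" "v \<noteq> 0" "T v = \<mu> *\<^sub>R v" "\<And>x. x \<in> S \<Longrightarrow> \<mu> * (norm x)\<^sup>2 \<le> x \<bullet> T x"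
proof -
  interpret T: linear T by (rule lin)
  have "compact (sphere 0 1 \<inter> S)"
    using closed_subspace[OF S] by (intro compact_Int_closed) auto
  moreover have "inverse (norm w) *\<^sub>R w \<in> sphere 0 1 \<inter> S"
    using ne S by (auto simp: subspace_scale)
  moreover have "continuous_on (sphere 0 1 \<inter> S) (\<lambda>x. x \<bullet> T x)"
    by (intro continuous_intros linear_continuous_on[OF lin[unfolded linear_conv_bounded_linear]])
  ultimately obtain v where v: "v \<in> sphere 0 1 \<inter> S"
    and min: "\<And>x. x \<in> sphere 0 1 \<inter> S \<Longrightarrow> v \<bullet> T v \<le> x \<bullet> T x"
    using continuous_attains_inf[of "sphere 0 1 \<inter> S" "\<lambda>x. x \<bullet> T x"] by blast
  define \<mu> where "\<mu> = v \<bullet> T v"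
  have le: "\<mu> * (norm x)\<^sup>2 \<le> x \<bullet> T x" if "x \<in> S" for x
  proof (cases "x = 0")
    case False
    have "inverse (norm x) *\<^sub>R x \<in> sphere 0 1 \<inter> S"
      using that False S by (auto simp: subspace_scale)
    then have "\<mu> \<le> (inverse (norm x))\<^sup>2 * (x \<bullet> T x)"
      using min by (fastforce simp: \<mu>_def T.scaleR power2_eq_square)
    then show ?thesis
      using False by (simp add: field_simps)
  qed simp
  define z where "z = T v - \<mu> *\<^sub>R v"
  define b where "b = z \<bullet> T z - \<mu> * (norm z)\<^sup>2"
  have zS: "z \<in> S"
    using v inv S by (auto simp: z_def subspace_diff subspace_scale)
  then have b: "b \<ge> 0"
    using le by (simp add: b_def)
  have zz: "(norm z)\<^sup>2 = z \<bullet> z"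
    by (rule power2_norm_eq_inner)
  have vv: "v \<bullet> v = 1"
    using v by (simp add: dot_square_norm)
  \<comment> \<open>Minimality tested at \<open>v - s z\<close>; the terms free of \<open>s\<close>
    cancel because \<open>v\<close> is a unit vector with value \<open>\<mu>\<close>.\<close>
  have key: "0 \<le> - (2 * s * (z \<bullet> z)) + s\<^sup>2 * b" for s
  proof -
    have "v - s *\<^sub>R z \<in> S"
      using v zS S by (auto simp: subspace_diff subspace_scale)
    then have "\<mu> * ((v - s *\<^sub>R z) \<bullet> (v - s *\<^sub>R z)) \<le> (v - s *\<^sub>R z) \<bullet> T (v - s *\<^sub>R z)"
      using le by (simp add: dot_square_norm)
    moreover have "z \<bullet> T v = z \<bullet> z + \<mu> * (z \<bullet> v)"
      by (simp add: z_def inner_diff_right)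
    moreover have "v \<bullet> T z = z \<bullet> T v"
      using adj[of v z] by (simp add: inner_commute)
    ultimately show ?thesis
      using vv unfolding b_def zz
      by (simp add: T.diff T.scaleR inner_diff_left inner_diff_right
          \<mu>_def[symmetric] inner_commute[of v z] algebra_simps power2_eq_square)
  qed
  have "z \<bullet> z = 0"
  proof (rule ccontr)
    assume "z \<bullet> z \<noteq> 0"
    then have a: "z \<bullet> z > 0" by simp
    \<comment> \<open>Any positive \<open>t\<close> with \<open>t b < 2 (z \<bullet> z)\<close>
      contradicts \<open>key\<close>; the \<open>+ 1\<close> covers the case
      \<open>b = 0\<close>.\<close>
    define t where "t = z \<bullet> z / (b + 1)"
    have "t > 0"
      using a b by (simp add: t_def)
    have "0 \<le> t * (t * b - 2 * (z \<bullet> z))"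
      using key[of t] by (simp add: right_diff_distrib power2_eq_square mult_ac)
    then have "2 * (z \<bullet> z) \<le> t * b"
      using \<open>t > 0\<close> by (simp add: zero_le_mult_iff)
    also have "\<dots> \<le> t * (b + 1)"
      using \<open>t > 0\<close> by simp
    also have "\<dots> = z \<bullet> z"
      using b by (simp add: t_def)
    finally show False using a by simp
  qed
  then have "T v = \<mu> *\<^sub>R v"
    by (simp add: z_def)
  moreover have "v \<in> S" "v \<noteq> 0"
    using v by auto
  ultimately show ?thesis
    using that le by blast
qed

section \<open>The Laplacian acting on stacked vectors\<close>

text \<open>The Kronecker product of \<open>B\<close> with the identity: a stacked vector has one
  block per agent, and \<open>B\<close> mixes blocks without mixing the coordinates inside
  them.\<close>

definition mat_act :: "real^'n^'m \<Rightarrow> 'a::real_vector^'n \<Rightarrow> 'a^'m" where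
  "mat_act B x = (\<chi> i. \<Sum>j\<in>UNIV. B $ i $ j *\<^sub>R x $ j)"

text \<open>The orthogonal projection onto the complement of consensus, that is, onto the stacks
  whose blocks sum to zero.\<close>

definition center :: "'a::real_vector^'n \<Rightarrow> 'a^'n" where
  "center x = (\<chi> i. x $ i - agent_avg (($) x))"

lemma linear_mat_act: "linear (mat_act B :: 'a::real_vector^'n \<Rightarrow> 'a^'m)"
  by (rule linearI) (auto simp: mat_act_def vec_eq_iff scaleR_add_right sum.distrib scaleR_sum_right mult.commute)

lemma sum_agent_avg: "(\<Sum>i\<in>(UNIV::'n::finite set). (agent_avg z :: 'a::real_vector)) = (\<Sum>i\<in>(UNIV::'n set). z i)"
  by (simp only: sum_constant_scaleR agent_avg_def) simp

lemma agent_avg_const: "agent_avg (\<lambda>i. c) = c"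
  by (simp add: agent_avg_def sum_constant_scaleR)

lemma sum_center [simp]: "(\<Sum>i\<in>UNIV. center x $ i) = 0"
  by (simp add: center_def sum_subtractf sum_agent_avg)

lemma linear_center: "linear (center :: 'a::real_vector^'n \<Rightarrow> 'a^'n)"
  by (rule linearI)
    (auto simp: center_def vec_eq_iff agent_avg_def sum.distrib scaleR_add_right scaleR_diff_right
      scaleR_sum_right mult.commute)

lemma center_id: "(\<Sum>i\<in>UNIV. x $ i) = 0 \<Longrightarrow> center x = x"
  by (simp add: center_def vec_eq_iff agent_avg_def)

text \<open>Pythagoras: the centered part has block sum zero and is therefore orthogonal to the
  constant stack \<open>cc\<close>.\<close>

lemma norm_square_center:
  fixes x :: "'a::real_inner^'n"
  shows "(norm x)\<^sup>2 = (norm (center x))\<^sup>2 + real CARD('n) * (norm (agent_avg (($) x)))\<^sup>2"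
proof -
  define c where "c = agent_avg (($) x)"
  define cc :: "'a^'n" where "cc = (\<chi> i. c)"
  have "x = center x + cc"
    by (simp add: center_def c_def cc_def vec_eq_iff)
  then have "x \<bullet> x = (center x + cc) \<bullet> (center x + cc)"
    by simp
  also have "\<dots> = center x \<bullet> center x + 2 * (center x \<bullet> cc) + cc \<bullet> cc"
    by (simp add: inner_add_left inner_add_right inner_commute)
  also have "center x \<bullet> cc = 0"
    by (simp only: cc_def inner_vec_def vec_lambda_beta inner_sum_left[symmetric] sum_center inner_zero_left)
  also have "cc \<bullet> cc = real CARD('n) * (c \<bullet> c)"
    by (simp add: cc_def inner_vec_def)
  finally show ?thesis
    by (simp add: power2_norm_eq_inner c_def)
qed

lemma norm_center_le:
  fixes x :: "'a::real_inner^'n"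
  shows "norm (center x) \<le> norm x"
proof (rule power2_le_imp_le)
  have "0 \<le> real CARD('n) * (norm (agent_avg (($) x)))\<^sup>2"
    by simp
  then show "(norm (center x))\<^sup>2 \<le> (norm x)\<^sup>2"
    using norm_square_center[of x] by linarith
qed simp

lemma mat_act_laplacian:
  "mat_act (laplacian A) x $ i = (\<Sum>j\<in>UNIV. A $ i $ j *\<^sub>R (x $ i - x $ j))"
proof -
  have "mat_act (laplacian A) x $ i
      = (\<Sum>j\<in>UNIV. if i = j then (\<Sum>m\<in>UNIV. A $ i $ m) *\<^sub>R x $ j else 0) - (\<Sum>j\<in>UNIV. A $ i $ j *\<^sub>R x $ j)"
    by (simp add: mat_act_def laplacian_def scaleR_diff_left sum_subtractf if_distrib[of "\<lambda>c. c *\<^sub>R _"] cong: if_cong)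
  then show ?thesis
    by (simp add: scaleR_sum_left scaleR_diff_right sum_subtractf)
qed

text \<open>Swapping the indices and using symmetric weights gives a second expression for the same
  inner product; the mean of both is the edge sum. Self-adjointness, nonnegativity and the kernel
  are read off from it.\<close>

lemma inner_laplacian:
  fixes x y :: "'a::real_inner^'n"
  assumes "adjacency A"
  shows "x \<bullet> mat_act (laplacian A) y
    = (\<Sum>i\<in>UNIV. \<Sum>j\<in>UNIV. A $ i $ j * ((x $ i - x $ j) \<bullet> (y $ i - y $ j))) / 2"
proof -
  have sym: "A $ i $ j = A $ j $ i" for i j
    using assms by (simp add: adjacency_def)
  define S where "S = x \<bullet> mat_act (laplacian A) y"
  have 1: "S = (\<Sum>i\<in>UNIV. \<Sum>j\<in>UNIV. A $ i $ j * (x $ i \<bullet> (y $ i - y $ j)))"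
    by (simp add: S_def inner_vec_def mat_act_laplacian inner_sum_right)
  also have "\<dots> = (\<Sum>j\<in>UNIV. \<Sum>i\<in>UNIV. A $ i $ j * (x $ i \<bullet> (y $ i - y $ j)))"
    by (rule sum.swap)
  also have "\<dots> = (\<Sum>i\<in>UNIV. \<Sum>j\<in>UNIV. A $ i $ j * (x $ j \<bullet> (y $ j - y $ i)))"
    by (intro sum.cong refl) (subst sym, simp)
  finally have 2: "S = (\<Sum>i\<in>UNIV. \<Sum>j\<in>UNIV. A $ i $ j * (x $ j \<bullet> (y $ j - y $ i)))" .
  have "S + S = (\<Sum>i\<in>UNIV. \<Sum>j\<in>UNIV. A $ i $ j * (x $ i \<bullet> (y $ i - y $ j))
      + A $ i $ j * (x $ j \<bullet> (y $ j - y $ i)))"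
    unfolding sum.distrib using 1 2 by simp
  also have "\<dots> = (\<Sum>i\<in>UNIV. \<Sum>j\<in>UNIV. A $ i $ j * ((x $ i - x $ j) \<bullet> (y $ i - y $ j)))"
    by (intro sum.cong refl) (simp add: inner_diff_left inner_diff_right algebra_simps)
  finally have "S + S = (\<Sum>i\<in>UNIV. \<Sum>j\<in>UNIV. A $ i $ j * ((x $ i - x $ j) \<bullet> (y $ i - y $ j)))" .
  then show ?thesis
    by (simp add: S_def)
qed

text \<open>The edge sum vanishes when one argument is a constant stack; with the block sum itself
  as that constant, its own square is zero.\<close>

lemma sum_laplacian [simp]:
  fixes x :: "'a::real_inner^'n"
  assumes "adjacency A"
  shows "(\<Sum>i\<in>UNIV. mat_act (laplacian A) x $ i) = 0"
proof -
  let ?s = "\<Sum>i\<in>UNIV. mat_act (laplacian A) x $ i"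
  have "?s \<bullet> ?s = (\<chi> i. ?s) \<bullet> mat_act (laplacian A) x"
    by (simp add: inner_vec_def inner_sum_right)
  also have "\<dots> = 0"
    by (simp add: inner_laplacian[OF assms])
  finally show ?thesis by simp
qed

lemma laplacian_center:
  "mat_act (laplacian A) (center x) = mat_act (laplacian A) x"
  by (simp add: vec_eq_iff mat_act_laplacian center_def)

text \<open>All edge terms are nonnegative, so each of them vanishes when the form does; equality of
  blocks then spreads along paths.\<close>

lemma laplacian_eq_zero_imp_const:
  fixes x :: "'a::real_inner^'n"
  assumes A: "adjacency A" "connected_graph A" and 0: "x \<bullet> mat_act (laplacian A) x = 0"
  shows "x $ i = x $ j"
proof -
  have nn: "0 \<le> A $ i $ j * ((x $ i - x $ j) \<bullet> (x $ i - x $ j))" for i j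
    using A by (simp add: adjacency_def)
  have "\<forall>i\<in>UNIV. (\<Sum>j\<in>UNIV. A $ i $ j * ((x $ i - x $ j) \<bullet> (x $ i - x $ j))) = 0"
    using 0 by (subst sum_nonneg_eq_0_iff[symmetric])
      (auto intro!: sum_nonneg nn simp: inner_laplacian[OF A(1)])
  then have 0: "A $ i $ j * ((x $ i - x $ j) \<bullet> (x $ i - x $ j)) = 0" for i j
    using nn by (subst (asm) sum_nonneg_eq_0_iff) auto
  then have edge: "x $ i = x $ j" if "(i, j) \<in> edges A" for i j
    using that 0[of j i] by (auto simp: edges_def)
  have "(i, j) \<in> (edges A)\<^sup>*"
    using A by (simp add: connected_graph_def)
  then show ?thesis
    by (induction rule: rtrancl_induct) (auto dest: edge)
qed

section \<open>Eigenvalues of the Laplacian and of its action on stacked vectors\<close>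

lemma mat_act_eigenvector_imp_eigenvalue:
  fixes v :: "'a::euclidean_space^'n"
  assumes "mat_act B v = \<mu> *\<^sub>R v" "v \<noteq> 0"
  shows "eigenvalue B \<mu>"
proof -
  obtain i where "v $ i \<noteq> 0"
    using assms(2) by (auto simp: vec_eq_iff)
  \<comment> \<open>Pairing every block with one direction \<open>b\<close> projects the stacked
    eigenvector to an eigenvector of \<open>B\<close>; \<open>b\<close> is chosen to keep it
    nonzero.\<close>
  then obtain b where b: "v $ i \<bullet> b \<noteq> 0"
    using euclidean_all_zero_iff by blast
  have "(\<Sum>j\<in>UNIV. B $ k $ j *\<^sub>R v $ j) \<bullet> b = (\<mu> *\<^sub>R v $ k) \<bullet> b" for k
    using arg_cong[OF assms(1), of "\<lambda>w. w $ k \<bullet> b"] by (simp add: mat_act_def)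
  then have "B *v (\<chi> j. v $ j \<bullet> b) = \<mu> *s (\<chi> j. v $ j \<bullet> b)"
    by (simp add: vec_eq_iff matrix_vector_mult_def inner_sum_left)
  moreover have "(\<chi> j. v $ j \<bullet> b) \<noteq> 0"
    using b by (auto simp: vec_eq_iff)
  ultimately show ?thesis
    by (auto simp: eigenvalue_def)
qed

lemma eigenvalue_imp_mat_act_eigenvector:
  assumes "eigenvalue B \<mu>"
  obtains v :: "'a::euclidean_space^'n" where "mat_act B v = \<mu> *\<^sub>R v" "v \<noteq> 0"
proof -
  obtain z where z: "z \<noteq> 0" "B *v z = \<mu> *s z"
    using assms by (auto simp: eigenvalue_def)
  obtain b :: 'a where b: "b \<in> Basis"
    using nonempty_Basis by blast
  have "(\<Sum>j\<in>UNIV. B $ i $ j * z $ j) = \<mu> * z $ i" for i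
    using arg_cong[OF z(2), of "\<lambda>w. w $ i"] by (simp add: matrix_vector_mult_def)
  then have "mat_act B (\<chi> i. z $ i *\<^sub>R b) = \<mu> *\<^sub>R (\<chi> i. z $ i *\<^sub>R b)"
    by (simp add: mat_act_def vec_eq_iff scaleR_sum_left[symmetric])
  moreover have "(\<chi> i. z $ i *\<^sub>R b) \<noteq> 0"
    using z(1) b nonzero_Basis by (auto simp: vec_eq_iff)
  ultimately show ?thesis
    using that by blast
qed

text \<open>A real eigenvector is also a complex one, so the modulus of \<open>\<mu>\<close> belongs
  to the set whose supremum is taken. The bound on all complex eigenvalues is proved because
  \<open>Sup\<close> on the reals dominates the members only of a bounded set.\<close>

lemma eigenvalue_le_spectral_radius:
  fixes B :: "real^'n^'n"
  assumes "eigenvalue B \<mu>"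
  shows "\<mu> \<le> spectral_radius B"
proof -
  let ?B = "map_matrix complex_of_real B"
  obtain v where v: "v \<noteq> 0" "B *v v = \<mu> *s v"
    using assms by (auto simp: eigenvalue_def)
  have "(\<Sum>j\<in>UNIV. B $ i $ j * v $ j) = \<mu> * v $ i" for i
    using arg_cong[OF v(2), of "\<lambda>w. w $ i"] by (simp add: matrix_vector_mult_def)
  then have "(\<Sum>j\<in>UNIV. complex_of_real (B $ i $ j) * complex_of_real (v $ j)) = complex_of_real \<mu> * complex_of_real (v $ i)" for i
    by (metis (no_types, lifting) of_real_mult of_real_sum sum.cong)
  then have "?B *v (\<chi> i. complex_of_real (v $ i)) = complex_of_real \<mu> *s (\<chi> i. complex_of_real (v $ i))"
    by (simp add: vec_eq_iff matrix_vector_mult_def)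
  moreover have "(\<chi> i. complex_of_real (v $ i)) \<noteq> 0"
    using v(1) by (auto simp: vec_eq_iff)
  ultimately have ev: "eigenvalue ?B (complex_of_real \<mu>)"
    by (auto simp: eigenvalue_def)
  have bound: "cmod z \<le> (\<Sum>i\<in>UNIV. \<Sum>j\<in>UNIV. \<bar>B $ i $ j\<bar>)" if "eigenvalue ?B z" for z
  proof -
    obtain w where w: "w \<noteq> 0" "?B *v w = z *s w"
      using \<open>eigenvalue ?B z\<close> by (auto simp: eigenvalue_def)
    \<comment> \<open>The eigenvalue equation is read at a coordinate of largest modulus.\<close>
    define m where "m = Max (range (\<lambda>i. cmod (w $ i)))"
    have "m \<in> range (\<lambda>i. cmod (w $ i))"
      unfolding m_def by (intro Max_in) auto
    then obtain i where i: "cmod (w $ i) = m"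
      by auto
    have le: "cmod (w $ j) \<le> m" for j
      unfolding m_def by (intro Max_ge) auto
    obtain j where "w $ j \<noteq> 0"
      using w(1) by (auto simp: vec_eq_iff)
    then have "m > 0"
      using le[of j] by (smt (verit) zero_less_norm_iff)
    have "cmod z * m = cmod (\<Sum>j\<in>UNIV. complex_of_real (B $ i $ j) * w $ j)"
      using arg_cong[OF w(2), of "\<lambda>w. w $ i"] i by (simp add: matrix_vector_mult_def norm_mult)
    also have "\<dots> \<le> (\<Sum>j\<in>UNIV. \<bar>B $ i $ j\<bar> * m)"
      by (intro order_trans[OF norm_sum] sum_mono) (auto simp: norm_mult le mult_left_mono)
    also have "\<dots> = (\<Sum>j\<in>UNIV. \<bar>B $ i $ j\<bar>) * m"
      by (simp add: sum_distrib_right)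
    finally have "cmod z \<le> (\<Sum>j\<in>UNIV. \<bar>B $ i $ j\<bar>)"
      using \<open>m > 0\<close> by simp
    also have "\<dots> \<le> (\<Sum>i\<in>UNIV. \<Sum>j\<in>UNIV. \<bar>B $ i $ j\<bar>)"
      by (rule member_le_sum) (auto intro: sum_nonneg)
    finally show ?thesis .
  qed
  have "cmod (complex_of_real \<mu>) \<le> spectral_radius B"
    unfolding spectral_radius_def
    by (rule cSup_upper) (use ev bound in \<open>auto simp: bdd_above_def intro!: exI[of _ "complex_of_real \<mu>"]\<close>)
  then show ?thesis
    by simp
qed

text \<open>The minimal Rayleigh quotient of \<open>- L\<close> is minus an eigenvalue of
  \<open>L\<close>, and no real eigenvalue exceeds the spectral radius.\<close>

lemma laplacian_le_spectral_radius:
  fixes x :: "'a::euclidean_space^'n"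
  assumes "adjacency A"
  shows "x \<bullet> mat_act (laplacian A) x \<le> spectral_radius (laplacian A) * (norm x)\<^sup>2"
proof -
  let ?L = "mat_act (laplacian A) :: 'a^'n \<Rightarrow> 'a^'n"
  interpret L: linear ?L by (rule linear_mat_act)
  obtain w :: "'a^'n" where "w \<noteq> 0"
    using vector_choose_size[of 1] by (metis norm_zero zero_le_one zero_neq_one)
  moreover have "linear (\<lambda>x. - ?L x)"
    by (intro linear_compose_neg linear_mat_act)
  moreover have "- ?L x \<bullet> y = x \<bullet> - ?L y" for x y
    by (simp add: inner_commute[of "?L x"] inner_laplacian[OF assms] inner_commute)
  ultimately obtain v \<mu> where v: "v \<noteq> 0" "- ?L v = \<mu> *\<^sub>R v"
    and le: "\<And>x. \<mu> * (norm x)\<^sup>2 \<le> x \<bullet> - ?L x"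
    using rayleigh_minimizer[of "\<lambda>x. - ?L x" UNIV w] by (metis UNIV_I subspace_UNIV)
  have "?L v = (- \<mu>) *\<^sub>R v"
    using v(2) by (metis minus_minus scaleR_minus_left)
  then have "- \<mu> \<le> spectral_radius (laplacian A)"
    using v(1) by (intro eigenvalue_le_spectral_radius mat_act_eigenvector_imp_eigenvalue)
  then have "- \<mu> * (norm x)\<^sup>2 \<le> spectral_radius (laplacian A) * (norm x)\<^sup>2"
    by (intro mult_right_mono) auto
  with le[of x] show ?thesis
    by simp
qed

text \<open>The minimal Rayleigh quotient on zero-sum stacks is an eigenvalue. Connectivity makes it
  positive, because a zero-sum stack with vanishing form is constant, hence zero. It is the least
  positive one because the image of \<open>L\<close> is zero-sum, and so is every eigenvector with
  positive eigenvalue. Two distinct agents provide a nonzero zero-sum stack to start from.\<close>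

lemma least_pos_eigenvalue_laplacian:
  fixes x :: "'a::euclidean_space^'n"
  assumes A: "adjacency A" "connected_graph A" and n: "CARD('n) \<ge> 2"
  shows "0 < least_pos_eigenvalue (laplacian A)"
    and "(\<Sum>i\<in>UNIV. x $ i) = 0 \<Longrightarrow>
      least_pos_eigenvalue (laplacian A) * (norm x)\<^sup>2 \<le> x \<bullet> mat_act (laplacian A) x"
    and "least_pos_eigenvalue (laplacian A) \<le> spectral_radius (laplacian A)"
proof -
  let ?L = "mat_act (laplacian A) :: 'a^'n \<Rightarrow> 'a^'n"
  define S where "S = {x :: 'a^'n. (\<Sum>i\<in>UNIV. x $ i) = 0}"
  have S: "subspace S"
    by (auto simp: S_def subspace_def sum.distrib scaleR_sum_right[symmetric])
  obtain i j :: 'n where ij: "i \<noteq> j"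
    using n by (meson card_2_iff' ex_card subset_UNIV top_greatest)
  obtain b :: 'a where b: "b \<in> Basis"
    using nonempty_Basis by blast
  define w :: "'a^'n" where "w = center (axis i b)"
  have "w $ i \<noteq> w $ j"
    using ij nonzero_Basis[OF b] by (simp add: w_def center_def axis_def)
  then have w: "w \<in> S" "w \<noteq> 0"
    by (auto simp: S_def w_def)
  have adj: "?L x \<bullet> y = x \<bullet> ?L y" for x y
    by (simp add: inner_commute[of "?L x"] inner_laplacian[OF A(1)] inner_commute)
  obtain v \<mu> where v: "v \<in> S" "v \<noteq> 0" "?L v = \<mu> *\<^sub>R v"
    and le: "\<And>x. x \<in> S \<Longrightarrow> \<mu> * (norm x)\<^sup>2 \<le> x \<bullet> ?L x"
    using rayleigh_minimizer[OF linear_mat_act adj S _ w] A(1)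
    by (auto simp: S_def)
  have "v \<bullet> ?L v \<noteq> 0"
  proof
    assume "v \<bullet> ?L v = 0"
    then have "($) v = (\<lambda>_. v $ i)" for i
      using laplacian_eq_zero_imp_const[OF A, of v] by (auto simp: fun_eq_iff)
    then have "agent_avg (($) v) = v $ i" for i
      using agent_avg_const by metis
    then have "center v = 0"
      by (simp add: center_def vec_eq_iff)
    with v show False
      by (simp add: S_def center_id)
  qed
  moreover have "v \<bullet> ?L v \<ge> 0"
    using A by (auto simp: inner_laplacian[OF A(1)] adjacency_def intro!: sum_nonneg)
  moreover have "v \<bullet> ?L v = \<mu> * (norm v)\<^sup>2"
    by (simp add: v(3) power2_norm_eq_inner)
  ultimately have "\<mu> > 0"
    using v(2) by (smt (verit) zero_less_mult_iff zero_le_power2)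
  have ev: "eigenvalue (laplacian A) \<mu>"
    using v by (intro mat_act_eigenvector_imp_eigenvalue)
  have lpe: "least_pos_eigenvalue (laplacian A) = \<mu>"
    unfolding least_pos_eigenvalue_def
  proof (rule Least_equality)
    fix z
    assume z: "0 < z \<and> eigenvalue (laplacian A) z"
    obtain u :: "'a^'n" where u: "?L u = z *\<^sub>R u" "u \<noteq> 0"
      using eigenvalue_imp_mat_act_eigenvector z by blast
    have "z *\<^sub>R (\<Sum>i\<in>UNIV. u $ i) = (\<Sum>i\<in>UNIV. ?L u $ i)"
      by (simp add: u scaleR_sum_right)
    then have "u \<in> S"
      using z A(1) by (simp add: S_def)
    then have "\<mu> * (norm u)\<^sup>2 \<le> z * (norm u)\<^sup>2"
      using le[of u] by (simp add: u power2_norm_eq_inner)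
    then show "\<mu> \<le> z"
      using u(2) by simp
  qed (use ev \<open>\<mu> > 0\<close> in blast)
  show "0 < least_pos_eigenvalue (laplacian A)"
    using lpe \<open>\<mu> > 0\<close> by simp
  show "least_pos_eigenvalue (laplacian A) * (norm x)\<^sup>2 \<le> x \<bullet> ?L x" if "(\<Sum>i\<in>UNIV. x $ i) = 0"
    using le[of x] that lpe by (simp add: S_def)
  show "least_pos_eigenvalue (laplacian A) \<le> spectral_radius (laplacian A)"
    using lpe eigenvalue_le_spectral_radius[OF ev] by simp
qed

section \<open>One step of the averaged dynamics\<close>

lemma young_inner:
  fixes x y :: "'a::real_inner"
  assumes "t > 0"
  shows "x \<bullet> y \<le> t * (norm x)\<^sup>2 + (norm y)\<^sup>2 / (4 * t)"
proof -
  have "0 \<le> (norm ((2 * t) *\<^sub>R x - y))\<^sup>2"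
    by simp
  also have "\<dots> = 4 * t\<^sup>2 * (norm x)\<^sup>2 - 4 * t * (x \<bullet> y) + (norm y)\<^sup>2"
    by (simp only: power2_norm_eq_inner)
      (simp add: inner_diff_left inner_diff_right inner_commute power2_eq_square)
  finally have "4 * t * (x \<bullet> y) \<le> 4 * t\<^sup>2 * (norm x)\<^sup>2 + (norm y)\<^sup>2"
    by simp
  then show ?thesis
    using assms by (simp add: field_simps power2_eq_square)
qed

lemma young_inner_minus:
  fixes x y :: "'a::real_inner"
  assumes "t > 0"
  shows "- (x \<bullet> y) \<le> t * (norm x)\<^sup>2 + (norm y)\<^sup>2 / (4 * t)"
  using young_inner[OF assms, of "- x" y] by simp

lemma norm_add_square_le:
  fixes x y :: "'a::real_inner"
  shows "(norm (x + y))\<^sup>2 \<le> 2 * (norm x)\<^sup>2 + 2 * (norm y)\<^sup>2"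
  using young_inner[of "1/2" x y]
  by (simp add: power2_norm_eq_inner inner_add_left inner_add_right inner_commute)

lemma norm_add_square_le_weighted:
  fixes x y :: "'a::real_inner"
  assumes "t > 0"
  shows "(norm (x + y))\<^sup>2 \<le> (1 + t) * (norm x)\<^sup>2 + (1 + 1 / t) * (norm y)\<^sup>2"
  using young_inner[of "t / 2" x y] assms
  by (simp add: power2_norm_eq_inner inner_add_left inner_add_right inner_commute field_simps)

lemma norm_diff_square_le:
  fixes x y :: "'a::real_inner"
  shows "(norm (x - y))\<^sup>2 \<le> 2 * (norm x)\<^sup>2 + 2 * (norm y)\<^sup>2"
  using norm_add_square_le[of x "- y"] by simp

text \<open>Each summand is paired with the whole sum by Young's inequality; weights adding up to
  one leave a single copy of the squared sum to be moved to the left.\<close>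

lemma convex_sum_inner_square_le:
  fixes a b c d :: "'a::real_inner"
  assumes "t1 > 0" "t2 > 0" "t3 > 0" "t4 > 0" "t1 + t2 + t3 + t4 = 1"
  shows "(norm (a + b + c + d))\<^sup>2
    \<le> (norm a)\<^sup>2 / t1 + (norm b)\<^sup>2 / t2 + (norm c)\<^sup>2 / t3 + (norm d)\<^sup>2 / t4"
proof -
  let ?s = "a + b + c + d"
  have *: "2 * (x \<bullet> ?s) \<le> (norm x)\<^sup>2 / t + t * (norm ?s)\<^sup>2" if "t > 0" for x and t :: real
    using young_inner[of "1 / (2 * t)" x ?s] that by (simp add: field_simps)
  have "2 * (norm ?s)\<^sup>2 = 2 * (a \<bullet> ?s) + 2 * (b \<bullet> ?s) + 2 * (c \<bullet> ?s) + 2 * (d \<bullet> ?s)"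
    by (simp only: power2_norm_eq_inner) (simp only: inner_add_left distrib_left)
  also have "\<dots> \<le> (norm a)\<^sup>2 / t1 + (norm b)\<^sup>2 / t2 + (norm c)\<^sup>2 / t3 + (norm d)\<^sup>2 / t4
      + (t1 + t2 + t3 + t4) * (norm ?s)\<^sup>2"
    using *[OF assms(1), of a] *[OF assms(2), of b] *[OF assms(3), of c] *[OF assms(4), of d]
    by (simp only: distrib_right)
  finally show ?thesis
    using assms(5) by simp
qed

text \<open>The estimates of one iteration see the Laplacian only through these facts.
  \<open>S\<close> plays the zero-sum stacks, \<open>lo\<close> the least positive eigenvalue and
  \<open>hi\<close> the spectral radius.\<close>

locale spectral_gap =
  fixes L :: "'a::real_inner \<Rightarrow> 'a" and S :: "'a set" and lo hi :: real
  assumes linear: "linear L"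
    and self_adjoint: "L x \<bullet> y = x \<bullet> L y"
    and nonneg: "0 \<le> x \<bullet> L x"
    and upper: "x \<bullet> L x \<le> hi * (norm x)\<^sup>2"
    and lower: "x \<in> S \<Longrightarrow> lo * (norm x)\<^sup>2 \<le> x \<bullet> L x"
    and lo_pos: "0 < lo"
    and lo_le_hi: "lo \<le> hi"
begin

sublocale linear L by (rule linear)

lemma hi_pos: "0 < hi"
  using lo_pos lo_le_hi by linarith

text \<open>Expansion of the nonnegative form at \<open>2 t x - y\<close>: Young's inequality holds
  for a semidefinite form as it does for an inner product.\<close>

lemma young_form:
  assumes "t > 0"
  shows "x \<bullet> L y \<le> t * (x \<bullet> L x) + (y \<bullet> L y) / (4 * t)"
proof -
  have "0 \<le> ((2 * t) *\<^sub>R x - y) \<bullet> L ((2 * t) *\<^sub>R x - y)"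
    by (rule nonneg)
  also have "\<dots> = 4 * t\<^sup>2 * (x \<bullet> L x) - 4 * t * (x \<bullet> L y) + y \<bullet> L y"
    using self_adjoint[of x y]
    by (simp add: diff scaleR inner_diff_left inner_diff_right inner_commute power2_eq_square)
  finally have "4 * t * (x \<bullet> L y) \<le> 4 * t\<^sup>2 * (x \<bullet> L x) + y \<bullet> L y"
    by simp
  then show ?thesis
    using assms by (simp add: field_simps power2_eq_square)
qed

text \<open>Young's inequality for the form at \<open>L x\<close> and \<open>x\<close> with weight
  \<open>1 / (2 hi)\<close> leaves a term that is at most half of the left side and is absorbed.
  Operator bounds are obtained this way without diagonalizing \<open>L\<close>.\<close>

lemma norm_image: "(norm (L x))\<^sup>2 \<le> hi * (x \<bullet> L x)"
proof -
  have "L x \<bullet> L x \<le> (1 / (2 * hi)) * (L x \<bullet> L (L x)) + hi * (x \<bullet> L x) / 2"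
    using young_form[of "1 / (2 * hi)" "L x" x] hi_pos by (simp add: mult.commute)
  moreover have "(1 / (2 * hi)) * (L x \<bullet> L (L x)) \<le> (1 / (2 * hi)) * (hi * (norm (L x))\<^sup>2)"
    using upper[of "L x"] hi_pos by (intro mult_left_mono) auto
  moreover have "(1 / (2 * hi)) * (hi * (norm (L x))\<^sup>2) = (norm (L x))\<^sup>2 / 2"
    using hi_pos by simp
  ultimately show ?thesis
    unfolding power2_norm_eq_inner by linarith
qed

lemma norm_image_le: "(norm (L x))\<^sup>2 \<le> hi\<^sup>2 * (norm x)\<^sup>2"
proof -
  have "hi * (x \<bullet> L x) \<le> hi * (hi * (norm x)\<^sup>2)"
    using hi_pos by (intro mult_left_mono upper) simp
  then show ?thesis
    using norm_image[of x] by (simp add: power2_eq_square[of hi] mult.assoc)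
qed

lemma norm_le_form: "x \<in> S \<Longrightarrow> (norm x)\<^sup>2 \<le> (x \<bullet> L x) / lo"
  using lower[of x] lo_pos by (simp add: field_simps)

lemma form_le_image:
  assumes "x \<in> S" shows "x \<bullet> L x \<le> (norm (L x))\<^sup>2 / lo"
proof -
  have "x \<bullet> L x \<le> (lo / 2) * (norm x)\<^sup>2 + (norm (L x))\<^sup>2 / (4 * (lo / 2))"
    by (rule young_inner) (use lo_pos in simp)
  also have "(lo / 2) * (norm x)\<^sup>2 \<le> (x \<bullet> L x) / 2"
    using lower[OF assms] by simp
  finally show ?thesis
    by simp
qed

lemma norm_le_image:
  assumes "x \<in> S" shows "(norm x)\<^sup>2 \<le> (norm (L x))\<^sup>2 / lo\<^sup>2"
proof -
  have "(norm x)\<^sup>2 \<le> (x \<bullet> L x) / lo"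
    by (rule norm_le_form[OF assms])
  also have "\<dots> \<le> (norm (L x))\<^sup>2 / lo / lo"
    using form_le_image[OF assms] lo_pos by (intro divide_right_mono) auto
  finally show ?thesis
    by (simp add: power2_eq_square)
qed

text \<open>The weight \<open>1 + \<tau>\<close> makes the first-order terms in \<open>X \<bullet> L u\<close> cancel along the iteration.\<close>

definition disagreement :: "real \<Rightarrow> 'a \<Rightarrow> 'a \<Rightarrow> real" where
  "disagreement \<tau> X u = (norm X)\<^sup>2 / 2 + (1 + \<tau>) / 2 * (u \<bullet> L u) + X \<bullet> u"

text \<open>The cross term costs \<open>|X|^2 / 4\<close> and one \<open>|u|^2\<close>. The spectral
  gap and \<open>4 / lo \<le> \<tau>\<close>, which is the purpose of \<open>kappa1\<close>, let the
  form in \<open>u\<close> pay for the latter.\<close>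

lemma disagreement_lower:
  assumes "u \<in> S" "4 / lo \<le> \<tau>"
  shows "(norm X)\<^sup>2 / 4 \<le> disagreement \<tau> X u"
proof -
  have "- (X \<bullet> u) \<le> 1 / 4 * (norm X)\<^sup>2 + (norm u)\<^sup>2"
    using young_inner_minus[of "1/4" X u] by simp
  moreover have "(norm u)\<^sup>2 \<le> (\<tau> / 4) * (u \<bullet> L u)"
  proof -
    have "(norm u)\<^sup>2 \<le> (1 / lo) * (u \<bullet> L u)"
      using norm_le_form[OF assms(1)] by simp
    also have "\<dots> \<le> (\<tau> / 4) * (u \<bullet> L u)"
      using assms(2) by (intro mult_right_mono nonneg) (simp add: field_simps)
    finally show ?thesis .
  qed
  moreover have "(\<tau> / 4) * (u \<bullet> L u) \<le> (1 + \<tau>) / 2 * (u \<bullet> L u)"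
  proof (intro mult_right_mono nonneg)
    have "0 < \<tau>"
      using lo_pos assms(2) by (meson divide_pos_pos order_less_le_trans zero_less_numeral)
    then show "\<tau> / 4 \<le> (1 + \<tau>) / 2"
      by simp
  qed
  ultimately show ?thesis
    by (simp add: disagreement_def)
qed

text \<open>Young's inequality with weight \<open>\<tau> lo / 2\<close> on the cross term produces
  exactly the two entries of the maximum \<open>eps2\<close>.\<close>

lemma disagreement_upper:
  assumes "u \<in> S" "4 / lo \<le> \<tau>"
  shows "disagreement \<tau> X u \<le> eps2 lo \<tau> * ((norm X)\<^sup>2 + u \<bullet> L u)"
proof -
  have \<tau>: "0 < \<tau>"
    using lo_pos assms(2) by (meson divide_pos_pos order_less_le_trans zero_less_numeral)
  have "X \<bullet> u \<le> (\<tau> * lo / 2) * (norm X)\<^sup>2 + (norm u)\<^sup>2 / (4 * (\<tau> * lo / 2))"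
    by (rule young_inner) (use lo_pos \<tau> in simp)
  also have "(norm u)\<^sup>2 / (4 * (\<tau> * lo / 2)) \<le> ((u \<bullet> L u) / lo) / (4 * (\<tau> * lo / 2))"
    by (intro divide_right_mono norm_le_form assms) (use lo_pos \<tau> in simp)
  also have "\<dots> = 1 / (2 * \<tau> * lo\<^sup>2) * (u \<bullet> L u)"
    by (simp add: power2_eq_square)
  finally have "disagreement \<tau> X u \<le> (1 + \<tau> * lo) / 2 * (norm X)\<^sup>2
      + ((1 + \<tau>) / 2 + 1 / (2 * \<tau> * lo\<^sup>2)) * (u \<bullet> L u)"
    by (simp add: disagreement_def algebra_simps add_divide_distrib)
  also have "\<dots> \<le> eps2 lo \<tau> * (norm X)\<^sup>2 + eps2 lo \<tau> * (u \<bullet> L u)"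
    by (intro add_mono mult_right_mono nonneg) (auto simp: eps2_def)
  finally show ?thesis
    by (simp add: distrib_left)
qed

text \<open>The left side is the coefficient of \<alpha> in the change of
  \<open>disagreement\<close>, \<open>D\<close> being the drift of \<open>u\<close> caused by the
  moving mean. The reserve \<open>2 / 5 * l^2\<close> is kept for comparing the averaged gradient
  with the gradient of the mean cost.\<close>

lemma first_order_bound:
  assumes S: "X \<in> S" "u \<in> S" "D \<in> S" and pos: "0 < \<beta>" "0 < \<gamma>"
    and G: "(norm G)\<^sup>2 \<le> l\<^sup>2 * (norm X)\<^sup>2" and D: "(norm (L D))\<^sup>2 \<le> l\<^sup>2 * N"
  shows "- \<beta> * (X \<bullet> L (X - e)) - X \<bullet> G - \<gamma> * (e \<bullet> L u) + (\<beta> + \<gamma>) / \<gamma>\<^sup>2 * (u \<bullet> L D)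
      + \<gamma> * (X \<bullet> (X - e)) + (X \<bullet> D) / \<gamma> - \<gamma> * (u \<bullet> L u) - G \<bullet> u
    \<le> - (phi1 lo l \<beta> \<gamma> + 2 / 5 * l\<^sup>2) * (norm X)\<^sup>2 - phi3 lo \<gamma> * (u \<bullet> L u)
      + phi7 hi \<beta> \<gamma> * (norm e)\<^sup>2 + (1 / 8 - phi5 lo l \<beta> \<gamma>) * N"
proof -
  define xx ee W where "xx = (norm X)\<^sup>2" and "ee = (norm e)\<^sup>2" and "W = u \<bullet> L u"
  have XX: "X \<bullet> X = xx"
    by (simp add: xx_def power2_norm_eq_inner)
  have ee0: "0 \<le> ee"
    by (simp add: ee_def)
  have "X \<bullet> L e \<le> 1 / 2 * (X \<bullet> L X) + (e \<bullet> L e) / 2"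
    using young_form[of "1/2" X e] by simp
  then have "- (X \<bullet> L (X - e)) \<le> - (lo / 2) * xx + hi / 2 * ee"
    using lower[OF S(1)] upper[of e] by (simp add: diff inner_diff_right xx_def ee_def)
  then have b1: "- \<beta> * (X \<bullet> L (X - e)) \<le> \<beta> * (- (lo / 2) * xx + hi / 2 * ee)"
    using pos mult_left_mono[of _ _ \<beta>] by (metis less_imp_le minus_mult_commute)
  have b2: "- (X \<bullet> G) \<le> xx / 2 + l\<^sup>2 * xx / 2"
    using young_inner_minus[of "1/2" X G] G by (simp add: xx_def)
  have "- (e \<bullet> L u) \<le> hi * ee + W / 4"
    using young_form[of 1 "- e" u] upper[of e] by (simp add: neg W_def ee_def)
  then have b3: "- \<gamma> * (e \<bullet> L u) \<le> \<gamma> * (hi * ee + W / 4)"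
    using pos mult_left_mono[of _ _ \<gamma>] by (metis less_imp_le minus_mult_commute)
  \<comment> \<open>The weight \<open>lo \<gamma> / 4\<close> in \<open>b4\<close> turns the square
    of this factor into the \<open>\<gamma> ^ 5\<close> of \<open>phi5\<close>.\<close>
  define t where "t = (\<beta> + \<gamma>) / \<gamma>\<^sup>2"
  have t2: "t\<^sup>2 / (lo * \<gamma>) = (\<beta> + \<gamma>)\<^sup>2 / \<gamma> ^ 5 * (1 / lo)"
    using pos by (simp add: t_def field_simps power2_eq_square eval_nat_numeral)
  have b4: "t * (u \<bullet> L D) \<le> \<gamma> / 4 * W + (\<beta> + \<gamma>)\<^sup>2 / \<gamma> ^ 5 * (1 / lo) * l\<^sup>2 * N"
  proof -
    have "t * (u \<bullet> L D) = u \<bullet> (t *\<^sub>R L D)"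
      by simp
    also have "\<dots> \<le> (lo * \<gamma> / 4) * (norm u)\<^sup>2 + (norm (t *\<^sub>R L D))\<^sup>2 / (4 * (lo * \<gamma> / 4))"
      by (rule young_inner) (use lo_pos pos in simp)
    also have "(norm (t *\<^sub>R L D))\<^sup>2 / (4 * (lo * \<gamma> / 4)) = t\<^sup>2 / (lo * \<gamma>) * (norm (L D))\<^sup>2"
      by (simp add: power_mult_distrib)
    also have "\<dots> \<le> t\<^sup>2 / (lo * \<gamma>) * (l\<^sup>2 * N)"
      using lo_pos pos by (intro mult_left_mono D) simp
    also have "(lo * \<gamma> / 4) * (norm u)\<^sup>2 \<le> \<gamma> / 4 * W"
      using mult_left_mono[OF lower[OF S(2)], of "\<gamma> / 4"] pos by (simp add: W_def mult_ac)
    finally show ?thesis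
      by (simp add: t2 mult.assoc)
  qed
  have "- (X \<bullet> e) \<le> xx / 2 + ee / 2"
    using young_inner_minus[of "1/2" X e] by (simp add: xx_def ee_def)
  then have "X \<bullet> (X - e) \<le> 3 / 2 * xx + ee / 2"
    by (simp add: inner_diff_right XX)
  then have b5: "\<gamma> * (X \<bullet> (X - e)) \<le> \<gamma> * (3 / 2 * xx + ee / 2)"
    using pos by (intro mult_left_mono) auto
  have b6: "(X \<bullet> D) / \<gamma> \<le> xx / 2 + 1 / (2 * \<gamma>\<^sup>2) * (1 / lo\<^sup>2) * l\<^sup>2 * N"
  proof -
    have "(X \<bullet> D) / \<gamma> = X \<bullet> ((1 / \<gamma>) *\<^sub>R D)"
      by simp
    also have "\<dots> \<le> 1 / 2 * xx + (norm ((1 / \<gamma>) *\<^sub>R D))\<^sup>2 / (4 * (1 / 2))"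
      unfolding xx_def by (rule young_inner) simp
    also have "(norm ((1 / \<gamma>) *\<^sub>R D))\<^sup>2 / (4 * (1 / 2)) = 1 / (2 * \<gamma>\<^sup>2) * (norm D)\<^sup>2"
      by (simp add: power_mult_distrib power_divide)
    also have "1 / (2 * \<gamma>\<^sup>2) * (norm D)\<^sup>2 \<le> 1 / (2 * \<gamma>\<^sup>2) * ((1 / lo\<^sup>2) * (l\<^sup>2 * N))"
      using norm_le_image[OF S(3)] divide_right_mono[OF D, of "lo\<^sup>2"]
      by (intro mult_left_mono) auto
    finally show ?thesis
      by (simp add: mult.assoc)
  qed
  \<comment> \<open>The weight \<open>1 / 10\<close> costs only \<open>l^2 / 10\<close> of
    \<open>|X|^2\<close>; with the \<open>l^2 / 2\<close> of \<open>b2\<close> this leaves the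
    reserve \<open>2 / 5\<close>. It also produces the \<open>5 / (2 lo)\<close> in
    \<open>phi3\<close>.\<close>
  have b7: "- (G \<bullet> u) \<le> l\<^sup>2 * xx / 10 + 5 / (2 * lo) * W"
    using young_inner_minus[of "1/10" G u] G norm_le_form[OF S(2)] by (simp add: xx_def W_def)
  \<comment> \<open>Padding: \<open>b5\<close> yields only half of the \<gamma> that
    \<open>phi7\<close> contains besides \<open>hi \<gamma>\<close>.\<close>
  have g: "0 \<le> \<gamma> * ee"
    using pos ee0 by simp
  have "- \<beta> * (X \<bullet> L (X - e)) - X \<bullet> G - \<gamma> * (e \<bullet> L u) + t * (u \<bullet> L D)
      + \<gamma> * (X \<bullet> (X - e)) + (X \<bullet> D) / \<gamma> - \<gamma> * W - G \<bullet> u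
    \<le> \<beta> * (- (lo / 2) * xx + hi / 2 * ee) + (xx / 2 + l\<^sup>2 * xx / 2) + \<gamma> * (hi * ee + W / 4)
      + (\<gamma> / 4 * W + (\<beta> + \<gamma>)\<^sup>2 / \<gamma> ^ 5 * (1 / lo) * l\<^sup>2 * N) + \<gamma> * (3 / 2 * xx + ee / 2)
      + (xx / 2 + 1 / (2 * \<gamma>\<^sup>2) * (1 / lo\<^sup>2) * l\<^sup>2 * N) - \<gamma> * W + (l\<^sup>2 * xx / 10 + 5 / (2 * lo) * W)
      + \<gamma> * ee / 2"
    using b1 b2 b3 b4 b5 b6 b7 g by linarith
  also have "\<dots> = - (phi1 lo l \<beta> \<gamma> + 2 / 5 * l\<^sup>2) * xx - phi3 lo \<gamma> * W
      + phi7 hi \<beta> \<gamma> * ee + (1 / 8 - phi5 lo l \<beta> \<gamma>) * N"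
    unfolding phi1_def phi3_def phi5_def phi7_def by (simp add: algebra_simps add_divide_distrib diff_divide_distrib)
  finally show ?thesis
    by (simp add: t_def xx_def ee_def W_def)
qed

text \<open>The left side is the coefficient of \<open>\<alpha>^2\<close> in the change of
  \<open>disagreement\<close>, increased by \<open>e10 |p|^2\<close> because the movement of
  \<open>x\<close> also enlarges the compression error. The \<open>l / 2\<close> withheld from
  \<open>phi6\<close> is left for the curvature term of the descent inequality.\<close>

lemma second_order_bound:
  assumes S: "X \<in> S" "u \<in> S" "D \<in> S" and pos: "0 < \<beta>" "0 < \<gamma>" "0 \<le> e10" "0 \<le> N"
    and \<beta>: "4 * \<gamma> \<le> lo * \<beta>"
    and G: "(norm G)\<^sup>2 \<le> l\<^sup>2 * (norm X)\<^sup>2" and D: "(norm (L D))\<^sup>2 \<le> l\<^sup>2 * N"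
    and p: "p = \<beta> *\<^sub>R L (X - e) + \<gamma> *\<^sub>R L u + G" and c: "c = X - e"
  shows "(norm p)\<^sup>2 / 2 + e10 * (norm p)\<^sup>2 + (\<gamma>\<^sup>2 + \<beta> * \<gamma>) / 2 * (c \<bullet> L c) + c \<bullet> L D
      + (\<beta> + \<gamma>) / (2 * \<gamma> ^ 3) * (D \<bullet> L D) - \<gamma> * \<beta> * (c \<bullet> L c) - \<gamma>\<^sup>2 * (L u \<bullet> c)
      - \<gamma> * (G \<bullet> c) - L u \<bullet> D - (G \<bullet> D) / \<gamma>
    \<le> phi2' hi lo l e10 \<beta> \<gamma> * (norm X)\<^sup>2 + phi4' hi e10 \<gamma> * (u \<bullet> L u)
      + phi8' hi lo e10 \<beta> \<gamma> * (norm e)\<^sup>2 + (phi6 lo l \<beta> \<gamma> - l / 2) * N"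
proof -
  define xx ee W where "xx = (norm X)\<^sup>2" and "ee = (norm e)\<^sup>2" and "W = u \<bullet> L u"
  define B where "B = hi * \<beta>"
  have nn: "0 \<le> xx" "0 \<le> ee" "0 \<le> W"
    by (simp_all add: xx_def ee_def W_def nonneg)
  have B: "4 * \<gamma> \<le> B"
  proof -
    have "lo * \<beta> \<le> hi * \<beta>"
      using pos by (intro mult_right_mono lo_le_hi) simp
    with \<beta> show ?thesis
      by (simp only: B_def)
  qed
  have LX: "(norm (\<beta> *\<^sub>R L X))\<^sup>2 \<le> B\<^sup>2 * xx" and Le: "(norm (\<beta> *\<^sub>R L (- e)))\<^sup>2 \<le> B\<^sup>2 * ee"
    using mult_left_mono[OF norm_image_le[of X], of "\<beta>\<^sup>2"] mult_left_mono[OF norm_image_le[of e], of "\<beta>\<^sup>2"]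
    by (simp_all add: power_mult_distrib xx_def ee_def B_def mult_ac neg)
  have Lu: "(norm (L u))\<^sup>2 \<le> hi * W"
    using norm_image[of u] by (simp add: W_def)
  have gLu: "(norm (\<gamma> *\<^sub>R L u))\<^sup>2 \<le> \<gamma>\<^sup>2 * hi * W"
    using mult_left_mono[OF Lu, of "\<gamma>\<^sup>2"] by (simp add: power_mult_distrib mult_ac)
  have GG: "(norm G)\<^sup>2 \<le> l\<^sup>2 * xx"
    using G by (simp add: xx_def)
  have p': "p = \<beta> *\<^sub>R L X + \<beta> *\<^sub>R L (- e) + \<gamma> *\<^sub>R L u + G"
    by (simp add: p diff neg scaleR_diff_right)
  text \<open>The weights leave a third of \<open>B\<^sup>2\<close> in \<open>phi2'\<close> and \<open>phi8'\<close>, which pays for their negative terms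
    \<open>- \<rho>2 * \<beta> * \<gamma>\<close> because \<open>4 * \<gamma> \<le> B\<close>.\<close>
  have p1: "(norm p)\<^sup>2 / 2 \<le> 8 / 3 * (B\<^sup>2 * xx) + 8 / 3 * (B\<^sup>2 * ee) + 8 / 5 * (\<gamma>\<^sup>2 * hi * W) + 8 / 5 * (l\<^sup>2 * xx)"
    using convex_sum_inner_square_le[of "3/16" "3/16" "5/16" "5/16" "\<beta> *\<^sub>R L X" "\<beta> *\<^sub>R L (- e)" "\<gamma> *\<^sub>R L u" G]
      LX Le gLu GG unfolding p' by simp
  have p2: "(norm p)\<^sup>2 \<le> 4 * (B\<^sup>2 * xx + B\<^sup>2 * ee + \<gamma>\<^sup>2 * hi * W + l\<^sup>2 * xx)"
    using convex_sum_inner_square_le[of "1/4" "1/4" "1/4" "1/4" "\<beta> *\<^sub>R L X" "\<beta> *\<^sub>R L (- e)" "\<gamma> *\<^sub>R L u" G]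
      LX Le gLu GG unfolding p' by simp
  have p3: "e10 * (norm p)\<^sup>2 \<le> e10 * (4 * (B\<^sup>2 * xx + B\<^sup>2 * ee + \<gamma>\<^sup>2 * hi * W + l\<^sup>2 * xx))"
    using pos by (intro mult_left_mono p2) auto
  have cc: "(norm c)\<^sup>2 \<le> 2 * xx + 2 * ee"
    using norm_diff_square_le[of X e] by (simp add: c xx_def ee_def)
  have "(\<gamma>\<^sup>2 + \<beta> * \<gamma>) / 2 * (c \<bullet> L c) - \<gamma> * \<beta> * (c \<bullet> L c) = \<gamma>\<^sup>2 / 2 * (c \<bullet> L c) - \<gamma> * \<beta> / 2 * (c \<bullet> L c)"
    by (simp add: algebra_simps add_divide_distrib)
  also have "\<dots> \<le> \<gamma>\<^sup>2 / 2 * (c \<bullet> L c)"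
    using pos nonneg[of c] by simp
  also have "\<dots> \<le> \<gamma>\<^sup>2 / 2 * (hi * (2 * xx + 2 * ee))"
    using order_trans[OF upper[of c] mult_left_mono[OF cc]] hi_pos by (intro mult_left_mono) auto
  finally have c2: "(\<gamma>\<^sup>2 + \<beta> * \<gamma>) / 2 * (c \<bullet> L c) - \<gamma> * \<beta> * (c \<bullet> L c) \<le> hi * \<gamma>\<^sup>2 * xx + hi * \<gamma>\<^sup>2 * ee"
    by (simp add: algebra_simps)
  have c3: "c \<bullet> L D \<le> xx + ee + l\<^sup>2 / 2 * N"
    using young_inner[of "1/2" c "L D"] cc D by simp
  have c4: "(\<beta> + \<gamma>) / (2 * \<gamma> ^ 3) * (D \<bullet> L D) \<le> (\<beta> + \<gamma>) / (2 * \<gamma> ^ 3) * (1 / lo) * l\<^sup>2 * N"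
  proof -
    have "D \<bullet> L D \<le> (1 / lo) * (l\<^sup>2 * N)"
      using form_le_image[OF S(3)] divide_right_mono[OF D, of lo] lo_pos by simp
    then have "(\<beta> + \<gamma>) / (2 * \<gamma> ^ 3) * (D \<bullet> L D) \<le> (\<beta> + \<gamma>) / (2 * \<gamma> ^ 3) * ((1 / lo) * (l\<^sup>2 * N))"
      using pos by (intro mult_left_mono) auto
    then show ?thesis
      by (simp only: mult.assoc)
  qed
  \<comment> \<open>Together with the \<open>8 / 5\<close> of \<open>p1\<close>, the weight
    \<open>2 / 5\<close> here completes the 2 in \<open>phi4'\<close>; the same weight in
    \<open>c6\<close> and the half in \<open>c8\<close> complete the \<open>5 / 2\<close> in
    \<open>phi2'\<close>. The price is \<open>5 / 2\<close> instead of 2 times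
    \<open>\<gamma>^2\<close> on \<open>xx\<close> and \<open>ee\<close>, covered by the slack terms
    below.\<close>
  have "- (L u \<bullet> c) \<le> 2 / 5 * (hi * W) + 5 / 8 * (2 * xx + 2 * ee)"
  proof -
    have "- (L u \<bullet> c) \<le> 2 / 5 * (norm (L u))\<^sup>2 + 5 / 8 * (norm c)\<^sup>2"
      using young_inner_minus[of "2/5" "L u" c] by simp
    with Lu cc show ?thesis
      by argo
  qed
  then have c5: "- \<gamma>\<^sup>2 * (L u \<bullet> c) \<le> \<gamma>\<^sup>2 * (2 / 5 * (hi * W) + 5 / 8 * (2 * xx + 2 * ee))"
    by (metis minus_mult_commute mult_left_mono zero_le_power2)
  have c6: "- \<gamma> * (G \<bullet> c) \<le> 2 / 5 * (l\<^sup>2 * xx) + 5 / 8 * \<gamma>\<^sup>2 * (2 * xx + 2 * ee)"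
    using young_inner_minus[of "2/5" G "\<gamma> *\<^sub>R c"] GG mult_left_mono[OF cc, of "\<gamma>\<^sup>2"]
    by (simp add: power_mult_distrib)
  have DD: "(norm D)\<^sup>2 \<le> (1 / lo\<^sup>2) * l\<^sup>2 * N"
    using norm_le_image[OF S(3)] divide_right_mono[OF D, of "lo\<^sup>2"] by simp
  have c7: "- (L u \<bullet> D) \<le> hi * W / 2 + 1 / 2 * (1 / lo\<^sup>2) * l\<^sup>2 * N"
  proof -
    have "- (L u \<bullet> D) \<le> 1 / 2 * (norm (L u))\<^sup>2 + 1 / 2 * (norm D)\<^sup>2"
      using young_inner_minus[of "1/2" "L u" D] by simp
    also have "\<dots> \<le> 1 / 2 * (hi * W) + 1 / 2 * ((1 / lo\<^sup>2) * l\<^sup>2 * N)"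
      by (intro add_mono mult_left_mono Lu DD) auto
    finally show ?thesis
      by simp
  qed
  have c8: "- ((G \<bullet> D) / \<gamma>) \<le> l\<^sup>2 * xx / 2 + 1 / (2 * \<gamma>\<^sup>2) * (1 / lo\<^sup>2) * l\<^sup>2 * N"
  proof -
    have "- ((G \<bullet> D) / \<gamma>) = - (G \<bullet> ((1 / \<gamma>) *\<^sub>R D))"
      by simp
    also have "\<dots> \<le> 1 / 2 * (norm G)\<^sup>2 + (norm ((1 / \<gamma>) *\<^sub>R D))\<^sup>2 / (4 * (1 / 2))"
      by (rule young_inner_minus) simp
    also have "(norm ((1 / \<gamma>) *\<^sub>R D))\<^sup>2 / (4 * (1 / 2)) = 1 / (2 * \<gamma>\<^sup>2) * (norm D)\<^sup>2"
      by (simp add: power_mult_distrib power_divide)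
    also have "\<dots> \<le> 1 / (2 * \<gamma>\<^sup>2) * ((1 / lo\<^sup>2) * l\<^sup>2 * N)"
      by (intro mult_left_mono DD) simp
    finally show ?thesis
      using GG by (simp add: mult.assoc)
  qed
  have \<gamma>2: "16 * \<gamma>\<^sup>2 \<le> B\<^sup>2"
    using power_mono[OF B, of 2] pos by (simp add: power_mult_distrib)
  have \<gamma>B: "4 * (B * \<gamma>) \<le> B\<^sup>2"
    using mult_left_mono[OF B, of B] B pos by (simp add: power2_eq_square)
  have lB: "lo * \<beta> * \<gamma> \<le> B * \<gamma>"
    using lo_le_hi pos by (auto simp: B_def intro!: mult_right_mono)
  have B2: "0 \<le> B\<^sup>2"
    by simp
  \<comment> \<open>\<open>lo \<beta> \<gamma>\<close> is at most a quarter of the square of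
    \<open>B\<close>, and half of the square of \<gamma> at most \<open>1 / 32\<close> of it; the
    sum stays below a third.\<close>
  have "0 \<le> B\<^sup>2 / 3 - lo * \<beta> * \<gamma> - \<gamma>\<^sup>2 / 2"
    using \<gamma>2 \<gamma>B lB B2 by linarith
  then have slackx: "0 \<le> (B\<^sup>2 / 3 - lo * \<beta> * \<gamma> - \<gamma>\<^sup>2 / 2) * xx"
    using nn by (intro mult_nonneg_nonneg)
  have "(hi - 2 * lo) * \<beta> * \<gamma> = B * \<gamma> - 2 * (lo * \<beta> * \<gamma>)"
    by (simp add: B_def algebra_simps)
  then have "0 \<le> B\<^sup>2 / 3 + (hi - 2 * lo) * \<beta> * \<gamma> - \<gamma>\<^sup>2 / 2"
    using \<gamma>2 \<gamma>B lB B2 by linarith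
  then have slacke: "0 \<le> (B\<^sup>2 / 3 + (hi - 2 * lo) * \<beta> * \<gamma> - \<gamma>\<^sup>2 / 2) * ee"
    using nn by (intro mult_nonneg_nonneg)
  have "(norm p)\<^sup>2 / 2 + e10 * (norm p)\<^sup>2 + (\<gamma>\<^sup>2 + \<beta> * \<gamma>) / 2 * (c \<bullet> L c) + c \<bullet> L D
      + (\<beta> + \<gamma>) / (2 * \<gamma> ^ 3) * (D \<bullet> L D) - \<gamma> * \<beta> * (c \<bullet> L c) - \<gamma>\<^sup>2 * (L u \<bullet> c)
      - \<gamma> * (G \<bullet> c) - L u \<bullet> D - (G \<bullet> D) / \<gamma>
    \<le> (8 / 3 * (B\<^sup>2 * xx) + 8 / 3 * (B\<^sup>2 * ee) + 8 / 5 * (\<gamma>\<^sup>2 * hi * W) + 8 / 5 * (l\<^sup>2 * xx))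
      + e10 * (4 * (B\<^sup>2 * xx + B\<^sup>2 * ee + \<gamma>\<^sup>2 * hi * W + l\<^sup>2 * xx))
      + (hi * \<gamma>\<^sup>2 * xx + hi * \<gamma>\<^sup>2 * ee) + (xx + ee + l\<^sup>2 / 2 * N)
      + (\<beta> + \<gamma>) / (2 * \<gamma> ^ 3) * (1 / lo) * l\<^sup>2 * N
      + \<gamma>\<^sup>2 * (2 / 5 * (hi * W) + 5 / 8 * (2 * xx + 2 * ee))
      + (2 / 5 * (l\<^sup>2 * xx) + 5 / 8 * \<gamma>\<^sup>2 * (2 * xx + 2 * ee))
      + (hi * W / 2 + 1 / 2 * (1 / lo\<^sup>2) * l\<^sup>2 * N)
      + (l\<^sup>2 * xx / 2 + 1 / (2 * \<gamma>\<^sup>2) * (1 / lo\<^sup>2) * l\<^sup>2 * N)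
      + (B\<^sup>2 / 3 - lo * \<beta> * \<gamma> - \<gamma>\<^sup>2 / 2) * xx + (B\<^sup>2 / 3 + (hi - 2 * lo) * \<beta> * \<gamma> - \<gamma>\<^sup>2 / 2) * ee"
    using p1 p3 c2 c3 c4 c5 c6 c7 c8 slackx slacke by linarith
  also have "\<dots> = phi2' hi lo l e10 \<beta> \<gamma> * xx + phi4' hi e10 \<gamma> * W
      + phi8' hi lo e10 \<beta> \<gamma> * ee + (phi6 lo l \<beta> \<gamma> - l / 2) * N"
    unfolding phi2'_def phi4'_def phi6_def phi8'_def B_def power_mult_distrib
    by (simp add: algebra_simps add_divide_distrib diff_divide_distrib)
  finally show ?thesis
    by (simp add: xx_def ee_def W_def)
qed

text \<open>\<open>disagreement\<close> is quadratic and the update affine in \<alpha>, so the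
  change is exactly \<alpha> times a first-order part plus \<open>\<alpha>^2\<close> times a
  second-order part, and the two preceding bounds apply.\<close>

lemma disagreement_step:
  assumes S: "X \<in> S" "u \<in> S" "D \<in> S" and pos: "0 < \<alpha>" "0 < \<gamma>" "0 < \<tau>" "0 \<le> e10" "0 \<le> N"
    and \<tau>: "4 / lo \<le> \<tau>" and \<beta>: "\<beta> = \<tau> * \<gamma>"
    and G: "(norm G)\<^sup>2 \<le> l\<^sup>2 * (norm X)\<^sup>2" and D: "(norm (L D))\<^sup>2 \<le> l\<^sup>2 * N"
    and p: "p = \<beta> *\<^sub>R L (X - e) + \<gamma> *\<^sub>R L u + G"
  shows "disagreement \<tau> (X - \<alpha> *\<^sub>R p) (u + \<alpha> *\<^sub>R (\<gamma> *\<^sub>R (X - e) + (1 / \<gamma>) *\<^sub>R D))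
      + e10 * \<alpha>\<^sup>2 * (norm p)\<^sup>2
    \<le> disagreement \<tau> X u
      - \<alpha> * (phi1 lo l \<beta> \<gamma> + 2 / 5 * l\<^sup>2 - \<alpha> * phi2' hi lo l e10 \<beta> \<gamma>) * (norm X)\<^sup>2
      - \<alpha> * (phi3 lo \<gamma> - \<alpha> * phi4' hi e10 \<gamma>) * (u \<bullet> L u)
      + (\<alpha> * phi7 hi \<beta> \<gamma> + \<alpha>\<^sup>2 * phi8' hi lo e10 \<beta> \<gamma>) * (norm e)\<^sup>2
      + \<alpha> * (1 / 8 - phi5 lo l \<beta> \<gamma> + \<alpha> * (phi6 lo l \<beta> \<gamma> - l / 2)) * N"
proof -
  define c where "c = X - e"
  define F where "F = - \<beta> * (X \<bullet> L c) - X \<bullet> G - \<gamma> * (e \<bullet> L u) + (\<beta> + \<gamma>) / \<gamma>\<^sup>2 * (u \<bullet> L D)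
      + \<gamma> * (X \<bullet> c) + (X \<bullet> D) / \<gamma> - \<gamma> * (u \<bullet> L u) - G \<bullet> u"
  define H where "H = (norm p)\<^sup>2 / 2 + e10 * (norm p)\<^sup>2 + (\<gamma>\<^sup>2 + \<beta> * \<gamma>) / 2 * (c \<bullet> L c) + c \<bullet> L D
      + (\<beta> + \<gamma>) / (2 * \<gamma> ^ 3) * (D \<bullet> L D) - \<gamma> * \<beta> * (c \<bullet> L c) - \<gamma>\<^sup>2 * (L u \<bullet> c)
      - \<gamma> * (G \<bullet> c) - L u \<bullet> D - (G \<bullet> D) / \<gamma>"
  have \<beta>0: "0 < \<beta>"
    using pos by (simp add: \<beta>)
  have \<beta>4: "4 * \<gamma> \<le> lo * \<beta>"
    using mult_right_mono[OF \<tau>, of "lo * \<gamma>"] lo_pos pos by (simp add: \<beta> mult_ac)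
  define d where "d = \<gamma> *\<^sub>R c + (1 / \<gamma>) *\<^sub>R D"
  have Xp: "X \<bullet> p = \<beta> * (X \<bullet> L c) + \<gamma> * (X \<bullet> L u) + X \<bullet> G"
    by (simp add: p c_def inner_add_right)
  have pu: "p \<bullet> u = \<beta> * (u \<bullet> L c) + \<gamma> * (u \<bullet> L u) + G \<bullet> u"
    by (simp add: p c_def inner_add_right inner_commute[of _ u] inner_commute[of G])
  have symc: "L D \<bullet> c = c \<bullet> L D" "D \<bullet> L c = c \<bullet> L D"
    using self_adjoint[of D c] by (simp_all add: inner_commute)
  have ud: "u \<bullet> L d = \<gamma> * (u \<bullet> L c) + (1 / \<gamma>) * (u \<bullet> L D)"
    by (simp add: d_def add scaleR inner_add_right)
  have dd: "d \<bullet> L d = \<gamma>\<^sup>2 * (c \<bullet> L c) + 2 * (c \<bullet> L D) + (1 / \<gamma>\<^sup>2) * (D \<bullet> L D)"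
    using pos symc by (simp add: d_def add scaleR inner_add_right inner_add_left field_simps power2_eq_square)
  have pd: "p \<bullet> d = \<beta> * \<gamma> * (c \<bullet> L c) + (\<beta> / \<gamma>) * (c \<bullet> L D) + \<gamma>\<^sup>2 * (L u \<bullet> c) + L u \<bullet> D
      + \<gamma> * (G \<bullet> c) + (1 / \<gamma>) * (G \<bullet> D)"
    using pos symc self_adjoint[of c c] self_adjoint[of c D]
    by (simp add: p c_def[symmetric] d_def inner_add_left inner_add_right power2_eq_square algebra_simps)
  \<comment> \<open>With \<open>\<beta> = \<tau> \<gamma>\<close> the coefficient of
    \<open>u \<bullet> L c\<close> is \<open>(1 + \<tau>) \<gamma> - \<beta> = \<gamma>\<close>;
    this splitting cancels the \<open>X \<bullet> L u\<close> from \<open>Xp\<close> and leaves only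
    \<open>e \<bullet> L u\<close>.\<close>
  have uLe: "u \<bullet> L c = X \<bullet> L u - e \<bullet> L u"
    using self_adjoint[of u c] by (simp add: c_def inner_diff_right inner_commute)
  have Xd: "X \<bullet> d = \<gamma> * (X \<bullet> c) + (1 / \<gamma>) * (X \<bullet> D)"
    by (simp add: d_def inner_add_right)
  have "disagreement \<tau> (X - \<alpha> *\<^sub>R p) (u + \<alpha> *\<^sub>R d)
      = disagreement \<tau> X u + \<alpha> * (- (X \<bullet> p) + (1 + \<tau>) * (u \<bullet> L d) + X \<bullet> d - p \<bullet> u)
        + \<alpha>\<^sup>2 * ((norm p)\<^sup>2 / 2 + (1 + \<tau>) / 2 * (d \<bullet> L d) - p \<bullet> d)"
    using self_adjoint[of u d] unfolding disagreement_def power2_norm_eq_inner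
    by (simp add: add scaleR inner_add_left inner_add_right inner_diff_left inner_diff_right
        inner_commute power2_eq_square algebra_simps add_divide_distrib diff_divide_distrib)
  also have "- (X \<bullet> p) + (1 + \<tau>) * (u \<bullet> L d) + X \<bullet> d - p \<bullet> u = F"
    unfolding Xp pu ud Xd F_def uLe using pos
    by (simp add: \<beta> field_simps power2_eq_square)
  also have "(norm p)\<^sup>2 / 2 + (1 + \<tau>) / 2 * (d \<bullet> L d) - p \<bullet> d = H - e10 * (norm p)\<^sup>2"
    unfolding dd pd H_def using pos
    by (simp add: \<beta> field_simps power2_eq_square eval_nat_numeral)
  finally have eq: "disagreement \<tau> (X - \<alpha> *\<^sub>R p) (u + \<alpha> *\<^sub>R d) + e10 * \<alpha>\<^sup>2 * (norm p)\<^sup>2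
      = disagreement \<tau> X u + \<alpha> * F + \<alpha>\<^sup>2 * H"
    by (simp add: algebra_simps)
  have F: "\<alpha> * F \<le> \<alpha> * (- (phi1 lo l \<beta> \<gamma> + 2 / 5 * l\<^sup>2) * (norm X)\<^sup>2 - phi3 lo \<gamma> * (u \<bullet> L u)
      + phi7 hi \<beta> \<gamma> * (norm e)\<^sup>2 + (1 / 8 - phi5 lo l \<beta> \<gamma>) * N)"
    unfolding F_def c_def using pos
    by (intro mult_left_mono first_order_bound[OF S \<beta>0 pos(2) G D]) auto
  have H: "\<alpha>\<^sup>2 * H \<le> \<alpha>\<^sup>2 * (phi2' hi lo l e10 \<beta> \<gamma> * (norm X)\<^sup>2 + phi4' hi e10 \<gamma> * (u \<bullet> L u)
      + phi8' hi lo e10 \<beta> \<gamma> * (norm e)\<^sup>2 + (phi6 lo l \<beta> \<gamma> - l / 2) * N)"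
    unfolding H_def
    by (intro mult_left_mono second_order_bound[OF S \<beta>0 pos(2,4,5) \<beta>4 G D p c_def]) auto
  show ?thesis
    using eq F H by (simp add: d_def c_def algebra_simps power2_eq_square)
qed

end

section \<open>Step size and gain parameters\<close>

locale parameters =
  fixes \<rho> \<rho>2 l \<nu> e9 e10 e12 \<tau> \<alpha> \<beta> \<gamma> :: real
  assumes \<rho>2: "0 < \<rho>2" "\<rho>2 \<le> \<rho>" and l: "0 < l" and \<nu>: "0 < \<nu>"
    and e9: "0 < e9" "e9 \<le> 1 / 2" and e10: "e10 = eps10 e9" and e12: "e12 = eps12 e9"
    and \<alpha>: "0 < \<alpha>" "\<alpha> < kappa0hat' \<rho> \<rho>2 l e10 e12 \<beta> \<gamma>"
    and \<tau>: "kappa1 \<rho>2 \<le> \<tau>" and \<beta>: "\<beta> = \<tau> * \<gamma>" and \<gamma>: "kappa2 \<rho>2 l < \<gamma>"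
begin

lemma \<gamma>_gt: "5 / \<rho>2 < \<gamma>" "2 + 2 * l\<^sup>2 < \<gamma>"
  using \<gamma> by (simp_all add: kappa2_def)

lemma \<gamma>_pos: "0 < \<gamma>"
  using \<gamma>_gt(2) by (smt (verit) zero_le_power2)

lemma \<tau>_ge: "4 / \<rho>2 \<le> \<tau>"
  using \<tau> by (simp add: kappa1_def)

lemma \<tau>_pos: "0 < \<tau>"
  using \<tau>_ge \<rho>2 by (meson divide_pos_pos order_less_le_trans zero_less_numeral)

lemma \<beta>_pos: "0 < \<beta>"
  using \<tau>_pos \<gamma>_pos by (simp add: \<beta>)

lemma \<rho>_pos: "0 < \<rho>"
  using \<rho>2 by linarith

lemma \<beta>_ge: "4 * \<gamma> \<le> \<rho>2 * \<beta>"
  using mult_right_mono[OF \<tau>_ge, of "\<rho>2 * \<gamma>"] \<rho>2 \<gamma>_pos by (simp add: \<beta> mult_ac)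

lemma e10_nonneg: "0 \<le> e10"
  using e9 by (auto simp: e10 eps10_def intro!: mult_nonneg_nonneg)

text \<open>The negative terms of \<open>phi2'\<close> and \<open>phi8'\<close> are multiples of
  \<open>\<rho>2 \<beta> \<gamma>\<close>. As \<open>4 \<gamma> \<le> \<rho>2 \<beta>\<close>, the
  leading square dominates them, which makes these denominators of \<open>kappa0hat'\<close>
  positive.\<close>

lemma cross_le: "\<rho>2 * \<beta> * \<gamma> * 2 \<le> (3 + 4 * e10) * \<rho>\<^sup>2 * \<beta>\<^sup>2"
proof -
  have B: "\<rho>2 * \<beta> \<le> \<rho> * \<beta>"
    using \<rho>2 \<beta>_pos by simp
  have "\<rho>2 * \<beta> * \<gamma> * 2 \<le> (\<rho>2 * \<beta>) * (\<rho>2 * \<beta>)"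
    using mult_left_mono[OF \<beta>_ge, of "\<rho>2 * \<beta>"] \<rho>2 \<beta>_pos \<gamma>_pos by simp
  also have "\<dots> \<le> (\<rho> * \<beta>) * (\<rho> * \<beta>)"
    using \<rho>2 \<beta>_pos \<rho>_pos by (intro mult_mono B) auto
  also have "\<dots> \<le> (3 + 4 * e10) * ((\<rho> * \<beta>) * (\<rho> * \<beta>))"
    using e10_nonneg mult_right_mono[of 1 "3 + 4 * e10" "(\<rho> * \<beta>) * (\<rho> * \<beta>)"] by simp
  finally show ?thesis
    by (simp add: power2_eq_square mult_ac)
qed

lemma phi2'_pos: "0 < phi2' \<rho> \<rho>2 l e10 \<beta> \<gamma>"
proof -
  have "0 \<le> \<rho>2 * \<beta> * \<gamma>" "0 \<le> (\<rho> + 2) * \<gamma>\<^sup>2" "0 \<le> (5 / 2 + 4 * e10) * l\<^sup>2"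
    using \<rho>2 \<beta>_pos \<gamma>_pos \<rho>_pos e10_nonneg by auto
  then show ?thesis
    using cross_le unfolding phi2'_def by linarith
qed

lemma phi4'_pos: "0 < phi4' \<rho> e10 \<gamma>"
  unfolding phi4'_def using \<rho>_pos e10_nonneg by (intro add_nonneg_pos mult_nonneg_nonneg) auto

lemma phi6_pos: "0 < phi6 \<rho>2 l \<beta> \<gamma>"
  unfolding phi6_def using \<rho>2 l \<beta>_pos \<gamma>_pos
  by (intro add_nonneg_pos add_nonneg_nonneg mult_nonneg_nonneg) auto

lemma phi7_pos: "0 < phi7 \<rho> \<beta> \<gamma>"
  unfolding phi7_def using \<rho>_pos \<beta>_pos \<gamma>_pos by (intro add_pos_pos) auto

lemma phi8'_pos: "0 < phi8' \<rho> \<rho>2 e10 \<beta> \<gamma>"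
proof -
  have "0 \<le> \<rho> * \<beta> * \<gamma>" "0 \<le> (\<rho> + 2) * \<gamma>\<^sup>2"
    using \<rho>2 \<beta>_pos \<gamma>_pos \<rho>_pos by auto
  moreover have "(\<rho> - 2 * \<rho>2) * \<beta> * \<gamma> = \<rho> * \<beta> * \<gamma> - \<rho>2 * \<beta> * \<gamma> * 2"
    by (simp add: algebra_simps)
  ultimately show ?thesis
    using cross_le unfolding phi8'_def by linarith
qed

lemma \<alpha>_phi: "\<alpha> * phi2' \<rho> \<rho>2 l e10 \<beta> \<gamma> < phi1 \<rho>2 l \<beta> \<gamma>" "\<alpha> * phi4' \<rho> e10 \<gamma> < phi3 \<rho>2 \<gamma>"
    "\<alpha> * phi6 \<rho>2 l \<beta> \<gamma> < phi5 \<rho>2 l \<beta> \<gamma>"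
  using \<alpha>(2) phi2'_pos phi4'_pos phi6_pos by (simp_all add: kappa0hat'_def pos_less_divide_eq)

text \<open>The last entry of \<open>kappa0hat'\<close> is the positive root of the quadratic
  \<open>phi8' t^2 + phi7 t - 2 e12\<close>, which is negative at every smaller positive
  \<open>t\<close>.\<close>

lemma \<alpha>_phi7: "\<alpha> * phi7 \<rho> \<beta> \<gamma> + \<alpha>\<^sup>2 * phi8' \<rho> \<rho>2 e10 \<beta> \<gamma> < 2 * e12"
proof -
  let ?a = "phi8' \<rho> \<rho>2 e10 \<beta> \<gamma>" and ?b = "phi7 \<rho> \<beta> \<gamma>"
  have "\<alpha> < (sqrt (?b\<^sup>2 + 8 * e12 * ?a) - ?b) / (2 * ?a)"
    using \<alpha>(2) by (simp add: kappa0hat'_def)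
  then have "2 * \<alpha> * ?a + ?b < sqrt (?b\<^sup>2 + 8 * e12 * ?a)"
    using phi8'_pos by (simp add: pos_less_divide_eq mult_ac)
  moreover have nn: "0 \<le> 2 * \<alpha> * ?a + ?b"
    using \<alpha> phi8'_pos phi7_pos by simp
  ultimately have "(2 * \<alpha> * ?a + ?b)\<^sup>2 < ?b\<^sup>2 + 8 * e12 * ?a"
    using real_less_rsqrt real_le_lsqrt by (metis linorder_not_less)
  then have "?a * (4 * (\<alpha> * ?b + \<alpha>\<^sup>2 * ?a)) < ?a * (4 * (2 * e12))"
    by (simp add: power2_sum power_mult_distrib power2_eq_square algebra_simps)
  then show ?thesis
    using phi8'_pos by simp
qed

text \<open>The mean of \<open>x\<close> also moves, which costs \<open>e10 * \<alpha>\<^sup>2\<close> times the squared averaged gradient in the compression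
  error; \<open>phi6\<close> has no such term, so it is absorbed by the slack of the descent inequality.\<close>

lemma \<alpha>_e10: "\<alpha> * e10 \<le> 1 / 40"
proof -
  have "\<alpha> * (4 * e10 * \<rho> * \<gamma>\<^sup>2) \<le> \<alpha> * phi4' \<rho> e10 \<gamma>"
    using \<alpha>(1) \<rho>_pos unfolding phi4'_def by (intro mult_left_mono) (auto simp: distrib_right)
  also have "\<dots> \<le> \<gamma> / 2"
    using \<alpha>_phi(2) \<rho>2(1) unfolding phi3_def by (smt (verit) divide_nonneg_pos zero_le_mult_iff)
  finally have "\<gamma> * (8 * (\<alpha> * e10) * (\<rho> * \<gamma>)) \<le> \<gamma> * 1"
    by (simp add: power2_eq_square mult_ac)
  then have le: "8 * (\<alpha> * e10) * (\<rho> * \<gamma>) \<le> 1"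
    using \<gamma>_pos by simp
  have "5 \<le> \<rho>2 * \<gamma>"
    using \<gamma>_gt(1) \<rho>2(1) by (simp add: field_simps)
  also have "\<dots> \<le> \<rho> * \<gamma>"
    using \<rho>2 \<gamma>_pos by simp
  finally have "8 * (\<alpha> * e10) * 5 \<le> 8 * (\<alpha> * e10) * (\<rho> * \<gamma>)"
    using \<alpha>(1) e10_nonneg by (intro mult_left_mono) auto
  with le show ?thesis
    by linarith
qed

lemma eps2_ge: "1 \<le> eps2 \<rho>2 \<tau>"
proof -
  have "4 \<le> \<tau> * \<rho>2"
    using \<tau>_ge \<rho>2 by (simp add: field_simps)
  then show ?thesis
    by (simp add: eps2_def le_max_iff_disj)
qed

definition rate_min :: real where
  "rate_min = Min {\<nu> / 2, eps3' \<rho> \<rho>2 l e10 \<alpha> \<beta> \<gamma>,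
     (2 * e12 - \<alpha> * phi7 \<rho> \<beta> \<gamma> - \<alpha>\<^sup>2 * phi8' \<rho> \<rho>2 e10 \<beta> \<gamma>) / \<alpha>}"

lemma rate_min_pos: "0 < rate_min"
  using \<nu> \<alpha>(1) \<alpha>_phi \<alpha>_phi7 by (simp add: rate_min_def eps3'_def)

lemma eps6'_eq: "eps6' \<rho> \<rho>2 l \<nu> e10 e12 \<tau> \<alpha> \<beta> \<gamma> = rate_min / eps2 \<rho>2 \<tau>"
  by (simp add: eps6'_def rate_min_def)

lemma eps6'_pos: "0 < eps6' \<rho> \<rho>2 l \<nu> e10 e12 \<tau> \<alpha> \<beta> \<gamma>"
  using rate_min_pos eps2_ge by (simp add: eps6'_eq)

text \<open>Every coefficient on the right is at least \<open>\<alpha> * rate_min\<close>. Division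
  by \<open>eps2\<close> pays for the upper bound on \<open>\<Phi>\<close>, and since
  \<open>eps2\<close> is at least 1 the other two terms can bear the same division.\<close>

lemma contraction:
  assumes nn: "0 \<le> xx" "0 \<le> W" "0 \<le> F" "0 \<le> ee" and \<Phi>: "\<Phi> \<le> eps2 \<rho>2 \<tau> * (xx + W)"
  shows "\<alpha> * eps6' \<rho> \<rho>2 l \<nu> e10 e12 \<tau> \<alpha> \<beta> \<gamma> * (\<Phi> + F + ee)
    \<le> \<alpha> * (phi1 \<rho>2 l \<beta> \<gamma> - \<alpha> * phi2' \<rho> \<rho>2 l e10 \<beta> \<gamma>) * xx + \<alpha> * (phi3 \<rho>2 \<gamma> - \<alpha> * phi4' \<rho> e10 \<gamma>) * W
      + \<alpha> * (\<nu> / 2) * F + (2 * e12 - \<alpha> * phi7 \<rho> \<beta> \<gamma> - \<alpha>\<^sup>2 * phi8' \<rho> \<rho>2 e10 \<beta> \<gamma>) * ee"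
proof -
  let ?R = "2 * e12 - \<alpha> * phi7 \<rho> \<beta> \<gamma> - \<alpha>\<^sup>2 * phi8' \<rho> \<rho>2 e10 \<beta> \<gamma>"
  have le: "rate_min \<le> phi1 \<rho>2 l \<beta> \<gamma> - \<alpha> * phi2' \<rho> \<rho>2 l e10 \<beta> \<gamma>"
    "rate_min \<le> phi3 \<rho>2 \<gamma> - \<alpha> * phi4' \<rho> e10 \<gamma>" "rate_min \<le> \<nu> / 2" "rate_min \<le> ?R / \<alpha>"
    unfolding rate_min_def eps3'_def
    by (simp_all add: min_le_iff_disj del: le_divide_eq_numeral1)
  have "1 * F \<le> eps2 \<rho>2 \<tau> * F" "1 * ee \<le> eps2 \<rho>2 \<tau> * ee"
    by (intro mult_right_mono eps2_ge nn)+
  then have "\<Phi> + F + ee \<le> eps2 \<rho>2 \<tau> * (xx + W + F + ee)"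
    using \<Phi> by (simp add: distrib_left)
  then have "rate_min / eps2 \<rho>2 \<tau> * (\<Phi> + F + ee) \<le> rate_min / eps2 \<rho>2 \<tau> * (eps2 \<rho>2 \<tau> * (xx + W + F + ee))"
    using rate_min_pos eps2_ge by (intro mult_left_mono) auto
  also have "\<dots> = rate_min * xx + rate_min * W + rate_min * F + rate_min * ee"
    using eps2_ge by (simp add: distrib_left)
  also have "\<dots> \<le> (phi1 \<rho>2 l \<beta> \<gamma> - \<alpha> * phi2' \<rho> \<rho>2 l e10 \<beta> \<gamma>) * xx + (phi3 \<rho>2 \<gamma> - \<alpha> * phi4' \<rho> e10 \<gamma>) * W
      + \<nu> / 2 * F + ?R / \<alpha> * ee"
    using le nn by (intro add_mono mult_right_mono)
  finally have "\<alpha> * (rate_min / eps2 \<rho>2 \<tau> * (\<Phi> + F + ee))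
      \<le> \<alpha> * ((phi1 \<rho>2 l \<beta> \<gamma> - \<alpha> * phi2' \<rho> \<rho>2 l e10 \<beta> \<gamma>) * xx + (phi3 \<rho>2 \<gamma> - \<alpha> * phi4' \<rho> e10 \<gamma>) * W
      + \<nu> / 2 * F + ?R / \<alpha> * ee)"
    using \<alpha>(1) by (intro mult_left_mono) auto
  then show ?thesis
    using \<alpha>(1) by (simp add: eps6'_eq distrib_left mult.assoc)
qed

end

section \<open>The Lyapunov function\<close>

locale compressed_network = parameters +
  fixes A :: "real^'n^'n" and f :: "'n \<Rightarrow> 'a::euclidean_space \<Rightarrow> real" and g :: "'n \<Rightarrow> 'a \<Rightarrow> 'a"
    and fstar :: real
  assumes card: "CARD('n) \<ge> 2" and adj: "adjacency A" and conn: "connected_graph A"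
    and \<rho>_eq: "\<rho> = spectral_radius (laplacian A)" and \<rho>2_eq: "\<rho>2 = least_pos_eigenvalue (laplacian A)"
    and gderiv: "\<And>i z. GDERIV (f i) z :> g i z"
    and lipschitz: "\<And>i z z'. norm (g i z - g i z') \<le> l * norm (z - z')"
    and fstar_le: "\<And>z. fstar \<le> agent_avg (\<lambda>i. f i z)"
    and PL: "\<And>z. 1 / 2 * (norm (agent_avg (\<lambda>i. g i z)))\<^sup>2 \<ge> \<nu> * (agent_avg (\<lambda>i. f i z) - fstar)"
begin

abbreviation Lap :: "'a^'n \<Rightarrow> 'a^'n" where "Lap \<equiv> mat_act (laplacian A)"

abbreviation zero_sum :: "('a^'n) set" where "zero_sum \<equiv> {x. (\<Sum>i\<in>UNIV. x $ i) = 0}"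

definition favg :: "'a \<Rightarrow> real" where "favg z = agent_avg (\<lambda>i. f i z)"

definition gavg :: "'a \<Rightarrow> 'a" where "gavg z = agent_avg (\<lambda>i. g i z)"

definition mean :: "'a^'n \<Rightarrow> 'a" where "mean x = agent_avg (($) x)"

definition grads :: "'a^'n \<Rightarrow> 'a^'n" where "grads x = (\<chi> i. g i (x $ i))"

definition mean_grads :: "'a^'n \<Rightarrow> 'a^'n" where "mean_grads x = (\<chi> i. g i (mean x))"

sublocale spectral_gap Lap zero_sum \<rho>2 \<rho>
proof
  show "Lap x \<bullet> y = x \<bullet> Lap y" for x y
    by (simp add: inner_commute[of "Lap x"] inner_laplacian[OF adj] inner_commute)
  show "0 \<le> x \<bullet> Lap x" for x
    using adj by (auto simp: inner_laplacian[OF adj] adjacency_def intro!: sum_nonneg)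
  show "x \<bullet> Lap x \<le> \<rho> * (norm x)\<^sup>2" for x
    using laplacian_le_spectral_radius[OF adj] by (simp add: \<rho>_eq)
  show "\<rho>2 * (norm x)\<^sup>2 \<le> x \<bullet> Lap x" if "x \<in> zero_sum" for x
    using least_pos_eigenvalue_laplacian(2)[OF adj conn card] that by (simp add: \<rho>2_eq)
qed (use \<rho>2 in \<open>auto simp: linear_add[OF linear_mat_act] linear_cmul[OF linear_mat_act]\<close>)

interpretation center: linear "center :: 'a^'n \<Rightarrow> 'a^'n"
  by (rule linear_center)

lemma center_Lap: "center (Lap x) = Lap x"
  by (rule center_id) (simp add: adj)

lemma Lap_center: "Lap (center x) = Lap x"
  by (rule laplacian_center)

lemma center_center: "center (center x) = center (x :: 'a^'n)"
  by (rule center_id) simp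

lemma zero_sum_Lap_inj:
  assumes "x \<in> zero_sum" "y \<in> zero_sum" "Lap x = Lap y"
  shows "x = y"
proof -
  have "x - y \<in> zero_sum"
    using assms by (simp add: sum_subtractf)
  then have "(norm (x - y))\<^sup>2 \<le> (norm (Lap (x - y)))\<^sup>2 / \<rho>2\<^sup>2"
    by (rule norm_le_image)
  then show ?thesis
    using assms(3) by (simp add: diff)
qed

text \<open>\<open>T\<close> acts as \<open>L\<close> on zero-sum stacks and as the identity on
  constant stacks, so it is injective and, in finite dimension, invertible. Centering its inverse
  inverts \<open>L\<close> on the zero-sum stacks.\<close>

lemma ex_pinv: "\<exists>P. linear P \<and> (\<forall>w. P w \<in> zero_sum \<and> Lap (P w) = center w)"
proof -
  define T where "T x = Lap x + (x - center x)" for x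
  have lin: "linear T"
    unfolding T_def[abs_def] using linear linear_center linear_id
    by (intro linear_compose_add linear_compose_sub) (auto simp: id_def)
  have cT: "center (T x) = Lap x" for x
    by (simp add: T_def center.add center.diff center_center center_Lap)
  have "inj T"
    unfolding linear_injective_0[OF lin]
  proof (intro allI impI)
    fix x
    assume "T x = 0"
    then have "Lap x = Lap 0"
      using cT[of x] by (simp add: center.zero zero)
    then have "center x = x"
      using \<open>T x = 0\<close> by (simp add: T_def zero)
    then have "x \<in> zero_sum"
      using sum_center[of x] by simp
    then show "x = 0"
      using zero_sum_Lap_inj[of x 0] \<open>Lap x = Lap 0\<close> by simp
  qed
  then obtain T' where T': "linear T'" "\<And>x. T (T' x) = x"
    using linear_injective_isomorphism[OF lin] by blast
  have "linear (\<lambda>w. center (T' w))"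
    using linear_compose[OF T'(1) linear_center] by (simp add: o_def)
  moreover have "Lap (center (T' w)) = center w" for w
    using cT[of "T' w"] by (simp add: Lap_center T'(2))
  ultimately show ?thesis
    by (intro exI[of _ "\<lambda>w. center (T' w)"]) simp
qed

definition pinv :: "'a^'n \<Rightarrow> 'a^'n" where
  "pinv = (SOME P. linear P \<and> (\<forall>w. P w \<in> zero_sum \<and> Lap (P w) = center w))"

lemma linear_pinv: "linear pinv" and pinv_in: "pinv w \<in> zero_sum" and Lap_pinv: "Lap (pinv w) = center w"
  using someI_ex[OF ex_pinv] unfolding pinv_def by auto

interpretation pinv: linear pinv
  by (rule linear_pinv)

lemma pinv_Lap: "pinv (Lap x) = center x"
  by (rule zero_sum_Lap_inj) (use pinv_in in \<open>auto simp: Lap_pinv center_Lap Lap_center\<close>)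

definition dual :: "'a^'n \<Rightarrow> 'a^'n \<Rightarrow> 'a^'n" where
  "dual x v = pinv (v + (1 / \<gamma>) *\<^sub>R mean_grads x)"

text \<open>The squared compression error is kept apart because, at time \<open>k\<close>, it is the
  only part of the Lyapunov function that depends on the compressor call of that time.\<close>

definition energy :: "'a^'n \<Rightarrow> 'a^'n \<Rightarrow> real" where
  "energy x v = disagreement \<tau> (center x) (dual x v) + real CARD('n) * (favg (mean x) - fstar)"

lemma energy_lower:
  "(norm (center x))\<^sup>2 / 4 + real CARD('n) * (favg (mean x) - fstar) \<le> energy x v"
  using disagreement_lower[OF _ \<tau>_ge, of "dual x v" "center x"] pinv_in
  by (simp add: energy_def dual_def)

lemma energy_nonneg: "0 \<le> energy x v"
proof -
  have "0 \<le> real CARD('n) * (favg (mean x) - fstar)"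
    using fstar_le[of "mean x"] by (simp add: favg_def)
  moreover have "0 \<le> (norm (center x))\<^sup>2 / 4"
    by simp
  ultimately show ?thesis
    using energy_lower[of x v] by linarith
qed

section \<open>The mean cost and the deviations of the local gradients\<close>

lemma gavg_gderiv: "GDERIV favg z :> gavg z"
  unfolding favg_def[abs_def] gavg_def by (rule gderiv_agent_avg[OF gderiv])

lemma gavg_lipschitz: "norm (gavg z - gavg z') \<le> l * norm (z - z')"
proof -
  have "gavg z - gavg z' = (1 / real CARD('n)) *\<^sub>R (\<Sum>i\<in>UNIV. g i z - g i z')"
    by (simp add: gavg_def agent_avg_def sum_subtractf scaleR_diff_right)
  then have "norm (gavg z - gavg z') = (1 / real CARD('n)) * norm (\<Sum>i\<in>UNIV. g i z - g i z')"
    by simp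
  also have "\<dots> \<le> (1 / real CARD('n)) * (\<Sum>i\<in>(UNIV::'n set). l * norm (z - z'))"
    by (intro mult_left_mono order_trans[OF norm_sum] sum_mono lipschitz) simp
  finally show ?thesis
    by simp
qed

lemma mean_linear: "linear mean"
  unfolding mean_def[abs_def] agent_avg_def
  by (rule linearI) (auto simp: sum.distrib scaleR_add_right scaleR_sum_right mult.commute)

interpretation mean: linear mean
  by (rule mean_linear)

lemma norm_square_mean: "(norm x)\<^sup>2 = (norm (center x))\<^sup>2 + real CARD('n) * (norm (mean x))\<^sup>2"
  unfolding mean_def by (rule norm_square_center)

lemma mean_eq_zero: "(\<Sum>i\<in>UNIV. x $ i) = 0 \<Longrightarrow> mean x = 0"
  by (simp add: mean_def agent_avg_def)

lemma grads_deviation: "(norm (grads x - mean_grads x))\<^sup>2 \<le> l\<^sup>2 * (norm (center x))\<^sup>2"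
proof -
  have "(norm (grads x - mean_grads x))\<^sup>2 = (\<Sum>i\<in>UNIV. (norm (g i (x $ i) - g i (mean x)))\<^sup>2)"
    by (simp add: norm_vec_def L2_set_def grads_def mean_grads_def sum_nonneg)
  also have "\<dots> \<le> (\<Sum>i\<in>UNIV. (l * norm (x $ i - mean x))\<^sup>2)"
    by (intro sum_mono power_mono lipschitz) simp
  also have "\<dots> = l\<^sup>2 * (norm (center x))\<^sup>2"
    by (simp add: norm_vec_def L2_set_def sum_nonneg center_def mean_def power_mult_distrib sum_distrib_left)
  finally show ?thesis .
qed

lemma mean_grads_diff:
  "(norm (mean_grads x - mean_grads x'))\<^sup>2 \<le> real CARD('n) * (l * norm (mean x - mean x'))\<^sup>2"
proof -
  have "(norm (mean_grads x - mean_grads x'))\<^sup>2 = (\<Sum>i\<in>UNIV. (norm (g i (mean x) - g i (mean x')))\<^sup>2)"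
    by (simp add: norm_vec_def L2_set_def mean_grads_def sum_nonneg)
  also have "\<dots> \<le> (\<Sum>i\<in>(UNIV::'n set). (l * norm (mean x - mean x'))\<^sup>2)"
    by (intro sum_mono power_mono lipschitz) simp
  finally show ?thesis
    by simp
qed

lemma mean_mean_grads: "mean (mean_grads x) = gavg (mean x)"
  by (simp add: mean_def mean_grads_def gavg_def agent_avg_def)

text \<open>No randomness enters: \<open>h\<close> is arbitrary, and the new state is still compared
  with the old \<open>h\<close>. Since \<open>L h\<close> and \<open>v\<close> are zero-sum, the
  mean moves by the averaged gradient alone. This motion causes the drift of \<open>u\<close> and
  part of the growth of the compression error, and the descent of the mean cost pays for
  both.\<close>

lemma energy_step:
  assumes v: "(\<Sum>i\<in>UNIV. v $ i) = 0"
    and x': "x' = x - \<alpha> *\<^sub>R (\<beta> *\<^sub>R Lap h + \<gamma> *\<^sub>R v + grads x)"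
    and v': "v' = v + (\<alpha> * \<gamma>) *\<^sub>R Lap h"
  shows "energy x' v' + (1 - 2 * e9) * (norm (x' - h))\<^sup>2
    \<le> (1 - \<alpha> * eps6' \<rho> \<rho>2 l \<nu> e10 e12 \<tau> \<alpha> \<beta> \<gamma>) * (energy x v + (norm (x - h))\<^sup>2)"
proof -
  \<comment> \<open>Only the centered error acts on the disagreement, since \<open>L\<close>
    annihilates constant stacks; the Lyapunov function keeps the full error
    \<open>x - h\<close>.\<close>
  define X u e where "X = center x" and "u = dual x v" and "e = center (x - h)"
  define G where "G = center (grads x - mean_grads x)"
  \<comment> \<open>After division by \<alpha>, the squared norm of \<open>\<Delta>\<close> is at
    most \<open>l^2 * N\<close>, with no dependence on the step size.\<close>
  define \<Delta> where "\<Delta> = (1 / \<alpha>) *\<^sub>R (mean_grads x' - mean_grads x)"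
  define D where "D = pinv \<Delta>"
  define p where "p = \<beta> *\<^sub>R Lap (X - e) + \<gamma> *\<^sub>R Lap u + G"
  define b where "b = mean (grads x)"
  define N where "N = real CARD('n) * (norm b)\<^sup>2"
  define N0 where "N0 = real CARD('n) * (norm (gavg (mean x)))\<^sup>2"
  define F where "F = real CARD('n) * (favg (mean x) - fstar)"
  have Xe: "X - e = center h"
    by (simp add: X_def e_def center.diff)
  have Lh: "Lap (X - e) = Lap h"
    by (simp add: Xe Lap_center)
  have gLu: "\<gamma> *\<^sub>R Lap u = \<gamma> *\<^sub>R center v + center (mean_grads x)"
    using \<gamma>_pos by (simp add: u_def dual_def Lap_pinv center.add center.scaleR scaleR_add_right)
  have p_eq: "p = center (\<beta> *\<^sub>R Lap h + \<gamma> *\<^sub>R v + grads x)"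
    by (simp add: p_def Lh gLu G_def center.add center.diff center.scaleR center_Lap)
  have cx': "center x' = X - \<alpha> *\<^sub>R p"
    by (simp add: x' p_eq X_def center.diff center.scaleR)
  have mx': "mean x' - mean x = - \<alpha> *\<^sub>R b"
    using v by (simp add: x' mean.diff mean.scaleR mean.add b_def mean_eq_zero adj)
  have "dual x' v' = pinv ((v + (1 / \<gamma>) *\<^sub>R mean_grads x) + \<alpha> *\<^sub>R (\<gamma> *\<^sub>R Lap h + (1 / \<gamma>) *\<^sub>R \<Delta>))"
    using \<alpha>(1) by (simp add: dual_def v' \<Delta>_def scaleR_add_right scaleR_diff_right add.assoc)
  also have "\<dots> = u + \<alpha> *\<^sub>R (\<gamma> *\<^sub>R (X - e) + (1 / \<gamma>) *\<^sub>R D)"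
    by (simp only: pinv.add pinv.scaleR pinv_Lap Xe u_def dual_def D_def)
  finally have u': "dual x' v' = u + \<alpha> *\<^sub>R (\<gamma> *\<^sub>R (X - e) + (1 / \<gamma>) *\<^sub>R D)" .
  have N: "0 \<le> N"
    by (simp add: N_def)
  have GG: "(norm G)\<^sup>2 \<le> l\<^sup>2 * (norm X)\<^sup>2"
    using order_trans[OF power_mono[OF norm_center_le norm_ge_zero] grads_deviation[of x]]
    by (simp add: G_def X_def)
  have "(norm (Lap D))\<^sup>2 \<le> (norm \<Delta>)\<^sup>2"
    by (simp add: D_def Lap_pinv norm_center_le)
  also have "\<dots> = (1 / \<alpha>)\<^sup>2 * (norm (mean_grads x' - mean_grads x))\<^sup>2"
    by (simp add: \<Delta>_def power_mult_distrib power_divide)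
  also have "\<dots> \<le> (1 / \<alpha>)\<^sup>2 * (real CARD('n) * (l * norm (mean x' - mean x))\<^sup>2)"
    by (intro mult_left_mono mean_grads_diff) simp
  also have "\<dots> = l\<^sup>2 * N"
    using \<alpha>(1) unfolding mx' by (simp add: N_def power_mult_distrib power_divide)
  finally have DD: "(norm (Lap D))\<^sup>2 \<le> l\<^sup>2 * N" .
  have XS: "X \<in> zero_sum" and uS: "u \<in> zero_sum" and DS: "D \<in> zero_sum"
    using pinv_in by (auto simp: X_def u_def dual_def D_def)
  define \<Phi> \<Phi>' where "\<Phi> = disagreement \<tau> X u" and "\<Phi>' = disagreement \<tau> (center x') (dual x' v')"
  define xx W ee where "xx = (norm X)\<^sup>2" and "W = u \<bullet> Lap u" and "ee = (norm (x - h))\<^sup>2"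
  have nn: "0 \<le> xx" "0 \<le> W" "0 \<le> ee" "0 \<le> F" "0 \<le> N0"
    using fstar_le[of "mean x"] by (auto simp: xx_def W_def ee_def F_def N0_def favg_def nonneg)
  have dis: "\<Phi>' + e10 * \<alpha>\<^sup>2 * (norm p)\<^sup>2
    \<le> \<Phi> - \<alpha> * (phi1 \<rho>2 l \<beta> \<gamma> + 2 / 5 * l\<^sup>2 - \<alpha> * phi2' \<rho> \<rho>2 l e10 \<beta> \<gamma>) * xx
      - \<alpha> * (phi3 \<rho>2 \<gamma> - \<alpha> * phi4' \<rho> e10 \<gamma>) * W
      + (\<alpha> * phi7 \<rho> \<beta> \<gamma> + \<alpha>\<^sup>2 * phi8' \<rho> \<rho>2 e10 \<beta> \<gamma>) * (norm e)\<^sup>2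
      + \<alpha> * (1 / 8 - phi5 \<rho>2 l \<beta> \<gamma> + \<alpha> * (phi6 \<rho>2 l \<beta> \<gamma> - l / 2)) * N"
    unfolding \<Phi>_def \<Phi>'_def xx_def W_def cx' u'
    by (rule disagreement_step[OF XS uS DS \<alpha>(1) \<gamma>_pos \<tau>_pos e10_nonneg N \<tau>_ge \<beta> GG DD p_def])
  have ee: "(\<alpha> * phi7 \<rho> \<beta> \<gamma> + \<alpha>\<^sup>2 * phi8' \<rho> \<rho>2 e10 \<beta> \<gamma>) * (norm e)\<^sup>2
      \<le> (\<alpha> * phi7 \<rho> \<beta> \<gamma> + \<alpha>\<^sup>2 * phi8' \<rho> \<rho>2 e10 \<beta> \<gamma>) * ee"
    unfolding ee_def e_def using \<alpha>(1) phi7_pos phi8'_pos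
    by (intro mult_left_mono power_mono norm_center_le) auto
  have "favg (mean x + - \<alpha> *\<^sub>R b) \<le> favg (mean x) + (- \<alpha> *\<^sub>R b) \<bullet> gavg (mean x) + l / 2 * (norm (- \<alpha> *\<^sub>R b))\<^sup>2"
    by (rule descent_inequality[OF gavg_gderiv gavg_lipschitz])
  moreover have "mean x' = mean x + - \<alpha> *\<^sub>R b"
    using mx' by (simp add: algebra_simps)
  ultimately have "favg (mean x') \<le> favg (mean x) - \<alpha> * (b \<bullet> gavg (mean x)) + l / 2 * \<alpha>\<^sup>2 * (norm b)\<^sup>2"
    by (simp add: power_mult_distrib)
  then have "real CARD('n) * favg (mean x') \<le> real CARD('n) * (favg (mean x) - \<alpha> * (b \<bullet> gavg (mean x)) + l / 2 * \<alpha>\<^sup>2 * (norm b)\<^sup>2)"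
    by (intro mult_left_mono) auto
  then have desc: "real CARD('n) * (favg (mean x') - fstar)
      \<le> F + \<alpha> * (- (real CARD('n) * (b \<bullet> gavg (mean x)))) + l / 2 * \<alpha>\<^sup>2 * N"
    by (simp add: F_def N_def algebra_simps)
  have d: "real CARD('n) * (norm (b - gavg (mean x)))\<^sup>2 \<le> l\<^sup>2 * xx"
  proof -
    have "b - gavg (mean x) = mean (grads x - mean_grads x)"
      by (simp add: b_def mean.diff mean_mean_grads)
    moreover have "0 \<le> (norm (center (grads x - mean_grads x)))\<^sup>2"
      by simp
    ultimately show ?thesis
      using norm_square_mean[of "grads x - mean_grads x"] grads_deviation[of x]
      unfolding xx_def X_def by (simp only:)
  qed
  have sq: "real CARD('n) * (norm (b - gavg (mean x)))\<^sup>2 = N + N0 - 2 * (real CARD('n) * (b \<bullet> gavg (mean x)))"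
    unfolding N_def N0_def power2_norm_eq_inner
    by (simp add: inner_diff_left inner_diff_right inner_commute algebra_simps)
  have sq2: "real CARD('n) * (norm (b - gavg (mean x)))\<^sup>2 \<le> 2 * N + 2 * N0"
    using mult_left_mono[OF norm_diff_square_le[of b "gavg (mean x)"], of "real CARD('n)"]
    by (simp add: N_def N0_def algebra_simps)
  \<comment> \<open>By \<open>sq\<close>, half of the squared difference has to be bounded. Four
    fifths of it are bounded by \<open>d\<close> and one fifth by \<open>sq2\<close>, so that no
    more than the reserve \<open>2 / 5 * l^2\<close> is spent.\<close>
  have "- (real CARD('n) * (b \<bullet> gavg (mean x))) \<le> 2 / 5 * l\<^sup>2 * xx - 3 / 20 * N - N0 / 4"
    using d sq sq2 N nn(5) by linarith
  then have cross: "\<alpha> * (- (real CARD('n) * (b \<bullet> gavg (mean x)))) \<le> \<alpha> * (2 / 5 * l\<^sup>2 * xx - 3 / 20 * N - N0 / 4)"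
    using \<alpha>(1) by (intro mult_left_mono) auto
  have "\<nu> * F * 2 \<le> N0"
    using mult_left_mono[OF PL[of "mean x"], of "2 * real CARD('n)"]
    by (simp add: F_def N0_def favg_def gavg_def algebra_simps)
  then have PLx: "\<alpha> * (\<nu> / 2) * F \<le> \<alpha> * (N0 / 4)"
    using \<alpha>(1) by (simp add: mult.commute)
  \<comment> \<open>The budget closes here: \<open>\<alpha> * phi6 < phi5\<close>,
    \<open>\<alpha> * e10 \<le> 1 / 40\<close> and \<open>1 / 8 + 1 / 40 = 3 / 20\<close>.\<close>
  have "\<alpha> * N * (1 / 8 - phi5 \<rho>2 l \<beta> \<gamma> + \<alpha> * phi6 \<rho>2 l \<beta> \<gamma> + \<alpha> * e10 - 3 / 20) \<le> 0"
    using \<alpha>_phi(3) \<alpha>_e10 \<alpha>(1) N by (intro mult_nonneg_nonpos) auto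
  then have Nle: "\<alpha> * (1 / 8 - phi5 \<rho>2 l \<beta> \<gamma> + \<alpha> * (phi6 \<rho>2 l \<beta> \<gamma> - l / 2)) * N + l / 2 * \<alpha>\<^sup>2 * N
      + e10 * \<alpha>\<^sup>2 * N - \<alpha> * (3 / 20 * N) \<le> 0"
    by (simp add: algebra_simps power2_eq_square)
  \<comment> \<open>Pythagoras: \<open>p\<close> is the centered part of the step per unit of
    \<alpha>, and \<open>N\<close> the squared norm of its mean part.\<close>
  have x'x: "(norm (x' - x))\<^sup>2 = \<alpha>\<^sup>2 * (norm p)\<^sup>2 + \<alpha>\<^sup>2 * N"
    using cx' mx' by (simp add: norm_square_mean[of "x' - x"] center.diff mean.diff X_def[symmetric]
        power_mult_distrib N_def)
  \<comment> \<open>Splitting with weight \<open>e9\<close> is the origin of \<open>eps10\<close>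
    and \<open>eps12\<close>: the two products are \<open>1 - 2 * e12\<close> and
    \<open>e10\<close>.\<close>
  have "(1 - 2 * e9) * (norm ((x - h) + (x' - x)))\<^sup>2
      \<le> (1 - 2 * e9) * ((1 + e9) * ee + (1 + 1 / e9) * (norm (x' - x))\<^sup>2)"
    unfolding ee_def using e9 by (intro mult_left_mono norm_add_square_le_weighted) auto
  also have "\<dots> = (1 - 2 * e12) * ee + e10 * (norm (x' - x))\<^sup>2"
  proof -
    have "(1 - 2 * e9) * (1 + e9) = 1 - 2 * e12"
      by (simp add: e12 eps12_def algebra_simps power2_eq_square)
    then show ?thesis
      by (simp only: e10 eps10_def distrib_left mult.assoc[symmetric])
  qed
  finally have comp: "(1 - 2 * e9) * (norm (x' - h))\<^sup>2
      \<le> (1 - 2 * e12) * ee + (e10 * \<alpha>\<^sup>2 * (norm p)\<^sup>2 + e10 * \<alpha>\<^sup>2 * N)"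
    by (simp add: x'x algebra_simps)
  have con: "\<alpha> * eps6' \<rho> \<rho>2 l \<nu> e10 e12 \<tau> \<alpha> \<beta> \<gamma> * (\<Phi> + F + ee)
    \<le> \<alpha> * (phi1 \<rho>2 l \<beta> \<gamma> - \<alpha> * phi2' \<rho> \<rho>2 l e10 \<beta> \<gamma>) * xx + \<alpha> * (phi3 \<rho>2 \<gamma> - \<alpha> * phi4' \<rho> e10 \<gamma>) * W
      + \<alpha> * (\<nu> / 2) * F + (2 * e12 - \<alpha> * phi7 \<rho> \<beta> \<gamma> - \<alpha>\<^sup>2 * phi8' \<rho> \<rho>2 e10 \<beta> \<gamma>) * ee"
    unfolding \<Phi>_def xx_def W_def
    by (intro contraction disagreement_upper) (use nn \<tau>_ge uS in \<open>auto simp: xx_def W_def\<close>)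
  have 1: "\<alpha> * (phi1 \<rho>2 l \<beta> \<gamma> + 2 / 5 * l\<^sup>2 - \<alpha> * phi2' \<rho> \<rho>2 l e10 \<beta> \<gamma>) * xx
      = \<alpha> * (phi1 \<rho>2 l \<beta> \<gamma> - \<alpha> * phi2' \<rho> \<rho>2 l e10 \<beta> \<gamma>) * xx + \<alpha> * (2 / 5 * l\<^sup>2 * xx)"
    by (simp add: algebra_simps)
  have 2: "(\<alpha> * phi7 \<rho> \<beta> \<gamma> + \<alpha>\<^sup>2 * phi8' \<rho> \<rho>2 e10 \<beta> \<gamma>) * ee + (1 - 2 * e12) * ee
      = ee - (2 * e12 - \<alpha> * phi7 \<rho> \<beta> \<gamma> - \<alpha>\<^sup>2 * phi8' \<rho> \<rho>2 e10 \<beta> \<gamma>) * ee"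
    by (simp add: algebra_simps)
  have 3: "\<alpha> * (2 / 5 * l\<^sup>2 * xx - 3 / 20 * N - N0 / 4)
      = \<alpha> * (2 / 5 * l\<^sup>2 * xx) - \<alpha> * (3 / 20 * N) - \<alpha> * (N0 / 4)"
    by (simp add: algebra_simps)
  have combine: "P' + F' + H \<le> (P + F1 + E) - C"
    if "P' + q \<le> P - (a + b1) - c + k + t" "k \<le> k1" "F' \<le> F1 + r + s1" "r \<le> b1 - n1 - m1"
      "nf \<le> m1" "t + s1 + q1 - n1 \<le> 0" "H \<le> E1 + (q + q1)" "C \<le> a + c + nf + z" "k1 + E1 = E - z"
    for P' q P a b1 c k k1 t F' F1 r s1 n1 m1 nf q1 H E1 E C z :: real
    using that by linarith
  have "\<Phi>' + real CARD('n) * (favg (mean x') - fstar) + (1 - 2 * e9) * (norm (x' - h))\<^sup>2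
      \<le> (\<Phi> + F + ee) - \<alpha> * eps6' \<rho> \<rho>2 l \<nu> e10 e12 \<tau> \<alpha> \<beta> \<gamma> * (\<Phi> + F + ee)"
    by (rule combine[OF dis[unfolded 1] ee desc cross[unfolded 3] PLx Nle comp con 2])
  then show ?thesis
    by (simp add: energy_def \<Phi>_def \<Phi>'_def X_def u_def F_def ee_def left_diff_distrib)
qed

end

section \<open>Random seeds\<close>

text \<open>Independence is only available for the joint law of the past seeds, so quantities known before
  time \<open>k\<close> are presented as measurable functions of the family of past seeds.\<close>

definition known_before ::
  "'w measure \<Rightarrow> 's measure \<Rightarrow> ('n \<times> nat \<Rightarrow> 'w \<Rightarrow> 's) \<Rightarrow> nat \<Rightarrow> ('w \<Rightarrow> 'b::topological_space) \<Rightarrow> bool" where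
  "known_before M D \<xi> k h \<longleftrightarrow> (\<exists>H\<in>borel_measurable (PiM (UNIV \<times> {..<k}) (\<lambda>_. D)).
     \<forall>w\<in>space M. h w = H (\<lambda>c\<in>UNIV \<times> {..<k}. \<xi> c w))"

lemma known_before_cong:
  assumes "known_before M D \<xi> k h" "\<And>w. w \<in> space M \<Longrightarrow> h' w = h w"
  shows "known_before M D \<xi> k h'"
  using assms unfolding known_before_def by metis

lemma known_before_const: "known_before M D \<xi> k (\<lambda>_. c)"
  unfolding known_before_def by (intro bexI[of _ "\<lambda>_. c"]) auto

lemma known_before_compose:
  assumes "known_before M D \<xi> k h" and [measurable]: "F \<in> borel_measurable borel"
  shows "known_before M D \<xi> k (\<lambda>w. F (h w))"
proof -
  obtain H where [measurable]: "H \<in> borel_measurable (PiM (UNIV \<times> {..<k}) (\<lambda>_. D))"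
    and "\<forall>w\<in>space M. h w = H (\<lambda>c\<in>UNIV \<times> {..<k}. \<xi> c w)"
    using assms(1) by (auto simp: known_before_def)
  then show ?thesis
    unfolding known_before_def by (intro bexI[of _ "\<lambda>\<zeta>. F (H \<zeta>)"]) auto
qed

lemma known_before_add:
  fixes h h' :: "'w \<Rightarrow> 'b::euclidean_space"
  assumes "known_before M D \<xi> k h" "known_before M D \<xi> k h'"
  shows "known_before M D \<xi> k (\<lambda>w. h w + h' w)"
proof -
  obtain H H' where [measurable]: "H \<in> borel_measurable (PiM (UNIV \<times> {..<k}) (\<lambda>_. D))"
      "H' \<in> borel_measurable (PiM (UNIV \<times> {..<k}) (\<lambda>_. D))"
    and "\<forall>w\<in>space M. h w = H (\<lambda>c\<in>UNIV \<times> {..<k}. \<xi> c w)"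
      "\<forall>w\<in>space M. h' w = H' (\<lambda>c\<in>UNIV \<times> {..<k}. \<xi> c w)"
    using assms by (auto simp: known_before_def)
  then show ?thesis
    unfolding known_before_def by (intro bexI[of _ "\<lambda>\<zeta>. H \<zeta> + H' \<zeta>"]) auto
qed

lemma known_before_scaleR:
  fixes h :: "'w \<Rightarrow> 'b::euclidean_space"
  assumes "known_before M D \<xi> k h"
  shows "known_before M D \<xi> k (\<lambda>w. c *\<^sub>R h w)"
  using known_before_compose[OF assms, of "\<lambda>z. c *\<^sub>R z"] by simp

lemma known_before_diff:
  fixes h h' :: "'w \<Rightarrow> 'b::euclidean_space"
  assumes "known_before M D \<xi> k h" "known_before M D \<xi> k h'"
  shows "known_before M D \<xi> k (\<lambda>w. h w - h' w)"
  using known_before_add[OF assms(1) known_before_scaleR[OF assms(2), of "- 1"]] by simp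

lemma restrict_past_measurable:
  "(\<lambda>\<zeta>. restrict \<zeta> (UNIV \<times> {..<k})) \<in> measurable (PiM (UNIV \<times> {..<Suc k}) (\<lambda>_. D)) (PiM (UNIV \<times> {..<k}) (\<lambda>_. D))"
  by (rule measurable_restrict_subset) auto

lemma restrict_restrict_past:
  "restrict (\<lambda>c\<in>UNIV \<times> {..<Suc k}. z c) (UNIV \<times> {..<k}) = (\<lambda>c\<in>UNIV \<times> {..<k}. z c)"
  by (auto simp: restrict_def fun_eq_iff)

lemma known_before_Suc:
  assumes "known_before M D \<xi> k h"
  shows "known_before M D \<xi> (Suc k) h"
proof -
  obtain H where H: "H \<in> borel_measurable (PiM (UNIV \<times> {..<k}) (\<lambda>_. D))"
    and h: "\<forall>w\<in>space M. h w = H (\<lambda>c\<in>UNIV \<times> {..<k}. \<xi> c w)"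
    using assms by (auto simp: known_before_def)
  show ?thesis
    unfolding known_before_def
  proof (intro bexI ballI)
    show "(\<lambda>\<zeta>. H (restrict \<zeta> (UNIV \<times> {..<k}))) \<in> borel_measurable (PiM (UNIV \<times> {..<Suc k}) (\<lambda>_. D))"
      using restrict_past_measurable H by (rule measurable_compose)
    show "h w = H (restrict (\<lambda>c\<in>UNIV \<times> {..<Suc k}. \<xi> c w) (UNIV \<times> {..<k}))" if "w \<in> space M" for w
      using h that by (simp only: restrict_restrict_past)
  qed
qed

lemma borel_measurable_vec_lambda:
  fixes h :: "'i::finite \<Rightarrow> 'w \<Rightarrow> 'b::euclidean_space"
  assumes "\<And>i. h i \<in> borel_measurable M"
  shows "(\<lambda>w. \<chi> i. h i w) \<in> borel_measurable M"
  using assms by (intro borel_measurable_euclidean_space[THEN iffD2])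
    (auto simp: Basis_vec_def inner_axis)

text \<open>The call consumes the seeds of time \<open>k\<close>, so the index rises by one although
  the argument is known before \<open>k\<close>.\<close>

lemma known_before_compressed:
  fixes z :: "'w \<Rightarrow> (real^'d)^'n" and Q :: "'s \<Rightarrow> real^'d \<Rightarrow> real^'d"
  assumes "known_before M D \<xi> k z" and Q: "case_prod Q \<in> borel_measurable (D \<Otimes>\<^sub>M borel)"
  shows "known_before M D \<xi> (Suc k) (\<lambda>w. \<chi> i. Q (\<xi> (i, k) w) (z w $ i))"
proof -
  obtain H where H: "H \<in> borel_measurable (PiM (UNIV \<times> {..<Suc k}) (\<lambda>_. D))"
    and z: "\<forall>w\<in>space M. z w = H (\<lambda>c\<in>UNIV \<times> {..<Suc k}. \<xi> c w)"
    using known_before_Suc[OF assms(1)] by (auto simp: known_before_def)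
  show ?thesis
    unfolding known_before_def
  proof (intro bexI ballI)
    show "(\<lambda>\<zeta>. \<chi> i. Q (\<zeta> (i, k)) (H \<zeta> $ i)) \<in> borel_measurable (PiM (UNIV \<times> {..<Suc k}) (\<lambda>_. D))"
    proof (rule borel_measurable_vec_lambda)
      fix i
      have pair: "(\<lambda>\<zeta>. (\<zeta> (i, k), H \<zeta> $ i)) \<in> measurable (PiM (UNIV \<times> {..<Suc k}) (\<lambda>_. D)) (D \<Otimes>\<^sub>M borel)"
        using borel_measurable_continuous_on[OF continuous_on_component[OF continuous_on_id] H, of i]
        by (intro measurable_Pair measurable_component_singleton) auto
      show "(\<lambda>\<zeta>. Q (\<zeta> (i, k)) (H \<zeta> $ i)) \<in> borel_measurable (PiM (UNIV \<times> {..<Suc k}) (\<lambda>_. D))"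
        using measurable_compose[OF pair Q] by simp
    qed
  qed (use z in auto)
qed

lemma known_before_measurable:
  fixes h :: "'w \<Rightarrow> 'b::euclidean_space" and \<xi> :: "'n::finite \<times> nat \<Rightarrow> 'w \<Rightarrow> 's"
  assumes "known_before M D \<xi> k h" and \<xi>: "\<And>c. \<xi> c \<in> measurable M D"
  shows "h \<in> borel_measurable M"
proof -
  obtain H where H: "H \<in> borel_measurable (PiM (UNIV \<times> {..<k}) (\<lambda>_. D))"
    and h: "\<forall>w\<in>space M. h w = H (\<lambda>c\<in>UNIV \<times> {..<k}. \<xi> c w)"
    using assms(1) by (auto simp: known_before_def)
  have "(\<lambda>w. \<lambda>c\<in>UNIV \<times> {..<k}. \<xi> c w) \<in> measurable M (PiM (UNIV \<times> {..<k}) (\<lambda>_. D))"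
    by (intro measurable_restrict \<xi>)
  then have "(\<lambda>w. H (\<lambda>c\<in>UNIV \<times> {..<k}. \<xi> c w)) \<in> borel_measurable M"
    using H by (rule measurable_compose)
  then show ?thesis
    by (subst measurable_cong[of M h "\<lambda>w. H (\<lambda>c\<in>UNIV \<times> {..<k}. \<xi> c w)"]) (use h in auto)
qed

text \<open>Conditioning on the past by Fubini: the fresh seed and the past have a product joint
  law, so with the past frozen at \<open>b\<close> the argument is the fixed vector
  \<open>H b\<close>, the seed has law \<open>D\<close>, and the compressor inequality
  applies.\<close>

lemma compressor_conditional_bound:
  fixes Q :: "'s \<Rightarrow> real^'d \<Rightarrow> real^'d" and \<xi> :: "'n::finite \<times> nat \<Rightarrow> 'w \<Rightarrow> 's"
  assumes M: "prob_space M" and fresh: "fresh_seeds M D \<xi>" and Q: "globally_bounded_compressor D Q r \<delta> C"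
    and z: "known_before M D \<xi> k z"
  shows "(\<integral>\<^sup>+w. ennreal ((norm (Q (\<xi> (i, k) w) (z w) /\<^sub>R r - z w))\<^sup>2) \<partial>M)
    \<le> (\<integral>\<^sup>+w. ennreal ((1 - \<delta>) * (norm (z w))\<^sup>2 + C) \<partial>M)"
proof -
  interpret prob_space M by (rule M)
  let ?S = "PiM {(i, k)} (\<lambda>_. D)" and ?T = "PiM (UNIV \<times> {..<k}) (\<lambda>_. D)"
  let ?X = "\<lambda>w. \<lambda>c\<in>{(i, k)}. \<xi> c w" and ?Y = "\<lambda>w. \<lambda>c\<in>UNIV \<times> {..<k}. \<xi> c w"
  obtain H where H[measurable]: "H \<in> borel_measurable ?T" and z: "\<And>w. w \<in> space M \<Longrightarrow> z w = H (?Y w)"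
    using z by (auto simp: known_before_def)
  have \<xi>[measurable]: "\<xi> c \<in> measurable M D" and law: "distr M D (\<xi> c) = D" for c
    using fresh unfolding fresh_seeds_def by blast+
  have Qm[measurable]: "case_prod Q \<in> borel_measurable (D \<Otimes>\<^sub>M borel)"
    using Q by (simp add: globally_bounded_compressor_def)
  have X: "?X \<in> measurable M ?S" and Y: "?Y \<in> measurable M ?T"
    by (auto intro!: measurable_restrict)
  have "indep_var ?S ?X ?T ?Y"
    using fresh by (simp add: fresh_seeds_def)
  then have joint: "distr M ?S ?X \<Otimes>\<^sub>M distr M ?T ?Y = distr M (?S \<Otimes>\<^sub>M ?T) (\<lambda>w. (?X w, ?Y w))"
    by (simp add: indep_var_distribution_eq)
  interpret X: prob_space "distr M ?S ?X"
    by (rule prob_space_distr[OF X])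
  interpret Y: prob_space "distr M ?T ?Y"
    by (rule prob_space_distr[OF Y])
  interpret XY: pair_prob_space "distr M ?S ?X" "distr M ?T ?Y" ..
  define err where "err \<sigma> u = ennreal ((norm (Q \<sigma> u /\<^sub>R r - u))\<^sup>2)" for \<sigma> u
  have err[measurable]: "(\<lambda>p. err (fst p) (snd p)) \<in> borel_measurable (D \<Otimes>\<^sub>M borel)"
  proof -
    have "(\<lambda>p. Q (fst p) (snd p)) \<in> borel_measurable (D \<Otimes>\<^sub>M borel)"
      using Qm by (simp add: case_prod_beta')
    then show ?thesis
      unfolding err_def by measurable
  qed
  have \<phi>: "(\<lambda>p. err (fst p (i, k)) (H (snd p))) \<in> borel_measurable (?S \<Otimes>\<^sub>M ?T)"
  proof -
    have pair: "(\<lambda>p. (fst p (i, k), H (snd p))) \<in> measurable (?S \<Otimes>\<^sub>M ?T) (D \<Otimes>\<^sub>M borel)"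
      by measurable
    then show ?thesis
      using measurable_compose[OF pair err] by simp
  qed
  have inner: "(\<integral>\<^sup>+a. err (a (i, k)) (H b) \<partial>distr M ?S ?X) \<le> ennreal ((1 - \<delta>) * (norm (H b))\<^sup>2 + C)" for b
  proof -
    have e: "(\<lambda>\<sigma>. err \<sigma> (H b)) \<in> borel_measurable D"
      using measurable_compose[OF measurable_Pair2' err, of "H b"] by simp
    have coord: "(\<lambda>a. a (i, k)) \<in> measurable ?S D"
      by (rule measurable_component_singleton) simp
    have "(\<integral>\<^sup>+a. err (a (i, k)) (H b) \<partial>distr M ?S ?X) = (\<integral>\<^sup>+w. err (\<xi> (i, k) w) (H b) \<partial>M)"
      using measurable_compose[OF coord e] X by (subst nn_integral_distr) auto
    also have "\<dots> = (\<integral>\<^sup>+\<sigma>. err \<sigma> (H b) \<partial>distr M D (\<xi> (i, k)))"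
      using e by (subst nn_integral_distr) auto
    also have "\<dots> = ennreal (LINT \<sigma>|D. (norm (Q \<sigma> (H b) /\<^sub>R r - H b))\<^sup>2)"
      unfolding err_def law using Q
      by (intro nn_integral_eq_integral) (auto simp: globally_bounded_compressor_def)
    also have "\<dots> \<le> ennreal ((1 - \<delta>) * (norm (H b))\<^sup>2 + C)"
      using Q by (intro ennreal_leI) (auto simp: globally_bounded_compressor_def)
    finally show ?thesis .
  qed
  have "(\<integral>\<^sup>+w. err (\<xi> (i, k) w) (z w) \<partial>M) = (\<integral>\<^sup>+w. err (fst (?X w, ?Y w) (i, k)) (H (snd (?X w, ?Y w))) \<partial>M)"
    by (intro nn_integral_cong) (simp add: z)
  also have "\<dots> = (\<integral>\<^sup>+p. err (fst p (i, k)) (H (snd p)) \<partial>distr M (?S \<Otimes>\<^sub>M ?T) (\<lambda>w. (?X w, ?Y w)))"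
    using \<phi> X Y by (subst nn_integral_distr) auto
  also have "\<dots> = (\<integral>\<^sup>+p. err (fst p (i, k)) (H (snd p)) \<partial>(distr M ?S ?X \<Otimes>\<^sub>M distr M ?T ?Y))"
    by (simp only: joint)
  also have "\<dots> = (\<integral>\<^sup>+b. \<integral>\<^sup>+a. err (a (i, k)) (H b) \<partial>distr M ?S ?X \<partial>distr M ?T ?Y)"
    using \<phi> by (subst XY.nn_integral_snd[symmetric]) (auto cong: measurable_cong_sets)
  also have "\<dots> \<le> (\<integral>\<^sup>+b. ennreal ((1 - \<delta>) * (norm (H b))\<^sup>2 + C) \<partial>distr M ?T ?Y)"
    by (intro nn_integral_mono inner)
  also have "\<dots> = (\<integral>\<^sup>+w. ennreal ((1 - \<delta>) * (norm (H (?Y w)))\<^sup>2 + C) \<partial>M)"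
    using Y by (subst nn_integral_distr) auto
  also have "\<dots> = (\<integral>\<^sup>+w. ennreal ((1 - \<delta>) * (norm (z w))\<^sup>2 + C) \<partial>M)"
    by (intro nn_integral_cong) (simp add: z)
  finally show ?thesis
    by (simp add: err_def)
qed

section \<open>Decay of the expected Lyapunov function\<close>

text \<open>\<open>z - t c\<close> is the convex combination of \<open>z\<close> and
  \<open>z - c\<close> with weights \<open>1 - t\<close> and \<open>t\<close>. It is used with
  \<open>t = \<omega> * r\<close>, which \<open>\<omega> \<le> 1 / r\<close> keeps at most 1, and
  with \<open>c\<close> the compressor output divided by \<open>r\<close>.\<close>

lemma shrink_step_norm_square:
  fixes z c :: "'a::real_inner"
  assumes "0 \<le> t" "t \<le> 1"
  shows "(norm (z - t *\<^sub>R c))\<^sup>2 \<le> (1 - t) * (norm z)\<^sup>2 + t * (norm (c - z))\<^sup>2"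
proof -
  have "(norm (z - t *\<^sub>R c))\<^sup>2 = (1 - t) * (norm z)\<^sup>2 + t * (norm (c - z))\<^sup>2 - t * (1 - t) * (norm c)\<^sup>2"
    unfolding power2_norm_eq_inner
    by (simp add: inner_diff_left inner_diff_right inner_commute algebra_simps power2_eq_square)
  then show ?thesis
    using assms by simp
qed

lemma norm_vec_square: "(norm x)\<^sup>2 = (\<Sum>i\<in>UNIV. (norm (x $ i))\<^sup>2)"
  by (simp add: norm_vec_def L2_set_def sum_nonneg)

locale random_network = compressed_network where f = f and g = "\<lambda>i. gradient (f i)"
  for f :: "'n::finite \<Rightarrow> real^'d \<Rightarrow> real" +
  fixes M :: "'w measure" and D :: "'s measure" and Q :: "'s \<Rightarrow> real^'d \<Rightarrow> real^'d"
    and \<xi> :: "'n \<times> nat \<Rightarrow> 'w \<Rightarrow> 's" and r \<delta> C \<omega> :: real and s :: "nat \<Rightarrow> real"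
    and x0 :: "'n \<Rightarrow> real^'d" and x v q xhat y :: "'n \<Rightarrow> nat \<Rightarrow> 'w \<Rightarrow> real^'d"
  assumes M: "prob_space M" and fresh: "fresh_seeds M D \<xi>" and Q: "globally_bounded_compressor D Q r \<delta> C"
    and r: "0 < r" and C: "0 < C" and \<delta>: "0 < \<delta>" "\<delta> \<le> 1" and \<omega>: "0 < \<omega>" "\<omega> \<le> 1 / r"
    and e9_eq: "e9 = eps9 \<omega> r \<delta>" and s: "\<And>k. 0 < s k"
    and algorithm: "\<And>w. w \<in> space M \<Longrightarrow>
      unified_compression_algorithm (laplacian A) (\<lambda>i. gradient (f i)) (\<lambda>i k. Q (\<xi> (i, k) w))
        \<alpha> \<beta> \<gamma> \<omega> s x0
        (\<lambda>i k. x i k w) (\<lambda>i k. v i k w) (\<lambda>i k. q i k w) (\<lambda>i k. xhat i k w) (\<lambda>i k. y i k w)"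
begin

section \<open>The stacked iterates as functions of the past seeds\<close>

definition xs :: "nat \<Rightarrow> 'w \<Rightarrow> (real^'d)^'n" where "xs k w = (\<chi> i. x i k w)"
definition vs :: "nat \<Rightarrow> 'w \<Rightarrow> (real^'d)^'n" where "vs k w = (\<chi> i. v i k w)"
definition hs :: "nat \<Rightarrow> 'w \<Rightarrow> (real^'d)^'n" where "hs k w = (\<chi> i. xhat i k w)"
definition hs_prev :: "nat \<Rightarrow> 'w \<Rightarrow> (real^'d)^'n" where
  "hs_prev k w = (\<chi> i. prev (\<lambda>k. xhat i k w) k)"
definition zs :: "nat \<Rightarrow> 'w \<Rightarrow> (real^'d)^'n" where
  "zs k w = (1 / s k) *\<^sub>R (xs k w - hs_prev k w)"

lemma hs_prev_0: "hs_prev 0 w = 0" and hs_prev_Suc: "hs_prev (Suc k) w = hs k w"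
  by (simp_all add: hs_prev_def hs_def prev_def vec_eq_iff)

lemma algorithm_steps:
  assumes "w \<in> space M"
  shows "x i 0 w = x0 i" "v i 0 w = 0"
    and "q i k w = Q (\<xi> (i, k) w) ((x i k w - prev (\<lambda>k. xhat i k w) k) /\<^sub>R s k)"
    and "xhat i k w = prev (\<lambda>k. xhat i k w) k + (\<omega> * s k) *\<^sub>R q i k w"
    and "y i k w = prev (\<lambda>k. y i k w) k + (\<omega> * s k) *\<^sub>R (\<Sum>j\<in>UNIV. laplacian A $ i $ j *\<^sub>R q j k w)"
    and "x i (Suc k) w = x i k w - \<alpha> *\<^sub>R (\<beta> *\<^sub>R y i k w + \<gamma> *\<^sub>R v i k w + gradient (f i) (x i k w))"
    and "v i (Suc k) w = v i k w + (\<alpha> * \<gamma>) *\<^sub>R y i k w"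
  using algorithm[OF assms] unfolding unified_compression_algorithm_def by blast+

lemma init:
  assumes "w \<in> space M"
  shows "xs 0 w = (\<chi> i. x0 i)" "vs 0 w = 0"
  by (simp_all add: algorithm_steps(1,2)[OF assms] xs_def vs_def vec_eq_iff)

lemma q_eq:
  assumes "w \<in> space M"
  shows "q i k w = Q (\<xi> (i, k) w) (zs k w $ i)"
  by (simp add: algorithm_steps(3)[OF assms] zs_def xs_def hs_prev_def inverse_eq_divide)

lemma hs_eq:
  assumes "w \<in> space M"
  shows "hs k w = hs_prev k w + (\<omega> * s k) *\<^sub>R (\<chi> i. Q (\<xi> (i, k) w) (zs k w $ i))"
  unfolding hs_def hs_prev_def
  by (subst algorithm_steps(4)[OF assms]) (simp add: vec_eq_iff q_eq[OF assms] hs_prev_def)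

text \<open>Both sides start from zero and receive the same increments; this eliminates
  \<open>y\<close> from the dynamics.\<close>

lemma y_eq:
  assumes "w \<in> space M"
  shows "y i k w = Lap (hs k w) $ i"
proof -
  note y = algorithm_steps(5)[OF assms]
  have hs: "Lap (hs k w) = Lap (hs_prev k w) + (\<omega> * s k) *\<^sub>R Lap (\<chi> i. q i k w)" for k
    by (simp only: hs_eq[OF assms] add scaleR q_eq[OF assms])
  have q: "(\<Sum>j\<in>UNIV. laplacian A $ i $ j *\<^sub>R q j k w) = Lap (\<chi> i. q i k w) $ i" for i k
    by (simp add: mat_act_def)
  show ?thesis
  proof (induction k arbitrary: i)
    case 0
    then show ?case
      by (simp add: y[of _ 0] hs[of 0] q hs_prev_0 zero prev_def)
  next
    case (Suc k)
    then show ?case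
      by (simp add: y[of _ "Suc k"] hs[of "Suc k"] q hs_prev_Suc prev_def)
  qed
qed

lemma xs_Suc:
  assumes "w \<in> space M"
  shows "xs (Suc k) w = xs k w - \<alpha> *\<^sub>R (\<beta> *\<^sub>R Lap (hs k w) + \<gamma> *\<^sub>R vs k w + grads (xs k w))"
  by (simp add: algorithm_steps(6)[OF assms] vec_eq_iff xs_def vs_def grads_def y_eq[OF assms])

lemma vs_Suc:
  assumes "w \<in> space M"
  shows "vs (Suc k) w = vs k w + (\<alpha> * \<gamma>) *\<^sub>R Lap (hs k w)"
  by (simp add: algorithm_steps(7)[OF assms] vec_eq_iff vs_def y_eq[OF assms])

lemma sum_vs:
  assumes "w \<in> space M"
  shows "(\<Sum>i\<in>UNIV. vs k w $ i) = 0"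
  by (induction k) (simp_all add: init[OF assms] vs_Suc[OF assms] sum.distrib adj flip: scaleR_sum_right)

lemma continuous_grad: "continuous_on UNIV (gradient (f i))"
proof -
  have "l-lipschitz_on UNIV (gradient (f i))"
    using lipschitz l by (auto simp: lipschitz_on_def dist_norm)
  then show ?thesis
    by (rule lipschitz_on_continuous_on)
qed

lemma continuous_grads: "continuous_on UNIV grads"
  unfolding grads_def[abs_def]
  by (intro continuous_on_vec_lambda continuous_on_compose2[OF continuous_grad] continuous_intros) auto

text \<open>The state at time \<open>k\<close> is paired with the estimate of time
  \<open>k - 1\<close>, which is zero for \<open>k = 0\<close>: the estimate of time
  \<open>k\<close> already involves the seeds of time \<open>k\<close>.\<close>

lemma known_xs_vs_hs: "known_before M D \<xi> k (xs k) \<and> known_before M D \<xi> k (vs k) \<and> known_before M D \<xi> k (hs_prev k)"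
proof (induction k)
  case 0
  have "known_before M D \<xi> 0 (xs 0)" "known_before M D \<xi> 0 (vs 0)"
    by (rule known_before_cong[OF known_before_const], rule init, simp)+
  moreover have "known_before M D \<xi> 0 (hs_prev 0)"
    by (rule known_before_cong[OF known_before_const], rule hs_prev_0)
  ultimately show ?case
    by blast
next
  case (Suc k)
  then have x: "known_before M D \<xi> k (xs k)" and v: "known_before M D \<xi> k (vs k)"
    and h: "known_before M D \<xi> k (hs_prev k)"
    by auto
  have "known_before M D \<xi> k (zs k)"
    unfolding zs_def[abs_def] by (intro known_before_scaleR known_before_diff x h)
  then have "known_before M D \<xi> (Suc k) (\<lambda>w. \<chi> i. Q (\<xi> (i, k) w) (zs k w $ i))"
    using Q by (intro known_before_compressed) (auto simp: globally_bounded_compressor_def)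
  then have "known_before M D \<xi> (Suc k) (\<lambda>w. hs_prev k w + (\<omega> * s k) *\<^sub>R (\<chi> i. Q (\<xi> (i, k) w) (zs k w $ i)))"
    by (intro known_before_add known_before_scaleR known_before_Suc[OF h])
  then have hs: "known_before M D \<xi> (Suc k) (hs k)"
    by (rule known_before_cong) (rule hs_eq)
  have "Lap \<in> borel_measurable borel"
    by (intro borel_measurable_continuous_onI linear_continuous_on linear_conv_bounded_linear[THEN iffD1] linear)
  then have Lh: "known_before M D \<xi> (Suc k) (\<lambda>w. Lap (hs k w))"
    using hs by (intro known_before_compose[where F = Lap])
  have "grads \<in> borel_measurable borel"
    by (intro borel_measurable_continuous_onI continuous_grads)
  then have gr: "known_before M D \<xi> (Suc k) (\<lambda>w. grads (xs k w))"
    using known_before_Suc[OF x] by (intro known_before_compose[where F = grads])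
  have "known_before M D \<xi> (Suc k) (xs (Suc k))"
    by (rule known_before_cong[OF _ xs_Suc])
      (intro known_before_diff known_before_scaleR known_before_add known_before_Suc[OF x]
        known_before_Suc[OF v] Lh gr)
  moreover have "known_before M D \<xi> (Suc k) (vs (Suc k))"
    by (rule known_before_cong[OF _ vs_Suc])
      (intro known_before_scaleR known_before_add known_before_Suc[OF v] Lh)
  moreover have "hs_prev (Suc k) = hs k"
    by (simp add: fun_eq_iff hs_prev_Suc)
  ultimately show ?case
    using hs by simp
qed

lemma seeds_measurable: "\<xi> c \<in> measurable M D"
  using fresh unfolding fresh_seeds_def by blast

lemma measurable_states [measurable]:
  "xs k \<in> borel_measurable M" "vs k \<in> borel_measurable M" "hs_prev k \<in> borel_measurable M"
  "hs k \<in> borel_measurable M"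
proof -
  show "xs k \<in> borel_measurable M" "vs k \<in> borel_measurable M" "hs_prev k \<in> borel_measurable M"
    using known_xs_vs_hs[of k] by (auto intro: known_before_measurable seeds_measurable)
  have "hs_prev (Suc k) \<in> borel_measurable M"
    using known_xs_vs_hs[of "Suc k"] by (auto intro: known_before_measurable seeds_measurable)
  then show "hs k \<in> borel_measurable M"
    by (simp add: hs_prev_Suc[abs_def])
qed

lemma measurable_zs [measurable]: "zs k \<in> borel_measurable M"
  unfolding zs_def[abs_def] by measurable

lemma continuous_favg: "continuous_on UNIV favg"
  using gavg_gderiv by (auto simp: continuous_on_eq_continuous_at gderiv_def dest: has_derivative_continuous)

lemma continuous_mean: "continuous_on UNIV mean"
  by (intro linear_continuous_on linear_conv_bounded_linear[THEN iffD1] mean_linear)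

lemma continuous_center: "continuous_on UNIV (center :: (real^'d)^'n \<Rightarrow> _)"
  by (intro linear_continuous_on linear_conv_bounded_linear[THEN iffD1] linear_center)

lemma measurable_energy [measurable]: "(\<lambda>w. energy (xs k w) (vs k w)) \<in> borel_measurable M"
proof -
  have "continuous_on UNIV mean_grads"
    unfolding mean_grads_def[abs_def]
    by (intro continuous_on_vec_lambda continuous_on_compose2[OF continuous_grad] continuous_mean) auto
  then have mg: "(\<lambda>w. mean_grads (xs k w)) \<in> borel_measurable M"
    by (rule borel_measurable_continuous_on) measurable
  have "continuous_on UNIV pinv"
    by (intro linear_continuous_on linear_conv_bounded_linear[THEN iffD1] linear_pinv)
  then have u[measurable]: "(\<lambda>w. dual (xs k w) (vs k w)) \<in> borel_measurable M"
    unfolding dual_def by (rule borel_measurable_continuous_on) (use mg in measurable)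
  have "continuous_on UNIV Lap"
    by (intro linear_continuous_on linear_conv_bounded_linear[THEN iffD1] linear)
  then have [measurable]: "(\<lambda>w. Lap (dual (xs k w) (vs k w))) \<in> borel_measurable M"
    by (rule borel_measurable_continuous_on) (rule u)
  have [measurable]: "(\<lambda>w. center (xs k w)) \<in> borel_measurable M"
    by (rule borel_measurable_continuous_on[OF continuous_center]) measurable
  have m: "(\<lambda>w. mean (xs k w)) \<in> borel_measurable M"
    by (rule borel_measurable_continuous_on[OF continuous_mean]) measurable
  have [measurable]: "(\<lambda>w. favg (mean (xs k w))) \<in> borel_measurable M"
    by (rule borel_measurable_continuous_on[OF continuous_favg m])
  show ?thesis
    unfolding energy_def disagreement_def by measurable
qed

lemma \<omega>r: "0 < \<omega> * r" "\<omega> * r \<le> 1"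
  using \<omega> r by (simp_all add: pos_le_divide_eq)

lemma two_e9: "2 * e9 = \<omega> * r * \<delta>"
  by (simp add: e9_eq eps9_def)

text \<open>The expected compression error is propagated with \<open>nn_integral\<close>, so that integrability of the
  iterates comes out of the final bound instead of being required beforehand.\<close>

lemma compression_error:
  "(\<integral>\<^sup>+w. ennreal ((norm (xs k w - hs k w))\<^sup>2) \<partial>M)
    \<le> (\<integral>\<^sup>+w. ennreal ((1 - 2 * e9) * (norm (xs k w - hs_prev k w))\<^sup>2) \<partial>M)
      + ennreal (real CARD('n) * (\<omega> * r * C) * (s k)\<^sup>2)"
proof -
  interpret prob_space M by (rule M)
  define err where "err i w = (norm (Q (\<xi> (i, k) w) (zs k w $ i) /\<^sub>R r - zs k w $ i))\<^sup>2" for i w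
  have [simp]: "0 \<le> err i w" for i w
    by (simp add: err_def)
  have Qm: "(\<lambda>p. Q (fst p) (snd p)) \<in> borel_measurable (D \<Otimes>\<^sub>M borel)"
    using Q by (simp add: globally_bounded_compressor_def case_prod_beta')
  have z[measurable]: "(\<lambda>w. zs k w $ i) \<in> borel_measurable M" for i
    by (rule borel_measurable_continuous_on[OF continuous_on_component[OF continuous_on_id]]) measurable
  have "(\<lambda>w. Q (\<xi> (i, k) w) (zs k w $ i)) \<in> borel_measurable M" for i
    using measurable_compose[OF measurable_Pair[OF seeds_measurable z] Qm] by simp
  then have [measurable]: "err i \<in> borel_measurable M" for i
    unfolding err_def[abs_def] by measurable
  have kz: "known_before M D \<xi> k (\<lambda>w. zs k w $ i)" for i
  proof (rule known_before_compose[where F = "\<lambda>z. z $ i"])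
    show "known_before M D \<xi> k (zs k)"
      unfolding zs_def[abs_def] using known_xs_vs_hs[of k]
      by (intro known_before_scaleR known_before_diff) auto
  qed (intro borel_measurable_continuous_onI continuous_on_component continuous_on_id)
  have \<omega>': "0 \<le> (s k)\<^sup>2 * (1 - \<omega> * r)" "0 \<le> (s k)\<^sup>2 * (\<omega> * r)"
    using \<omega>r by auto
  have \<delta>C: "0 \<le> (1 - \<delta>) * (norm u)\<^sup>2 + C" for u :: "real^'d"
    using \<delta> C by (intro add_nonneg_nonneg mult_nonneg_nonneg) auto
  \<comment> \<open>Per agent the factor is
    \<open>(1 - \<omega> r) + \<omega> r (1 - \<delta>) = 1 - 2 e9\<close>; the constant
    \<open>C\<close> picks up the square of \<open>s k\<close> because the compressed vector was
    scaled by \<open>1 / s k\<close>.\<close>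
  have one: "(\<integral>\<^sup>+w. ennreal ((s k)\<^sup>2 * (1 - \<omega> * r) * (norm (zs k w $ i))\<^sup>2 + (s k)\<^sup>2 * (\<omega> * r) * err i w) \<partial>M)
      \<le> (\<integral>\<^sup>+w. ennreal ((s k)\<^sup>2 * ((1 - 2 * e9) * (norm (zs k w $ i))\<^sup>2) + \<omega> * r * C * (s k)\<^sup>2) \<partial>M)" for i
  proof -
    have "(\<integral>\<^sup>+w. ennreal ((s k)\<^sup>2 * (1 - \<omega> * r) * (norm (zs k w $ i))\<^sup>2 + (s k)\<^sup>2 * (\<omega> * r) * err i w) \<partial>M)
        = (\<integral>\<^sup>+w. ennreal ((s k)\<^sup>2 * (1 - \<omega> * r) * (norm (zs k w $ i))\<^sup>2) \<partial>M)
          + ennreal ((s k)\<^sup>2 * (\<omega> * r)) * (\<integral>\<^sup>+w. ennreal (err i w) \<partial>M)"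
      using \<omega>' by (simp add: nn_integral_add nn_integral_cmult ennreal_mult)
    also have "\<dots> \<le> (\<integral>\<^sup>+w. ennreal ((s k)\<^sup>2 * (1 - \<omega> * r) * (norm (zs k w $ i))\<^sup>2) \<partial>M)
          + ennreal ((s k)\<^sup>2 * (\<omega> * r)) * (\<integral>\<^sup>+w. ennreal ((1 - \<delta>) * (norm (zs k w $ i))\<^sup>2 + C) \<partial>M)"
      using compressor_conditional_bound[OF M fresh Q kz[of i], of i] unfolding err_def
      by (intro add_mono mult_left_mono) auto
    also have "\<dots> = (\<integral>\<^sup>+w. ennreal ((s k)\<^sup>2 * (1 - \<omega> * r) * (norm (zs k w $ i))\<^sup>2
        + (s k)\<^sup>2 * (\<omega> * r) * ((1 - \<delta>) * (norm (zs k w $ i))\<^sup>2 + C)) \<partial>M)"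
      using \<omega>' \<delta>C by (simp add: nn_integral_add nn_integral_cmult[symmetric] ennreal_plus ennreal_mult)
    also have "\<dots> = (\<integral>\<^sup>+w. ennreal ((s k)\<^sup>2 * ((1 - 2 * e9) * (norm (zs k w $ i))\<^sup>2) + \<omega> * r * C * (s k)\<^sup>2) \<partial>M)"
      unfolding two_e9 by (intro nn_integral_cong arg_cong[where f = ennreal]) (simp add: algebra_simps)
    finally show ?thesis .
  qed
  have sz: "s k *\<^sub>R zs k w = xs k w - hs_prev k w" for w
    using s[of k] by (simp add: zs_def)
  have pointwise: "(norm (xs k w - hs k w))\<^sup>2
      \<le> (\<Sum>i\<in>UNIV. (s k)\<^sup>2 * (1 - \<omega> * r) * (norm (zs k w $ i))\<^sup>2 + (s k)\<^sup>2 * (\<omega> * r) * err i w)"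
    if w: "w \<in> space M" for w
  proof -
    have "xs k w - hs k w = s k *\<^sub>R (\<chi> i. zs k w $ i - (\<omega> * r) *\<^sub>R (Q (\<xi> (i, k) w) (zs k w $ i) /\<^sub>R r))"
      using r sz[of w] by (simp add: hs_eq[OF w] vec_eq_iff scaleR_diff_right algebra_simps)
    then have "(norm (xs k w - hs k w))\<^sup>2
        = (\<Sum>i\<in>UNIV. (s k)\<^sup>2 * (norm (zs k w $ i - (\<omega> * r) *\<^sub>R (Q (\<xi> (i, k) w) (zs k w $ i) /\<^sub>R r)))\<^sup>2)"
      by (simp add: norm_vec_square power_mult_distrib sum_distrib_left)
    also have "\<dots> \<le> (\<Sum>i\<in>UNIV. (s k)\<^sup>2 * ((1 - \<omega> * r) * (norm (zs k w $ i))\<^sup>2 + \<omega> * r * err i w))"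
      unfolding err_def using \<omega>r by (intro sum_mono mult_left_mono shrink_step_norm_square) auto
    finally show ?thesis
      by (simp add: distrib_left mult.assoc)
  qed
  have nn: "0 \<le> (s k)\<^sup>2 * (1 - \<omega> * r) * (norm (zs k w $ i))\<^sup>2 + (s k)\<^sup>2 * (\<omega> * r) * err i w" for i w
    using \<omega>' by (intro add_nonneg_nonneg[OF mult_nonneg_nonneg mult_nonneg_nonneg]) auto
  have e9': "0 \<le> 1 - 2 * e9"
    using e9 by simp
  have nn': "0 \<le> (s k)\<^sup>2 * ((1 - 2 * e9) * (norm (zs k w $ i))\<^sup>2) + \<omega> * r * C * (s k)\<^sup>2" for i w
    using e9' \<omega>(1) r C by (intro add_nonneg_nonneg mult_nonneg_nonneg) auto
  have "(\<integral>\<^sup>+w. ennreal ((norm (xs k w - hs k w))\<^sup>2) \<partial>M)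
      \<le> (\<integral>\<^sup>+w. (\<Sum>i\<in>UNIV. ennreal ((s k)\<^sup>2 * (1 - \<omega> * r) * (norm (zs k w $ i))\<^sup>2 + (s k)\<^sup>2 * (\<omega> * r) * err i w)) \<partial>M)"
    by (intro nn_integral_mono) (use pointwise nn in \<open>auto intro!: ennreal_leI simp: sum_ennreal\<close>)
  also have "\<dots> = (\<Sum>i\<in>UNIV. \<integral>\<^sup>+w. ennreal ((s k)\<^sup>2 * (1 - \<omega> * r) * (norm (zs k w $ i))\<^sup>2 + (s k)\<^sup>2 * (\<omega> * r) * err i w) \<partial>M)"
    by (rule nn_integral_sum) measurable
  also have "\<dots> \<le> (\<Sum>i\<in>UNIV. \<integral>\<^sup>+w. ennreal ((s k)\<^sup>2 * ((1 - 2 * e9) * (norm (zs k w $ i))\<^sup>2) + \<omega> * r * C * (s k)\<^sup>2) \<partial>M)"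
    by (intro sum_mono one)
  also have "\<dots> = (\<integral>\<^sup>+w. (\<Sum>i\<in>UNIV. ennreal ((s k)\<^sup>2 * ((1 - 2 * e9) * (norm (zs k w $ i))\<^sup>2) + \<omega> * r * C * (s k)\<^sup>2)) \<partial>M)"
    by (rule nn_integral_sum[symmetric]) measurable
  also have "\<dots> = (\<integral>\<^sup>+w. ennreal ((1 - 2 * e9) * (norm (xs k w - hs_prev k w))\<^sup>2)
      + ennreal (real CARD('n) * (\<omega> * r * C) * (s k)\<^sup>2) \<partial>M)"
  proof (rule nn_integral_cong)
    fix w
    have "(\<Sum>i\<in>UNIV. (s k)\<^sup>2 * ((1 - 2 * e9) * (norm (zs k w $ i))\<^sup>2) + \<omega> * r * C * (s k)\<^sup>2)
        = (1 - 2 * e9) * (norm (xs k w - hs_prev k w))\<^sup>2 + real CARD('n) * (\<omega> * r * C) * (s k)\<^sup>2"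
      unfolding sz[symmetric]
      by (simp add: norm_vec_square sum.distrib power_mult_distrib sum_distrib_left mult_ac)
    then show "(\<Sum>i\<in>UNIV. ennreal ((s k)\<^sup>2 * ((1 - 2 * e9) * (norm (zs k w $ i))\<^sup>2) + \<omega> * r * C * (s k)\<^sup>2))
        = ennreal ((1 - 2 * e9) * (norm (xs k w - hs_prev k w))\<^sup>2) + ennreal (real CARD('n) * (\<omega> * r * C) * (s k)\<^sup>2)"
      using nn' e9' \<omega>r C by (simp add: sum_ennreal flip: ennreal_plus)
  qed
  also have "\<dots> = (\<integral>\<^sup>+w. ennreal ((1 - 2 * e9) * (norm (xs k w - hs_prev k w))\<^sup>2) \<partial>M)
      + ennreal (real CARD('n) * (\<omega> * r * C) * (s k)\<^sup>2)"
    by (subst nn_integral_add) (auto simp: emeasure_space_1)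
  finally show ?thesis .
qed

section \<open>Recursion for the expected Lyapunov function\<close>

definition expected_lyapunov :: "nat \<Rightarrow> ennreal" where
  "expected_lyapunov k = (\<integral>\<^sup>+w. ennreal (energy (xs k w) (vs k w) + (norm (xs k w - hs k w))\<^sup>2) \<partial>M)"

lemma expected_lyapunov_le:
  "expected_lyapunov k
    \<le> (\<integral>\<^sup>+w. ennreal (energy (xs k w) (vs k w) + (1 - 2 * e9) * (norm (xs k w - hs_prev k w))\<^sup>2) \<partial>M)
      + ennreal (real CARD('n) * (\<omega> * r * C) * (s k)\<^sup>2)"
proof -
  have e9': "0 \<le> 1 - 2 * e9"
    using e9 by simp
  have "expected_lyapunov k = (\<integral>\<^sup>+w. ennreal (energy (xs k w) (vs k w)) \<partial>M) + (\<integral>\<^sup>+w. ennreal ((norm (xs k w - hs k w))\<^sup>2) \<partial>M)"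
    unfolding expected_lyapunov_def by (subst nn_integral_add[symmetric]) (auto simp: energy_nonneg)
  also have "\<dots> \<le> (\<integral>\<^sup>+w. ennreal (energy (xs k w) (vs k w)) \<partial>M)
      + ((\<integral>\<^sup>+w. ennreal ((1 - 2 * e9) * (norm (xs k w - hs_prev k w))\<^sup>2) \<partial>M)
      + ennreal (real CARD('n) * (\<omega> * r * C) * (s k)\<^sup>2))"
    by (intro add_left_mono compression_error)
  also have "\<dots> = (\<integral>\<^sup>+w. ennreal (energy (xs k w) (vs k w)) + ennreal ((1 - 2 * e9) * (norm (xs k w - hs_prev k w))\<^sup>2) \<partial>M)
      + ennreal (real CARD('n) * (\<omega> * r * C) * (s k)\<^sup>2)"
    by (subst nn_integral_add) (auto simp: add.assoc)
  finally show ?thesis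
    using e9' by (simp add: energy_nonneg)
qed

text \<open>A nonnegative upper bound \<open>m\<close> replaces the pathwise factor, whose sign is
  not controlled, so that it can be pulled out of an integral of extended nonnegative reals.\<close>

lemma expected_lyapunov_Suc:
  assumes m: "1 - \<alpha> * eps6' \<rho> \<rho>2 l \<nu> e10 e12 \<tau> \<alpha> \<beta> \<gamma> \<le> m" "0 \<le> m"
  shows "expected_lyapunov (Suc k)
    \<le> ennreal m * expected_lyapunov k + ennreal (real CARD('n) * (\<omega> * r * C) * (s (Suc k))\<^sup>2)"
proof -
  have "(\<integral>\<^sup>+w. ennreal (energy (xs (Suc k) w) (vs (Suc k) w) + (1 - 2 * e9) * (norm (xs (Suc k) w - hs_prev (Suc k) w))\<^sup>2) \<partial>M)
      \<le> (\<integral>\<^sup>+w. ennreal (m * (energy (xs k w) (vs k w) + (norm (xs k w - hs k w))\<^sup>2)) \<partial>M)"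
  proof (intro nn_integral_mono ennreal_leI)
    fix w
    assume w: "w \<in> space M"
    have "energy (xs (Suc k) w) (vs (Suc k) w) + (1 - 2 * e9) * (norm (xs (Suc k) w - hs k w))\<^sup>2
        \<le> (1 - \<alpha> * eps6' \<rho> \<rho>2 l \<nu> e10 e12 \<tau> \<alpha> \<beta> \<gamma>) * (energy (xs k w) (vs k w) + (norm (xs k w - hs k w))\<^sup>2)"
      by (rule energy_step[OF sum_vs[OF w] xs_Suc[OF w] vs_Suc[OF w]])
    also have "\<dots> \<le> m * (energy (xs k w) (vs k w) + (norm (xs k w - hs k w))\<^sup>2)"
      using m by (intro mult_right_mono add_nonneg_nonneg energy_nonneg) auto
    finally show "energy (xs (Suc k) w) (vs (Suc k) w) + (1 - 2 * e9) * (norm (xs (Suc k) w - hs_prev (Suc k) w))\<^sup>2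
        \<le> m * (energy (xs k w) (vs k w) + (norm (xs k w - hs k w))\<^sup>2)"
      by (simp add: hs_prev_Suc)
  qed
  also have "\<dots> = ennreal m * expected_lyapunov k"
    unfolding expected_lyapunov_def using m(2)
    by (subst nn_integral_cmult[symmetric]) (auto simp: ennreal_mult energy_nonneg)
  finally show ?thesis
    using expected_lyapunov_le[of "Suc k"] by (meson add_right_mono order_trans)
qed

text \<open>The initial state is deterministic and the estimate before the first call is zero, so
  only the compressor's additive error has to be integrated.\<close>

lemma expected_lyapunov_0: "\<exists>a\<ge>0. expected_lyapunov 0 \<le> ennreal a"
proof -
  interpret prob_space M by (rule M)
  let ?x = "\<chi> i. x0 i"
  let ?a = "energy ?x 0 + (1 - 2 * e9) * (norm ?x)\<^sup>2" and ?b = "real CARD('n) * (\<omega> * r * C) * (s 0)\<^sup>2"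
  have nn: "0 \<le> ?a" "0 \<le> ?b"
    using e9 \<omega>r C energy_nonneg by auto
  have "(\<integral>\<^sup>+w. ennreal (energy (xs 0 w) (vs 0 w) + (1 - 2 * e9) * (norm (xs 0 w - hs_prev 0 w))\<^sup>2) \<partial>M)
      = (\<integral>\<^sup>+w. ennreal ?a \<partial>M)"
    by (intro nn_integral_cong) (simp add: init hs_prev_0)
  also have "\<dots> = ennreal ?a"
    by (simp add: emeasure_space_1)
  finally have "expected_lyapunov 0 \<le> ennreal (?a + ?b)"
    using expected_lyapunov_le[of 0] nn by (simp add: ennreal_plus)
  then show ?thesis
    using nn by (intro exI[of _ "?a + ?b"]) auto
qed

lemma expected_lyapunov_decay:
  assumes m: "1 - \<alpha> * eps6' \<rho> \<rho>2 l \<nu> e10 e12 \<tau> \<alpha> \<beta> \<gamma> \<le> m" "\<epsilon>\<^sup>2 \<le> m"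
    and \<epsilon>: "m < \<epsilon>hat" "\<epsilon>hat < 1" and s_eq: "\<And>k. s k = s 0 * \<epsilon> ^ k"
  shows "\<exists>K\<ge>0. \<forall>k. expected_lyapunov k \<le> ennreal (K * \<epsilon>hat ^ k)"
proof -
  obtain a where a: "0 \<le> a" "expected_lyapunov 0 \<le> ennreal a"
    using expected_lyapunov_0 by blast
  define c where "c = real CARD('n) * (\<omega> * r * C) * (s 0)\<^sup>2"
  have c: "0 \<le> c"
    using \<omega>r C by (simp add: c_def)
  \<comment> \<open>The second summand makes \<open>m * K + c \<le> K * \<epsilon>hat\<close>; the
    strict inequality \<open>m < \<epsilon>hat\<close> is used here.\<close>
  define K where "K = a + c / (\<epsilon>hat - m)"
  have m0: "0 \<le> m"
    using m(2) by (meson order_trans zero_le_power2)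
  have \<epsilon>0: "0 \<le> \<epsilon>hat"
    using \<epsilon> m0 by simp
  have K: "0 \<le> K" "a \<le> K"
    using a c \<epsilon> by (auto simp: K_def)
  have "c = c / (\<epsilon>hat - m) * (\<epsilon>hat - m)"
    using \<epsilon> by simp
  also have "\<dots> \<le> K * (\<epsilon>hat - m)"
    using a \<epsilon> by (intro mult_right_mono) (auto simp: K_def)
  finally have Kc: "m * K + c \<le> K * \<epsilon>hat"
    by (simp add: algebra_simps)
  have "expected_lyapunov k \<le> ennreal (K * \<epsilon>hat ^ k)" for k
  proof (induction k)
    case 0
    then show ?case
      using a(2) K(2) by (simp add: order_trans[OF _ ennreal_leI])
  next
    case (Suc k)
    \<comment> \<open>As the square of \<epsilon> is at most \<open>m\<close>, hence below
      \<open>\<epsilon>hat\<close>, the forcing term fits under the same geometric envelope; one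
      factor \<open>\<epsilon>hat\<close> is given away.\<close>
    have "(\<epsilon>\<^sup>2) ^ Suc k \<le> \<epsilon>hat ^ Suc k"
      using m \<epsilon> by (intro power_mono) auto
    also have "\<dots> \<le> \<epsilon>hat ^ k"
      using \<epsilon> \<epsilon>0 by (intro power_decreasing) auto
    finally have "c * (\<epsilon>\<^sup>2) ^ Suc k \<le> c * \<epsilon>hat ^ k"
      using c by (intro mult_left_mono)
    moreover have "(s (Suc k))\<^sup>2 = (s 0)\<^sup>2 * (\<epsilon>\<^sup>2) ^ Suc k"
      unfolding s_eq[of "Suc k"] by (simp add: power_mult_distrib power2_eq_square)
    ultimately have s_le: "real CARD('n) * (\<omega> * r * C) * (s (Suc k))\<^sup>2 \<le> c * \<epsilon>hat ^ k"
      by (simp add: c_def mult_ac)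
    have "expected_lyapunov (Suc k)
        \<le> ennreal m * expected_lyapunov k + ennreal (real CARD('n) * (\<omega> * r * C) * (s (Suc k))\<^sup>2)"
      by (rule expected_lyapunov_Suc[OF m(1) m0])
    also have "\<dots> \<le> ennreal m * ennreal (K * \<epsilon>hat ^ k) + ennreal (c * \<epsilon>hat ^ k)"
      by (intro add_mono mult_left_mono Suc ennreal_leI s_le) auto
    also have "\<dots> = ennreal ((m * K + c) * \<epsilon>hat ^ k)"
      using m0 K c \<epsilon>0 by (simp add: distrib_right mult.assoc flip: ennreal_mult ennreal_plus)
    also have "\<dots> \<le> ennreal (K * \<epsilon>hat ^ Suc k)"
      using mult_right_mono[OF Kc, of "\<epsilon>hat ^ k"] \<epsilon>0 by (intro ennreal_leI) (simp add: mult_ac)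
    finally show ?case .
  qed
  with K show ?thesis
    by blast
qed

section \<open>From the Lyapunov function to the optimality gap\<close>

definition optimality_gap :: "nat \<Rightarrow> 'w \<Rightarrow> real" where
  "optimality_gap k w = favg (agent_avg (\<lambda>i. x i k w)) - fstar
    + agent_avg (\<lambda>i. (norm (x i k w - agent_avg (\<lambda>j. x j k w)))\<^sup>2)"

lemma optimality_gap_eq:
  "optimality_gap k w = favg (mean (xs k w)) - fstar + (norm (center (xs k w)))\<^sup>2 / real CARD('n)"
proof -
  have "($) (xs k w) = (\<lambda>i. x i k w)"
    by (auto simp: xs_def)
  then show ?thesis
    by (simp add: optimality_gap_def mean_def center_def xs_def
        norm_vec_square[of "\<chi> i. x i k w - agent_avg (\<lambda>j. x j k w)"]
        agent_avg_def[of "\<lambda>i. (norm (x i k w - agent_avg (\<lambda>j. x j k w)))\<^sup>2"])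
qed

lemma optimality_gap_nonneg: "0 \<le> optimality_gap k w"
  using fstar_le[of "mean (xs k w)"] by (simp add: optimality_gap_eq favg_def)

text \<open>The factor 4 undoes the quarter of \<open>|X|^2\<close> in \<open>energy_lower\<close>;
  the weights \<open>n\<close> on the cost and \<open>1 / n\<close> on the disagreement go in the
  right direction.\<close>

lemma optimality_gap_le:
  "optimality_gap k w \<le> 4 * (energy (xs k w) (vs k w) + (norm (xs k w - hs k w))\<^sup>2)"
proof -
  have n: "1 \<le> real CARD('n)"
    using card by simp
  have F: "0 \<le> favg (mean (xs k w)) - fstar"
    using fstar_le[of "mean (xs k w)"] by (simp add: favg_def)
  have "favg (mean (xs k w)) - fstar \<le> real CARD('n) * (favg (mean (xs k w)) - fstar)"
    using mult_right_mono[OF n F] by simp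
  moreover have "(norm (center (xs k w)))\<^sup>2 / real CARD('n) \<le> (norm (center (xs k w)))\<^sup>2 / 1"
    using n by (intro divide_left_mono) auto
  moreover have "0 \<le> (norm (xs k w - hs k w))\<^sup>2"
    by simp
  ultimately show ?thesis
    using energy_lower[of "xs k w" "vs k w"] F unfolding optimality_gap_eq by argo
qed

lemma measurable_optimality_gap [measurable]: "optimality_gap k \<in> borel_measurable M"
proof -
  have [measurable]: "(\<lambda>w. center (xs k w)) \<in> borel_measurable M"
    by (rule borel_measurable_continuous_on[OF continuous_center]) measurable
  have "(\<lambda>w. mean (xs k w)) \<in> borel_measurable M"
    by (rule borel_measurable_continuous_on[OF continuous_mean]) measurable
  then have [measurable]: "(\<lambda>w. favg (mean (xs k w))) \<in> borel_measurable M"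
    by (rule borel_measurable_continuous_on[OF continuous_favg])
  show ?thesis
    unfolding optimality_gap_eq[abs_def] by measurable
qed

text \<open>The gap is nonnegative, so the finite bound on its \<open>nn_integral\<close> yields
  both integrability and the bound on its expectation.\<close>

lemma optimality_gap_decay:
  assumes "1 - \<alpha> * eps6' \<rho> \<rho>2 l \<nu> e10 e12 \<tau> \<alpha> \<beta> \<gamma> \<le> m" "\<epsilon>\<^sup>2 \<le> m"
    and "m < \<epsilon>hat" "\<epsilon>hat < 1" and "\<And>k. s k = s 0 * \<epsilon> ^ k"
  shows "\<exists>c. \<forall>k. integrable M (optimality_gap k) \<and> (LINT w|M. optimality_gap k w) \<le> c * \<epsilon>hat ^ k"
proof -
  obtain K where K: "0 \<le> K" "\<And>k. expected_lyapunov k \<le> ennreal (K * \<epsilon>hat ^ k)"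
    using expected_lyapunov_decay[OF assms] by blast
  have \<epsilon>0: "0 \<le> \<epsilon>hat"
    using assms(2,3) by (meson order_trans less_imp_le zero_le_power2)
  have le: "(\<integral>\<^sup>+w. ennreal (optimality_gap k w) \<partial>M) \<le> ennreal (4 * K * \<epsilon>hat ^ k)" for k
  proof -
    have "(\<integral>\<^sup>+w. ennreal (optimality_gap k w) \<partial>M)
        \<le> (\<integral>\<^sup>+w. ennreal 4 * ennreal (energy (xs k w) (vs k w) + (norm (xs k w - hs k w))\<^sup>2) \<partial>M)"
    proof (rule nn_integral_mono)
      fix w
      have "ennreal (optimality_gap k w) \<le> ennreal (4 * (energy (xs k w) (vs k w) + (norm (xs k w - hs k w))\<^sup>2))"
        by (intro ennreal_leI optimality_gap_le)
      also have "\<dots> = ennreal 4 * ennreal (energy (xs k w) (vs k w) + (norm (xs k w - hs k w))\<^sup>2)"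
        by (rule ennreal_mult) (auto simp: energy_nonneg)
      finally show "ennreal (optimality_gap k w)
          \<le> ennreal 4 * ennreal (energy (xs k w) (vs k w) + (norm (xs k w - hs k w))\<^sup>2)" .
    qed
    also have "\<dots> = ennreal 4 * expected_lyapunov k"
      unfolding expected_lyapunov_def by (rule nn_integral_cmult) measurable
    also have "\<dots> \<le> ennreal 4 * ennreal (K * \<epsilon>hat ^ k)"
      by (intro mult_left_mono K) auto
    also have "\<dots> = ennreal (4 * K * \<epsilon>hat ^ k)"
      using K(1) \<epsilon>0 by (simp add: ennreal_mult[symmetric] mult.assoc del: ennreal_numeral)
    finally show ?thesis .
  qed
  have int: "integrable M (optimality_gap k)" for k
    using le[of k] by (intro integrableI_nonneg) (auto simp: optimality_gap_nonneg intro: le_less_trans)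
  have "(LINT w|M. optimality_gap k w) \<le> 4 * K * \<epsilon>hat ^ k" for k
    using le[of k] K(1) \<epsilon>0 by (simp add: nn_integral_eq_integral[OF int] optimality_gap_nonneg)
  with int show ?thesis
    by blast
qed

end

theorem theorem5:
  fixes A L :: "real^'n^'n"
    and f :: "'n \<Rightarrow> real^'d \<Rightarrow> real" and favg :: "real^'d \<Rightarrow> real" and fstar :: real
    and M :: "'w measure" and D :: "'s measure"
    and Q :: "'s \<Rightarrow> real^'d \<Rightarrow> real^'d" and \<xi> :: "'n \<times> nat \<Rightarrow> 'w \<Rightarrow> 's"
    and x0 :: "'n \<Rightarrow> real^'d"
    and x v q xhat y :: "'n \<Rightarrow> nat \<Rightarrow> 'w \<Rightarrow> real^'d"
    and s :: "nat \<Rightarrow> real" and p :: ereal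
    and \<rho> \<rho>2 l \<nu> r C \<delta> \<alpha> \<beta> \<gamma> \<omega> \<tau>1 \<epsilon> e9 e10 e12 m :: real
  assumes "CARD('n) \<ge> 2"
    and "adjacency A" and "connected_graph A"
    and "L = laplacian A" and "\<rho> = spectral_radius L" and "\<rho>2 = least_pos_eigenvalue L"
    and "\<And>i z. f i differentiable (at z)"
    and "l > 0" and "\<And>i z z'. norm (gradient (f i) z - gradient (f i) z') \<le> l * norm (z - z')"
    and "favg = (\<lambda>z. agent_avg (\<lambda>i. f i z))"
    and "bdd_below (range favg)" and "fstar = (INF z. favg z)"
    and "\<nu> > 0" and "\<And>z. 1 / 2 * (norm (gradient favg z))\<^sup>2 \<ge> \<nu> * (favg z - fstar)"
    and "r > 0" and "C > 0" and "0 < \<delta>" and "\<delta> \<le> 1"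
    and "globally_bounded_compressor D Q r \<delta> C"
    and "prob_space M" and "fresh_seeds M D \<xi>"
    and "\<And>w. w \<in> space M \<Longrightarrow>
           unified_compression_algorithm L (\<lambda>i. gradient (f i)) (\<lambda>i k. Q (\<xi> (i, k) w))
             \<alpha> \<beta> \<gamma> \<omega> s x0
             (\<lambda>i k. x i k w) (\<lambda>i k. v i k w) (\<lambda>i k. q i k w) (\<lambda>i k. xhat i k w) (\<lambda>i k. y i k w)"
    and "e9 = eps9 \<omega> r \<delta>" and "e10 = eps10 e9" and "e12 = eps12 e9"
    and "0 < \<alpha>" and "\<alpha> < kappa0hat' \<rho> \<rho>2 l e10 e12 \<beta> \<gamma>"
    and "\<tau>1 \<ge> kappa1 \<rho>2" and "\<beta> = \<tau>1 * \<gamma>" and "\<gamma> > kappa2 \<rho>2 l"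
    and "0 < \<omega>" and "\<omega> \<le> 1 / r"
    and "1 \<le> p" and "0 < s 0" and "(MAX i. p_norm p (x0 i)) \<le> s 0"
    and "0 < \<epsilon>" and "\<epsilon> < 1" and "\<And>k. s k = s 0 * \<epsilon> ^ k"
    and "m = max (1 - \<alpha> * eps6' \<rho> \<rho>2 l \<nu> e10 e12 \<tau>1 \<alpha> \<beta> \<gamma>) (\<epsilon>\<^sup>2)"
  shows "0 < m \<and> m < 1 \<and>
    (\<forall>\<epsilon>hat\<in>{m<..<1}. \<exists>c. \<forall>k.
       integrable M (\<lambda>w. favg (agent_avg (\<lambda>i. x i k w)) - fstar +
         agent_avg (\<lambda>i. (norm (x i k w - agent_avg (\<lambda>j. x j k w)))\<^sup>2)) \<and>
       (LINT w|M. (favg (agent_avg (\<lambda>i. x i k w)) - fstar +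
         agent_avg (\<lambda>i. (norm (x i k w - agent_avg (\<lambda>j. x j k w)))\<^sup>2))) \<le> c * \<epsilon>hat ^ k)"
proof -
  have e9: "0 < e9" "e9 \<le> 1 / 2"
  proof -
    have "\<omega> * r \<le> 1"
      using \<open>\<omega> \<le> 1 / r\<close> \<open>r > 0\<close> by (simp add: pos_le_divide_eq)
    then have "\<omega> * r * \<delta> \<le> 1 * 1"
      using \<open>0 < \<delta>\<close> \<open>\<delta> \<le> 1\<close> by (intro mult_mono) auto
    then show "e9 \<le> 1 / 2"
      by (simp add: \<open>e9 = eps9 \<omega> r \<delta>\<close> eps9_def)
    show "0 < e9"
      using \<open>0 < \<omega>\<close> \<open>r > 0\<close> \<open>0 < \<delta>\<close> by (simp add: \<open>e9 = eps9 \<omega> r \<delta>\<close> eps9_def)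
  qed
  have gd: "GDERIV (f i) z :> gradient (f i) z" for i z
    using \<open>\<And>i z. f i differentiable (at z)\<close> by (rule gderiv_gradient)
  have grad_favg: "gradient favg z = agent_avg (\<lambda>i. gradient (f i) z)" for z
  proof -
    have "GDERIV favg z :> agent_avg (\<lambda>i. gradient (f i) z)"
      unfolding \<open>favg = _\<close> using gd by (rule gderiv_agent_avg)
    then show ?thesis
      by (rule gradient_eqI)
  qed
  have spectrum: "\<rho> = spectral_radius (laplacian A)" "\<rho>2 = least_pos_eigenvalue (laplacian A)"
    by (simp_all only: \<open>\<rho> = spectral_radius L\<close> \<open>\<rho>2 = least_pos_eigenvalue L\<close> \<open>L = laplacian A\<close>)
  note run = assms(22)[unfolded \<open>L = laplacian A\<close>]
  have lower: "0 < \<rho>2" "\<rho>2 \<le> \<rho>"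
    using least_pos_eigenvalue_laplacian[OF assms(2,3,1)] by (simp_all only: spectrum)
  interpret random_network \<rho> \<rho>2 l \<nu> e9 e10 e12 \<tau>1 \<alpha> \<beta> \<gamma> A fstar f M D Q \<xi> r \<delta> C \<omega> s x0 x v q xhat y
  proof (intro random_network.intro random_network_axioms.intro compressed_network.intro
      compressed_network_axioms.intro parameters.intro)
    show "0 < s k" for k
      using \<open>\<And>k. s k = s 0 * \<epsilon> ^ k\<close>[of k] \<open>0 < s 0\<close> \<open>0 < \<epsilon>\<close> by (metis mult_pos_pos zero_less_power)
    show "fstar \<le> agent_avg (\<lambda>i. f i z)" for z
      unfolding \<open>fstar = _\<close> using cINF_lower[OF \<open>bdd_below (range favg)\<close>, of z] by (simp add: \<open>favg = _\<close>)
    show "\<nu> * (agent_avg (\<lambda>i. f i z) - fstar) \<le> 1 / 2 * (norm (agent_avg (\<lambda>i. gradient (f i) z)))\<^sup>2" for z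
      using assms(14)[of z] by (simp only: grad_favg) (simp add: \<open>favg = _\<close>)
  qed (fact+)
  \<comment> \<open>Positivity comes from the entry with the square of \<epsilon>, the bound by 1
    from \<open>\<epsilon> < 1\<close> and the positivity of \<open>eps6'\<close>.\<close>
  have m: "0 < m" "m < 1"
    using \<open>0 < \<epsilon>\<close> \<open>\<epsilon> < 1\<close> \<alpha>(1) eps6'_pos by (auto simp: \<open>m = _\<close> less_max_iff_disj abs_square_less_1 power_strict_mono)
  show ?thesis
  proof (intro conjI ballI m)
    fix \<epsilon>hat
    assume \<epsilon>hat: "\<epsilon>hat \<in> {m<..<1}"
    have gap: "optimality_gap k = (\<lambda>w. favg (agent_avg (\<lambda>i. x i k w)) - fstar +
         agent_avg (\<lambda>i. (norm (x i k w - agent_avg (\<lambda>j. x j k w)))\<^sup>2))" for k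
      by (simp add: optimality_gap_def fun_eq_iff favg_def \<open>favg = _\<close>)
    have "\<exists>c. \<forall>k. integrable M (optimality_gap k) \<and> (LINT w|M. optimality_gap k w) \<le> c * \<epsilon>hat ^ k"
    proof (rule optimality_gap_decay)
      show "1 - \<alpha> * eps6' \<rho> \<rho>2 l \<nu> e10 e12 \<tau>1 \<alpha> \<beta> \<gamma> \<le> m" "\<epsilon>\<^sup>2 \<le> m"
        by (simp_all add: \<open>m = _\<close>)
      show "m < \<epsilon>hat" "\<epsilon>hat < 1"
        using \<epsilon>hat by simp_all
      show "s k = s 0 * \<epsilon> ^ k" for k
        by fact
    qed
    then show "\<exists>c. \<forall>k.
       integrable M (\<lambda>w. favg (agent_avg (\<lambda>i. x i k w)) - fstar +
         agent_avg (\<lambda>i. (norm (x i k w - agent_avg (\<lambda>j. x j k w)))\<^sup>2)) \<and>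
       (LINT w|M. (favg (agent_avg (\<lambda>i. x i k w)) - fstar +
         agent_avg (\<lambda>i. (norm (x i k w - agent_avg (\<lambda>j. x j k w)))\<^sup>2))) \<le> c * \<epsilon>hat ^ k"
      by (simp only: gap)
  qed
qed

end
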